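(* For any finitely complete category $\mathcal{C}$, there exists a $\mathcal{W}_{\mathcal{C}}$-algebra $$\mathsf{Spn}_{\mathcal{C}}\colon\mathcal{W}_{\mathcal{C}}\longrightarrow\mathbf{Cat}$$ for which the inhabitants of labeled boxes are spans in $\mathcal{C}$.
   Context: A $\mathcal{C}$-typed finite set is a finite set $X$ with a function $\tau\colon X\to\mathrm{ob}\,\mathcal{C}$; $\mathcal{C}$-typed functions are functions preserving types. If $\mathcal{C}$ has finite products, put $\widehat{X}=\prod_{x\in X}\tau(x)$. $\mathcal{W}_{\mathcal{C}}$ is the symmetric monoidal category of $\mathcal{C}$-labeled boxes and wiring diagrams. Objects (labeled boxes) are pairs $X=(X^{\mathrm{in}},X^{\mathrm{out}})$ of $\mathcal{C}$-typed finite sets. A morphism (wiring diagram) $\phi\colon X\to Y$ is a pair of typed functions $\phi^{\mathrm{in}}\colon X^{\mathrm{in}}\to X^{\mathrm{out}}+Y^{\mathrm{in}}$ and $\phi^{\mathrm{out}}\colon Y^{\mathrm{out}}\to X^{\mathrm{out}}$. The identity is (coproduct inclusion, identity). The composite $\omega=\psi\circ\phi$ with $\psi\colon Y\to Z$ has $\omega^{\mathrm{out}}=\phi^{\mathrm{out}}\circ\psi^{\mathrm{out}}$ and $\omega^{\mathrm{in}}$ equal to $$X^{\mathrm{in}}\xrightarrow{\phi^{\mathrm{in}}}X^{\mathrm{out}}+Y^{\mathrm{in}}\xrightarrow{1+\psi^{\mathrm{in}}}X^{\mathrm{out}}+Y^{\mathrm{out}}+Z^{\mathrm{in}}\xrightarrow{1+\phi^{\mathrm{out}}+1}X^{\mathrm{out}}+X^{\mathrm{out}}+Z^{\mathrm{in}}\xrightarrow{\nabla+1}X^{\mathrm{out}}+Z^{\mathrm{in}}.$$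 The tensor product is $X\oplus Y=(X^{\mathrm{in}}+Y^{\mathrm{in}},X^{\mathrm{out}}+Y^{\mathrm{out}})$ with unit $0=(\emptyset,\emptyset)$. A $\mathcal{W}_{\mathcal{C}}$-algebra is a symmetric lax monoidal functor $(\mathcal{W}_{\mathcal{C}},\oplus,0)\to(\mathbf{Cat},\times,\mathbf{1})$, understood in the pseudo sense: composites and identities are preserved, and the lax monoidal axioms hold, up to coherent natural isomorphism. For an algebra $F$ and a box $X$, the objects of the category $F(X)$ are called inhabitants of $X$. Here the inhabitants of a box $X$ are the spans $\widehat{X^{\mathrm{in}}}\leftarrow S\to\widehat{X^{\mathrm{out}}}$ in $\mathcal{C}$. *)

theory Defs
  imports Main
begin

section \<open>Categories, functors, natural isomorphisms\<close>

record ('o, 'm) cat =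
  Ob :: "'o set"
  Arr :: "'m set"
  Dom :: "'m \<Rightarrow> 'o"
  Cod :: "'m \<Rightarrow> 'o"
  Id :: "'o \<Rightarrow> 'm"
  Comp :: "'m \<Rightarrow> 'm \<Rightarrow> 'm"  (infixr "\<cdot>\<index>" 70)

definition hom :: "('o, 'm, 'z) cat_scheme \<Rightarrow> 'o \<Rightarrow> 'o \<Rightarrow> 'm set" where
  "hom C a b = {f \<in> Arr C. Dom C f = a \<and> Cod C f = b}"

locale category =
  fixes C :: "('o, 'm, 'z) cat_scheme" (structure)
  assumes dom_in_Ob: "f \<in> Arr C \<Longrightarrow> Dom C f \<in> Ob C"
    and cod_in_Ob: "f \<in> Arr C \<Longrightarrow> Cod C f \<in> Ob C"
    and Id_in_hom: "a \<in> Ob C \<Longrightarrow> Id C a \<in> hom C a a"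
    and Comp_in_hom: "f \<in> hom C a b \<Longrightarrow> g \<in> hom C b c \<Longrightarrow> g \<cdot> f \<in> hom C a c"
    and Comp_Id_left: "f \<in> hom C a b \<Longrightarrow> Id C b \<cdot> f = f"
    and Comp_Id_right: "f \<in> hom C a b \<Longrightarrow> f \<cdot> Id C a = f"
    and Comp_assoc: "f \<in> hom C a b \<Longrightarrow> g \<in> hom C b c \<Longrightarrow> h \<in> hom C c d \<Longrightarrow>
      (h \<cdot> g) \<cdot> f = h \<cdot> (g \<cdot> f)"

definition is_iso :: "('o, 'm, 'z) cat_scheme \<Rightarrow> 'm \<Rightarrow> bool" where
  "is_iso C f \<longleftrightarrow> f \<in> Arr C \<and>
    (\<exists>g \<in> hom C (Cod C f) (Dom C f). g \<cdot>\<^bsub>C\<^esub> f = Id C (Dom C f) \<and> f \<cdot>\<^bsub>C\<^esub> g = Id C (Cod C f))"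

record ('a, 'b, 'c, 'd) func =
  on_ob :: "'a \<Rightarrow> 'c"
  on_arr :: "'b \<Rightarrow> 'd"

definition is_functor ::
  "('a, 'b, 'y) cat_scheme \<Rightarrow> ('c, 'd, 'z) cat_scheme \<Rightarrow> ('a, 'b, 'c, 'd) func \<Rightarrow> bool" where
  "is_functor C D F \<longleftrightarrow> category C \<and> category D \<and>
    (\<forall>a \<in> Ob C. on_ob F a \<in> Ob D) \<and>
    (\<forall>a b. \<forall>f \<in> hom C a b. on_arr F f \<in> hom D (on_ob F a) (on_ob F b)) \<and>
    (\<forall>a \<in> Ob C. on_arr F (Id C a) = Id D (on_ob F a)) \<and>
    (\<forall>a b c. \<forall>f \<in> hom C a b. \<forall>g \<in> hom C b c.
      on_arr F (g \<cdot>\<^bsub>C\<^esub> f) = on_arr F g \<cdot>\<^bsub>D\<^esub> on_arr F f)"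

definition is_nat_iso ::
  "('a, 'b, 'y) cat_scheme \<Rightarrow> ('c, 'd, 'z) cat_scheme \<Rightarrow>
   ('a, 'b, 'c, 'd) func \<Rightarrow> ('a, 'b, 'c, 'd) func \<Rightarrow> ('a \<Rightarrow> 'd) \<Rightarrow> bool" where
  "is_nat_iso C D F G \<theta> \<longleftrightarrow> is_functor C D F \<and> is_functor C D G \<and>
    (\<forall>a \<in> Ob C. \<theta> a \<in> hom D (on_ob F a) (on_ob G a) \<and> is_iso D (\<theta> a)) \<and>
    (\<forall>a b. \<forall>f \<in> hom C a b. on_arr G f \<cdot>\<^bsub>D\<^esub> \<theta> a = \<theta> b \<cdot>\<^bsub>D\<^esub> on_arr F f)"

definition id_func :: "('a, 'b, 'a, 'b) func" where
  "id_func = \<lparr>on_ob = (\<lambda>a. a), on_arr = (\<lambda>f. f)\<rparr>"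

definition comp_func ::
  "('c, 'd, 'e, 'f) func \<Rightarrow> ('a, 'b, 'c, 'd) func \<Rightarrow> ('a, 'b, 'e, 'f) func"
  (infixr "\<circ>\<^sub>F" 55) where
  "G \<circ>\<^sub>F F = \<lparr>on_ob = on_ob G \<circ> on_ob F, on_arr = on_arr G \<circ> on_arr F\<rparr>"

text \<open>The cartesian monoidal structure of \<open>Cat\<close>: products of categories and of functors, the
  terminal category, and the structure isomorphisms (given by their inverses where this is the
  direction needed below).\<close>

definition prod_cat ::
  "('a, 'b, 'y) cat_scheme \<Rightarrow> ('c, 'd, 'z) cat_scheme \<Rightarrow> ('a \<times> 'c, 'b \<times> 'd) cat"
  (infixr "\<times>\<^sub>C" 80) where
  "C \<times>\<^sub>C D = \<lparr>Ob = Ob C \<times> Ob D, Arr = Arr C \<times> Arr D,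
     Dom = map_prod (Dom C) (Dom D), Cod = map_prod (Cod C) (Cod D),
     Id = map_prod (Id C) (Id D),
     Comp = (\<lambda>(g, g') (f, f'). (g \<cdot>\<^bsub>C\<^esub> f, g' \<cdot>\<^bsub>D\<^esub> f'))\<rparr>"

definition prod_func ::
  "('a, 'b, 'c, 'd) func \<Rightarrow> ('a2, 'b2, 'c2, 'd2) func \<Rightarrow>
   ('a \<times> 'a2, 'b \<times> 'b2, 'c \<times> 'c2, 'd \<times> 'd2) func" (infixr "\<times>\<^sub>F" 80) where
  "F \<times>\<^sub>F G = \<lparr>on_ob = map_prod (on_ob F) (on_ob G), on_arr = map_prod (on_arr F) (on_arr G)\<rparr>"

definition one_cat :: "(unit, unit) cat" where
  "one_cat = \<lparr>Ob = UNIV, Arr = UNIV, Dom = (\<lambda>_. ()), Cod = (\<lambda>_. ()), Id = (\<lambda>_. ()),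
     Comp = (\<lambda>_ _. ())\<rparr>"

definition reassoc_func ::
  "('a \<times> 'b \<times> 'c, 'd \<times> 'e \<times> 'f, ('a \<times> 'b) \<times> 'c, ('d \<times> 'e) \<times> 'f) func" where
  "reassoc_func = \<lparr>on_ob = (\<lambda>(a, b, c). ((a, b), c)), on_arr = (\<lambda>(f, g, h). ((f, g), h))\<rparr>"

definition swap_func :: "('a \<times> 'b, 'c \<times> 'd, 'b \<times> 'a, 'd \<times> 'c) func" where
  "swap_func = \<lparr>on_ob = prod.swap, on_arr = prod.swap\<rparr>"

definition left_one_func :: "('a, 'b, unit \<times> 'a, unit \<times> 'b) func" where
  "left_one_func = \<lparr>on_ob = Pair (), on_arr = Pair ()\<rparr>"

definition right_one_func :: "('a, 'b, 'a \<times> unit, 'b \<times> unit) func" where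
  "right_one_func = \<lparr>on_ob = (\<lambda>a. (a, ())), on_arr = (\<lambda>f. (f, ()))\<rparr>"


section \<open>Finite limits\<close>

definition is_cone ::
  "('o, 'm) cat \<Rightarrow> ('j, 'k) cat \<Rightarrow> ('j, 'k, 'o, 'm) func \<Rightarrow> 'o \<Rightarrow> ('j \<Rightarrow> 'm) \<Rightarrow> bool" where
  "is_cone C J D L p \<longleftrightarrow> L \<in> Ob C \<and> (\<forall>j \<in> Ob J. p j \<in> hom C L (on_ob D j)) \<and>
    (\<forall>i j. \<forall>u \<in> hom J i j. on_arr D u \<cdot>\<^bsub>C\<^esub> p i = p j)"

definition is_limit ::
  "('o, 'm) cat \<Rightarrow> ('j, 'k) cat \<Rightarrow> ('j, 'k, 'o, 'm) func \<Rightarrow> 'o \<Rightarrow> ('j \<Rightarrow> 'm) \<Rightarrow> bool" where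
  "is_limit C J D L p \<longleftrightarrow> is_cone C J D L p \<and>
    (\<forall>Q q. is_cone C J D Q q \<longrightarrow>
      (\<exists>!h. h \<in> hom C Q L \<and> (\<forall>j \<in> Ob J. p j \<cdot>\<^bsub>C\<^esub> h = q j)))"

text \<open>Every finite category is isomorphic to one whose objects and arrows are natural numbers, so
  taking the index categories over \<^typ>\<open>nat\<close> is no restriction.\<close>

definition finitely_complete :: "('o, 'm) cat \<Rightarrow> bool" where
  "finitely_complete C \<longleftrightarrow>
    (\<forall>(J :: (nat, nat) cat) D. finite (Ob J) \<and> finite (Arr J) \<and> is_functor J C D \<longrightarrow>
      (\<exists>L p. is_limit C J D L p))"


section \<open>Symmetric monoidal categories\<close>

record ('o, 'm) moncat = "('o, 'm) cat" +
  tens_ob :: "'o \<Rightarrow> 'o \<Rightarrow> 'o"  (infixr "\<oplus>\<index>" 75)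
  tens_arr :: "'m \<Rightarrow> 'm \<Rightarrow> 'm"  (infixr "\<boxplus>\<index>" 75)
  tens_unit :: 'o
  assoc :: "'o \<Rightarrow> 'o \<Rightarrow> 'o \<Rightarrow> 'm"
  lunit :: "'o \<Rightarrow> 'm"
  runit :: "'o \<Rightarrow> 'm"
  braid :: "'o \<Rightarrow> 'o \<Rightarrow> 'm"

locale symmetric_monoidal = category V
  for V :: "('x, 'w, 'z) moncat_scheme" (structure) +
  assumes tens_functor:
      "is_functor (V \<times>\<^sub>C V) V \<lparr>on_ob = (\<lambda>(X, Y). X \<oplus> Y), on_arr = (\<lambda>(\<phi>, \<psi>). \<phi> \<boxplus> \<psi>)\<rparr>"
    and unit_in_Ob: "tens_unit V \<in> Ob V"
    and assoc_iso: "\<lbrakk>X \<in> Ob V; Y \<in> Ob V; Z \<in> Ob V\<rbrakk> \<Longrightarrow>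
      assoc V X Y Z \<in> hom V ((X \<oplus> Y) \<oplus> Z) (X \<oplus> (Y \<oplus> Z)) \<and> is_iso V (assoc V X Y Z)"
    and lunit_iso: "X \<in> Ob V \<Longrightarrow> lunit V X \<in> hom V (tens_unit V \<oplus> X) X \<and> is_iso V (lunit V X)"
    and runit_iso: "X \<in> Ob V \<Longrightarrow> runit V X \<in> hom V (X \<oplus> tens_unit V) X \<and> is_iso V (runit V X)"
    and braid_iso: "\<lbrakk>X \<in> Ob V; Y \<in> Ob V\<rbrakk> \<Longrightarrow>
      braid V X Y \<in> hom V (X \<oplus> Y) (Y \<oplus> X) \<and> is_iso V (braid V X Y)"
    and assoc_natural: "\<lbrakk>\<phi> \<in> hom V X X'; \<psi> \<in> hom V Y Y'; \<chi> \<in> hom V Z Z'\<rbrakk> \<Longrightarrow>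
      assoc V X' Y' Z' \<cdot> ((\<phi> \<boxplus> \<psi>) \<boxplus> \<chi>) = (\<phi> \<boxplus> (\<psi> \<boxplus> \<chi>)) \<cdot> assoc V X Y Z"
    and lunit_natural: "\<phi> \<in> hom V X X' \<Longrightarrow>
      lunit V X' \<cdot> (Id V (tens_unit V) \<boxplus> \<phi>) = \<phi> \<cdot> lunit V X"
    and runit_natural: "\<phi> \<in> hom V X X' \<Longrightarrow>
      runit V X' \<cdot> (\<phi> \<boxplus> Id V (tens_unit V)) = \<phi> \<cdot> runit V X"
    and braid_natural: "\<lbrakk>\<phi> \<in> hom V X X'; \<psi> \<in> hom V Y Y'\<rbrakk> \<Longrightarrow>
      braid V X' Y' \<cdot> (\<phi> \<boxplus> \<psi>) = (\<psi> \<boxplus> \<phi>) \<cdot> braid V X Y"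
    and pentagon: "\<lbrakk>X \<in> Ob V; Y \<in> Ob V; Z \<in> Ob V; T \<in> Ob V\<rbrakk> \<Longrightarrow>
      assoc V X Y (Z \<oplus> T) \<cdot> assoc V (X \<oplus> Y) Z T =
      (Id V X \<boxplus> assoc V Y Z T) \<cdot> (assoc V X (Y \<oplus> Z) T \<cdot> (assoc V X Y Z \<boxplus> Id V T))"
    and triangle: "\<lbrakk>X \<in> Ob V; Y \<in> Ob V\<rbrakk> \<Longrightarrow>
      (Id V X \<boxplus> lunit V Y) \<cdot> assoc V X (tens_unit V) Y = runit V X \<boxplus> Id V Y"
    and hexagon: "\<lbrakk>X \<in> Ob V; Y \<in> Ob V; Z \<in> Ob V\<rbrakk> \<Longrightarrow>
      assoc V Y Z X \<cdot> (braid V X (Y \<oplus> Z) \<cdot> assoc V X Y Z) =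
      (Id V Y \<boxplus> braid V X Z) \<cdot> (assoc V Y X Z \<cdot> (braid V X Y \<boxplus> Id V Z))"
    and symmetry: "\<lbrakk>X \<in> Ob V; Y \<in> Ob V\<rbrakk> \<Longrightarrow> braid V Y X \<cdot> braid V X Y = Id V (X \<oplus> Y)"


section \<open>Symmetric lax monoidal pseudofunctors to \<open>Cat\<close>\<close>

text \<open>
  The data of a symmetric lax monoidal pseudofunctor \<open>(V, \<oplus>, 0) \<rightarrow> (Cat, \<times>, 1)\<close>, where \<open>V\<close> is
  regarded as a bicategory with only identity 2-cells. All coherence cells are invertible, and are
  oriented so that the action of arrows of \<open>V\<close> moves outwards:
    \<^item> \<open>comp_cell \<psi> \<phi> a : F \<psi> (F \<phi> a) \<rightarrow> F (\<psi> \<cdot> \<phi>) a\<close> and \<open>id_cell X a : a \<rightarrow> F id a\<close>;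
    \<^item> \<open>mult_cell \<phi> \<psi> (a, b) : \<mu> (F \<phi> a, F \<psi> b) \<rightarrow> F (\<phi> \<boxplus> \<psi>) (\<mu> (a, b))\<close>;
    \<^item> \<open>assoc_cell X Y Z (a, b, c) : \<mu> (a, \<mu> (b, c)) \<rightarrow> F assoc (\<mu> (\<mu> (a, b), c))\<close>;
    \<^item> \<open>lunit_cell X a : a \<rightarrow> F lunit (\<mu> (\<eta>, a))\<close> and \<open>runit_cell X a : a \<rightarrow> F runit (\<mu> (a, \<eta>))\<close>;
    \<^item> \<open>braid_cell X Y (a, b) : \<mu> (b, a) \<rightarrow> F braid (\<mu> (a, b))\<close>.
\<close>

record ('x, 'w, 'a, 'b) lax_data =
  cat_of :: "'x \<Rightarrow> ('a, 'b) cat"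
  fun_of :: "'w \<Rightarrow> ('a, 'b, 'a, 'b) func"
  comp_cell :: "'w \<Rightarrow> 'w \<Rightarrow> 'a \<Rightarrow> 'b"
  id_cell :: "'x \<Rightarrow> 'a \<Rightarrow> 'b"
  mult :: "'x \<Rightarrow> 'x \<Rightarrow> ('a \<times> 'a, 'b \<times> 'b, 'a, 'b) func"
  unit_fun :: "(unit, unit, 'a, 'b) func"
  mult_cell :: "'w \<Rightarrow> 'w \<Rightarrow> 'a \<times> 'a \<Rightarrow> 'b"
  assoc_cell :: "'x \<Rightarrow> 'x \<Rightarrow> 'x \<Rightarrow> 'a \<times> 'a \<times> 'a \<Rightarrow> 'b"
  lunit_cell :: "'x \<Rightarrow> 'a \<Rightarrow> 'b"
  runit_cell :: "'x \<Rightarrow> 'a \<Rightarrow> 'b"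
  braid_cell :: "'x \<Rightarrow> 'x \<Rightarrow> 'a \<times> 'a \<Rightarrow> 'b"

locale pseudofunctor_to_Cat = category V
  for V :: "('x, 'w, 'z) cat_scheme" (structure) +
  fixes F :: "('x, 'w, 'a, 'b) lax_data"
begin

abbreviation act_ob :: "'w \<Rightarrow> 'a \<Rightarrow> 'a" (infixr "\<star>" 80) where
  "\<phi> \<star> a \<equiv> on_ob (fun_of F \<phi>) a"

abbreviation act_arr :: "'w \<Rightarrow> 'b \<Rightarrow> 'b" (infixr "\<odot>" 80) where
  "\<phi> \<odot> f \<equiv> on_arr (fun_of F \<phi>) f"

abbreviation comp_at :: "'b \<Rightarrow> 'x \<Rightarrow> 'b \<Rightarrow> 'b" ("(_ \<bullet>\<^bsub>_\<^esub>/ _)" [56, 0, 55] 55) where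
  "g \<bullet>\<^bsub>X\<^esub> f \<equiv> Comp (cat_of F X) g f"

abbreviation one_at :: "'x \<Rightarrow> 'a \<Rightarrow> 'b" where
  "one_at X a \<equiv> Id (cat_of F X) a"

end

locale pseudofunctor = pseudofunctor_to_Cat V F
  for V :: "('x, 'w, 'z) cat_scheme" (structure)
  and F :: "('x, 'w, 'a, 'b) lax_data" +
  assumes cat_of: "X \<in> Ob V \<Longrightarrow> category (cat_of F X)"
    and fun_of: "\<phi> \<in> hom V X Y \<Longrightarrow> is_functor (cat_of F X) (cat_of F Y) (fun_of F \<phi>)"
    and comp_cell: "\<lbrakk>\<phi> \<in> hom V X Y; \<psi> \<in> hom V Y Z\<rbrakk> \<Longrightarrow>
      is_nat_iso (cat_of F X) (cat_of F Z)
        (fun_of F \<psi> \<circ>\<^sub>F fun_of F \<phi>) (fun_of F (\<psi> \<cdot> \<phi>)) (comp_cell F \<psi> \<phi>)"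
    and id_cell: "X \<in> Ob V \<Longrightarrow>
      is_nat_iso (cat_of F X) (cat_of F X) id_func (fun_of F (Id V X)) (id_cell F X)"
    and comp_cell_assoc:
      "\<lbrakk>\<phi> \<in> hom V X Y; \<psi> \<in> hom V Y Z; \<chi> \<in> hom V Z T; a \<in> Ob (cat_of F X)\<rbrakk> \<Longrightarrow>
       comp_cell F \<chi> (\<psi> \<cdot> \<phi>) a \<bullet>\<^bsub>T\<^esub> \<chi> \<odot> comp_cell F \<psi> \<phi> a =
       comp_cell F (\<chi> \<cdot> \<psi>) \<phi> a \<bullet>\<^bsub>T\<^esub> comp_cell F \<chi> \<psi> (\<phi> \<star> a)"
    and comp_cell_id_right: "\<lbrakk>\<phi> \<in> hom V X Y; a \<in> Ob (cat_of F X)\<rbrakk> \<Longrightarrow>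
       comp_cell F \<phi> (Id V X) a \<bullet>\<^bsub>Y\<^esub> \<phi> \<odot> id_cell F X a = one_at Y (\<phi> \<star> a)"
    and comp_cell_id_left: "\<lbrakk>\<phi> \<in> hom V X Y; a \<in> Ob (cat_of F X)\<rbrakk> \<Longrightarrow>
       comp_cell F (Id V Y) \<phi> a \<bullet>\<^bsub>Y\<^esub> id_cell F Y (\<phi> \<star> a) = one_at Y (\<phi> \<star> a)"

locale pseudofunctor_with_mult = symmetric_monoidal V + pseudofunctor V F
  for V :: "('x, 'w, 'z) moncat_scheme" (structure)
  and F :: "('x, 'w, 'a, 'b) lax_data" +
  assumes mult: "\<lbrakk>X \<in> Ob V; Y \<in> Ob V\<rbrakk> \<Longrightarrow>
      is_functor (cat_of F X \<times>\<^sub>C cat_of F Y) (cat_of F (X \<oplus> Y)) (mult F X Y)"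
    and unit_fun: "is_functor one_cat (cat_of F (tens_unit V)) (unit_fun F)"
    and mult_cell: "\<lbrakk>\<phi> \<in> hom V X X'; \<psi> \<in> hom V Y Y'\<rbrakk> \<Longrightarrow>
      is_nat_iso (cat_of F X \<times>\<^sub>C cat_of F Y) (cat_of F (X' \<oplus> Y'))
        (mult F X' Y' \<circ>\<^sub>F (fun_of F \<phi> \<times>\<^sub>F fun_of F \<psi>)) (fun_of F (\<phi> \<boxplus> \<psi>) \<circ>\<^sub>F mult F X Y)
        (mult_cell F \<phi> \<psi>)"
begin

abbreviation mu :: "'x \<Rightarrow> 'x \<Rightarrow> 'a \<Rightarrow> 'a \<Rightarrow> 'a" where
  "mu X Y a b \<equiv> on_ob (mult F X Y) (a, b)"

abbreviation mu_arr :: "'x \<Rightarrow> 'x \<Rightarrow> 'b \<Rightarrow> 'b \<Rightarrow> 'b" where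
  "mu_arr X Y f g \<equiv> on_arr (mult F X Y) (f, g)"

abbreviation eta :: 'a where
  "eta \<equiv> on_ob (unit_fun F) ()"

text \<open>The composites \<open>\<mu> (a, F \<phi> b) \<rightarrow> F (id \<boxplus> \<phi>) (\<mu> (a, b))\<close> and
  \<open>\<mu> (F \<phi> a, b) \<rightarrow> F (\<phi> \<boxplus> id) (\<mu> (a, b))\<close>.\<close>

definition whisker_left :: "'x \<Rightarrow> 'w \<Rightarrow> 'a \<Rightarrow> 'a \<Rightarrow> 'b" where
  "whisker_left X \<phi> a b =
    mult_cell F (Id V X) \<phi> (a, b) \<bullet>\<^bsub>X \<oplus> Cod V \<phi>\<^esub>
    mu_arr X (Cod V \<phi>) (id_cell F X a) (one_at (Cod V \<phi>) (\<phi> \<star> b))"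

definition whisker_right :: "'w \<Rightarrow> 'x \<Rightarrow> 'a \<Rightarrow> 'a \<Rightarrow> 'b" where
  "whisker_right \<phi> Y a b =
    mult_cell F \<phi> (Id V Y) (a, b) \<bullet>\<^bsub>Cod V \<phi> \<oplus> Y\<^esub>
    mu_arr (Cod V \<phi>) Y (one_at (Cod V \<phi>) (\<phi> \<star> a)) (id_cell F Y b)"

end

text \<open>
  The axioms \<open>mult_cell_comp\<close> and \<open>mult_cell_id\<close> say that \<open>\<mu>\<close> is pseudonatural; the axioms
  \<open>*_modification\<close> say that the families of coherence cells are modifications, i.e. natural with
  respect to the arrows of \<open>V\<close>. The last four axioms are the coherence conditions sitting over
  the pentagon, triangle, hexagon and symmetry equations of \<open>V\<close>. The condition over the
  other hexagon (for the inverse associator) is a consequence of the hexagon and symmetry ones.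
\<close>

locale symmetric_lax_monoidal_pseudofunctor = pseudofunctor_with_mult V F
  for V :: "('x, 'w, 'z) moncat_scheme" (structure)
  and F :: "('x, 'w, 'a, 'b) lax_data" +
  assumes mult_cell_comp:
      "\<lbrakk>\<phi> \<in> hom V X X'; \<phi>' \<in> hom V X' X''; \<psi> \<in> hom V Y Y'; \<psi>' \<in> hom V Y' Y'';
        a \<in> Ob (cat_of F X); b \<in> Ob (cat_of F Y)\<rbrakk> \<Longrightarrow>
       mult_cell F (\<phi>' \<cdot> \<phi>) (\<psi>' \<cdot> \<psi>) (a, b) \<bullet>\<^bsub>X'' \<oplus> Y''\<^esub>
         mu_arr X'' Y'' (comp_cell F \<phi>' \<phi> a) (comp_cell F \<psi>' \<psi> b) =
       comp_cell F (\<phi>' \<boxplus> \<psi>') (\<phi> \<boxplus> \<psi>) (mu X Y a b) \<bullet>\<^bsub>X'' \<oplus> Y''\<^esub>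
         (\<phi>' \<boxplus> \<psi>') \<odot> mult_cell F \<phi> \<psi> (a, b) \<bullet>\<^bsub>X'' \<oplus> Y''\<^esub>
         mult_cell F \<phi>' \<psi>' (\<phi> \<star> a, \<psi> \<star> b)"
    and mult_cell_id:
      "\<lbrakk>X \<in> Ob V; Y \<in> Ob V; a \<in> Ob (cat_of F X); b \<in> Ob (cat_of F Y)\<rbrakk> \<Longrightarrow>
       mult_cell F (Id V X) (Id V Y) (a, b) \<bullet>\<^bsub>X \<oplus> Y\<^esub>
         mu_arr X Y (id_cell F X a) (id_cell F Y b) =
       id_cell F (X \<oplus> Y) (mu X Y a b)"
    and assoc_cell: "\<lbrakk>X \<in> Ob V; Y \<in> Ob V; Z \<in> Ob V\<rbrakk> \<Longrightarrow>
      is_nat_iso (cat_of F X \<times>\<^sub>C cat_of F Y \<times>\<^sub>C cat_of F Z) (cat_of F (X \<oplus> (Y \<oplus> Z)))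
        (mult F X (Y \<oplus> Z) \<circ>\<^sub>F (id_func \<times>\<^sub>F mult F Y Z))
        (fun_of F (assoc V X Y Z) \<circ>\<^sub>F mult F (X \<oplus> Y) Z \<circ>\<^sub>F (mult F X Y \<times>\<^sub>F id_func)
          \<circ>\<^sub>F reassoc_func)
        (assoc_cell F X Y Z)"
    and lunit_cell: "X \<in> Ob V \<Longrightarrow>
      is_nat_iso (cat_of F X) (cat_of F X) id_func
        (fun_of F (lunit V X) \<circ>\<^sub>F mult F (tens_unit V) X \<circ>\<^sub>F (unit_fun F \<times>\<^sub>F id_func)
          \<circ>\<^sub>F left_one_func)
        (lunit_cell F X)"
    and runit_cell: "X \<in> Ob V \<Longrightarrow>
      is_nat_iso (cat_of F X) (cat_of F X) id_func
        (fun_of F (runit V X) \<circ>\<^sub>F mult F X (tens_unit V) \<circ>\<^sub>F (id_func \<times>\<^sub>F unit_fun F)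
          \<circ>\<^sub>F right_one_func)
        (runit_cell F X)"
    and braid_cell: "\<lbrakk>X \<in> Ob V; Y \<in> Ob V\<rbrakk> \<Longrightarrow>
      is_nat_iso (cat_of F X \<times>\<^sub>C cat_of F Y) (cat_of F (Y \<oplus> X))
        (mult F Y X \<circ>\<^sub>F swap_func) (fun_of F (braid V X Y) \<circ>\<^sub>F mult F X Y)
        (braid_cell F X Y)"
    and assoc_cell_modification:
      "\<lbrakk>\<phi> \<in> hom V X X'; \<psi> \<in> hom V Y Y'; \<chi> \<in> hom V Z Z';
        a \<in> Ob (cat_of F X); b \<in> Ob (cat_of F Y); c \<in> Ob (cat_of F Z);
        U = X' \<oplus> (Y' \<oplus> Z'); m = mu (X \<oplus> Y) Z (mu X Y a b) c\<rbrakk> \<Longrightarrow>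
       comp_cell F (assoc V X' Y' Z') ((\<phi> \<boxplus> \<psi>) \<boxplus> \<chi>) m \<bullet>\<^bsub>U\<^esub>
         assoc V X' Y' Z' \<odot> mult_cell F (\<phi> \<boxplus> \<psi>) \<chi> (mu X Y a b, c) \<bullet>\<^bsub>U\<^esub>
         assoc V X' Y' Z' \<odot>
           mu_arr (X' \<oplus> Y') Z' (mult_cell F \<phi> \<psi> (a, b)) (one_at Z' (\<chi> \<star> c)) \<bullet>\<^bsub>U\<^esub>
         assoc_cell F X' Y' Z' (\<phi> \<star> a, \<psi> \<star> b, \<chi> \<star> c) =
       comp_cell F (\<phi> \<boxplus> (\<psi> \<boxplus> \<chi>)) (assoc V X Y Z) m \<bullet>\<^bsub>U\<^esub>
         (\<phi> \<boxplus> (\<psi> \<boxplus> \<chi>)) \<odot> assoc_cell F X Y Z (a, b, c) \<bullet>\<^bsub>U\<^esub>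
         mult_cell F \<phi> (\<psi> \<boxplus> \<chi>) (a, mu Y Z b c) \<bullet>\<^bsub>U\<^esub>
         mu_arr X' (Y' \<oplus> Z') (one_at X' (\<phi> \<star> a)) (mult_cell F \<psi> \<chi> (b, c))"
    and lunit_cell_modification:
      "\<lbrakk>\<phi> \<in> hom V X X'; a \<in> Ob (cat_of F X); m = mu (tens_unit V) X eta a\<rbrakk> \<Longrightarrow>
       comp_cell F (lunit V X') (Id V (tens_unit V) \<boxplus> \<phi>) m \<bullet>\<^bsub>X'\<^esub>
         lunit V X' \<odot> whisker_left (tens_unit V) \<phi> eta a \<bullet>\<^bsub>X'\<^esub>
         lunit_cell F X' (\<phi> \<star> a) =
       comp_cell F \<phi> (lunit V X) m \<bullet>\<^bsub>X'\<^esub> \<phi> \<odot> lunit_cell F X a"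
    and runit_cell_modification:
      "\<lbrakk>\<phi> \<in> hom V X X'; a \<in> Ob (cat_of F X); m = mu X (tens_unit V) a eta\<rbrakk> \<Longrightarrow>
       comp_cell F (runit V X') (\<phi> \<boxplus> Id V (tens_unit V)) m \<bullet>\<^bsub>X'\<^esub>
         runit V X' \<odot> whisker_right \<phi> (tens_unit V) a eta \<bullet>\<^bsub>X'\<^esub>
         runit_cell F X' (\<phi> \<star> a) =
       comp_cell F \<phi> (runit V X) m \<bullet>\<^bsub>X'\<^esub> \<phi> \<odot> runit_cell F X a"
    and braid_cell_modification:
      "\<lbrakk>\<phi> \<in> hom V X X'; \<psi> \<in> hom V Y Y'; a \<in> Ob (cat_of F X); b \<in> Ob (cat_of F Y);
        U = Y' \<oplus> X'; m = mu X Y a b\<rbrakk> \<Longrightarrow>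
       comp_cell F (braid V X' Y') (\<phi> \<boxplus> \<psi>) m \<bullet>\<^bsub>U\<^esub>
         braid V X' Y' \<odot> mult_cell F \<phi> \<psi> (a, b) \<bullet>\<^bsub>U\<^esub>
         braid_cell F X' Y' (\<phi> \<star> a, \<psi> \<star> b) =
       comp_cell F (\<psi> \<boxplus> \<phi>) (braid V X Y) m \<bullet>\<^bsub>U\<^esub>
         (\<psi> \<boxplus> \<phi>) \<odot> braid_cell F X Y (a, b) \<bullet>\<^bsub>U\<^esub>
         mult_cell F \<psi> \<phi> (b, a)"
    and pentagon_coherence:
      "\<lbrakk>X \<in> Ob V; Y \<in> Ob V; Z \<in> Ob V; T \<in> Ob V; a \<in> Ob (cat_of F X); b \<in> Ob (cat_of F Y);
        c \<in> Ob (cat_of F Z); d \<in> Ob (cat_of F T);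
        U = X \<oplus> (Y \<oplus> (Z \<oplus> T));
        \<alpha> = assoc V X Y (Z \<oplus> T); \<alpha>' = assoc V (X \<oplus> Y) Z T;
        \<beta> = Id V X \<boxplus> assoc V Y Z T; \<beta>' = assoc V X (Y \<oplus> Z) T; \<beta>'' = assoc V X Y Z \<boxplus> Id V T;
        abc = mu (X \<oplus> Y) Z (mu X Y a b) c; m = mu ((X \<oplus> Y) \<oplus> Z) T abc d\<rbrakk> \<Longrightarrow>
       comp_cell F \<alpha> \<alpha>' m \<bullet>\<^bsub>U\<^esub>
         \<alpha> \<odot> assoc_cell F (X \<oplus> Y) Z T (mu X Y a b, c, d) \<bullet>\<^bsub>U\<^esub>
         assoc_cell F X Y (Z \<oplus> T) (a, b, mu Z T c d) =
       comp_cell F \<beta> (\<beta>' \<cdot> \<beta>'') m \<bullet>\<^bsub>U\<^esub>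
         \<beta> \<odot> comp_cell F \<beta>' \<beta>'' m \<bullet>\<^bsub>U\<^esub>
         \<beta> \<odot> \<beta>' \<odot> whisker_right (assoc V X Y Z) T abc d \<bullet>\<^bsub>U\<^esub>
         \<beta> \<odot> \<beta>' \<odot> mu_arr (X \<oplus> (Y \<oplus> Z)) T (assoc_cell F X Y Z (a, b, c)) (one_at T d) \<bullet>\<^bsub>U\<^esub>
         \<beta> \<odot> assoc_cell F X (Y \<oplus> Z) T (a, mu Y Z b c, d) \<bullet>\<^bsub>U\<^esub>
         whisker_left X (assoc V Y Z T) a (mu (Y \<oplus> Z) T (mu Y Z b c) d) \<bullet>\<^bsub>U\<^esub>
         mu_arr X (Y \<oplus> (Z \<oplus> T)) (one_at X a) (assoc_cell F Y Z T (b, c, d))"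
    and triangle_coherence:
      "\<lbrakk>X \<in> Ob V; Y \<in> Ob V; a \<in> Ob (cat_of F X); b \<in> Ob (cat_of F Y);
        I = tens_unit V; U = X \<oplus> Y; m = mu (X \<oplus> I) Y (mu X I a eta) b\<rbrakk> \<Longrightarrow>
       comp_cell F (Id V X \<boxplus> lunit V Y) (assoc V X I Y) m \<bullet>\<^bsub>U\<^esub>
         (Id V X \<boxplus> lunit V Y) \<odot> assoc_cell F X I Y (a, eta, b) \<bullet>\<^bsub>U\<^esub>
         whisker_left X (lunit V Y) a (mu I Y eta b) \<bullet>\<^bsub>U\<^esub>
         mu_arr X Y (one_at X a) (lunit_cell F Y b) =
       whisker_right (runit V X) Y (mu X I a eta) b \<bullet>\<^bsub>U\<^esub>
         mu_arr X Y (runit_cell F X a) (one_at Y b)"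
    and hexagon_coherence:
      "\<lbrakk>X \<in> Ob V; Y \<in> Ob V; Z \<in> Ob V; a \<in> Ob (cat_of F X); b \<in> Ob (cat_of F Y);
        c \<in> Ob (cat_of F Z);
        U = Y \<oplus> (Z \<oplus> X);
        \<alpha> = assoc V Y Z X; \<alpha>' = braid V X (Y \<oplus> Z); \<alpha>'' = assoc V X Y Z;
        \<beta> = Id V Y \<boxplus> braid V X Z; \<beta>' = assoc V Y X Z; \<beta>'' = braid V X Y \<boxplus> Id V Z;
        m = mu (X \<oplus> Y) Z (mu X Y a b) c\<rbrakk> \<Longrightarrow>
       comp_cell F \<alpha> (\<alpha>' \<cdot> \<alpha>'') m \<bullet>\<^bsub>U\<^esub>
         \<alpha> \<odot> comp_cell F \<alpha>' \<alpha>'' m \<bullet>\<^bsub>U\<^esub>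
         \<alpha> \<odot> \<alpha>' \<odot> assoc_cell F X Y Z (a, b, c) \<bullet>\<^bsub>U\<^esub>
         \<alpha> \<odot> braid_cell F X (Y \<oplus> Z) (a, mu Y Z b c) \<bullet>\<^bsub>U\<^esub>
         assoc_cell F Y Z X (b, c, a) =
       comp_cell F \<beta> (\<beta>' \<cdot> \<beta>'') m \<bullet>\<^bsub>U\<^esub>
         \<beta> \<odot> comp_cell F \<beta>' \<beta>'' m \<bullet>\<^bsub>U\<^esub>
         \<beta> \<odot> \<beta>' \<odot> whisker_right (braid V X Y) Z (mu X Y a b) c \<bullet>\<^bsub>U\<^esub>
         \<beta> \<odot> \<beta>' \<odot> mu_arr (Y \<oplus> X) Z (braid_cell F X Y (a, b)) (one_at Z c) \<bullet>\<^bsub>U\<^esub>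
         \<beta> \<odot> assoc_cell F Y X Z (b, a, c) \<bullet>\<^bsub>U\<^esub>
         whisker_left Y (braid V X Z) b (mu X Z a c) \<bullet>\<^bsub>U\<^esub>
         mu_arr Y (Z \<oplus> X) (one_at Y b) (braid_cell F X Z (a, c))"
    and symmetry_coherence:
      "\<lbrakk>X \<in> Ob V; Y \<in> Ob V; a \<in> Ob (cat_of F X); b \<in> Ob (cat_of F Y); U = X \<oplus> Y\<rbrakk> \<Longrightarrow>
       comp_cell F (braid V Y X) (braid V X Y) (mu X Y a b) \<bullet>\<^bsub>U\<^esub>
         braid V Y X \<odot> braid_cell F X Y (a, b) \<bullet>\<^bsub>U\<^esub>
         braid_cell F Y X (b, a) =
       id_cell F U (mu X Y a b)"


section \<open>Labeled boxes and wiring diagrams\<close>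

text \<open>The elements of typed finite sets are drawn from a universe that is closed under tagging, so
  that coproducts of finite sets are literal disjoint unions; \<^typ>\<open>'u\<close> is arbitrary.\<close>

datatype 'u elt = Atom 'u | InL "'u elt" | InR "'u elt"

text \<open>A typed finite set is a partial function: its domain is the set and its values
  are the types. Functions out of a typed set \<open>X\<close> are partial functions with domain \<open>dom X\<close>.\<close>

type_synonym ('u, 'o) tset = "'u elt \<rightharpoonup> 'o"

definition is_tset :: "('o, 'm) cat \<Rightarrow> ('u, 'o) tset \<Rightarrow> bool" where
  "is_tset C X \<longleftrightarrow> finite (dom X) \<and> ran X \<subseteq> Ob C"

definition typed_fun :: "('u, 'o) tset \<Rightarrow> ('u, 'o) tset \<Rightarrow> ('u elt \<rightharpoonup> 'u elt) \<Rightarrow> bool" where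
  "typed_fun X Y f \<longleftrightarrow> dom f = dom X \<and> (\<forall>x y. f x = Some y \<longrightarrow> y \<in> dom Y \<and> Y y = X x)"

definition tid :: "('u, 'o) tset \<Rightarrow> ('u elt \<rightharpoonup> 'u elt)" where
  "tid X = (\<lambda>x. if x \<in> dom X then Some x else None)"

definition copair :: "('u elt \<rightharpoonup> 'b) \<Rightarrow> ('u elt \<rightharpoonup> 'b) \<Rightarrow> ('u elt \<rightharpoonup> 'b)" where
  "copair f g = (\<lambda>p. case p of Atom _ \<Rightarrow> None | InL x \<Rightarrow> f x | InR y \<Rightarrow> g y)"

abbreviation tsum :: "('u, 'o) tset \<Rightarrow> ('u, 'o) tset \<Rightarrow> ('u, 'o) tset" where
  "tsum X Y \<equiv> copair X Y"

definition into_l :: "('u elt \<rightharpoonup> 'u elt) \<Rightarrow> ('u elt \<rightharpoonup> 'u elt)" where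
  "into_l f = map_option InL \<circ> f"

definition into_r :: "('u elt \<rightharpoonup> 'u elt) \<Rightarrow> ('u elt \<rightharpoonup> 'u elt)" where
  "into_r f = map_option InR \<circ> f"

definition inl :: "('u, 'o) tset \<Rightarrow> ('u elt \<rightharpoonup> 'u elt)" where
  "inl X = into_l (tid X)"

definition inr :: "('u, 'o) tset \<Rightarrow> ('u elt \<rightharpoonup> 'u elt)" where
  "inr X = into_r (tid X)"

definition fsum :: "('u elt \<rightharpoonup> 'u elt) \<Rightarrow> ('u elt \<rightharpoonup> 'u elt) \<Rightarrow> ('u elt \<rightharpoonup> 'u elt)" where
  "fsum f g = copair (into_l f) (into_r g)"

definition tassoc :: "('u, 'o) tset \<Rightarrow> ('u, 'o) tset \<Rightarrow> ('u, 'o) tset \<Rightarrow> ('u elt \<rightharpoonup> 'u elt)" where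
  "tassoc X Y Z = copair (copair (inl X) (into_r (inl Y))) (into_r (inr Z))"

definition tassoc_inv ::
  "('u, 'o) tset \<Rightarrow> ('u, 'o) tset \<Rightarrow> ('u, 'o) tset \<Rightarrow> ('u elt \<rightharpoonup> 'u elt)" where
  "tassoc_inv X Y Z = copair (into_l (inl X)) (copair (into_l (inr Y)) (inr Z))"

definition tswap :: "('u, 'o) tset \<Rightarrow> ('u, 'o) tset \<Rightarrow> ('u elt \<rightharpoonup> 'u elt)" where
  "tswap X Y = copair (inr X) (inl Y)"

text \<open>The interchange \<open>(A + B) + (C + D) \<rightarrow> (A + C) + (B + D)\<close>.\<close>

definition tinterchange ::
  "('u, 'o) tset \<Rightarrow> ('u, 'o) tset \<Rightarrow> ('u, 'o) tset \<Rightarrow> ('u, 'o) tset \<Rightarrow> ('u elt \<rightharpoonup> 'u elt)" where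
  "tinterchange A B C D =
    copair (copair (into_l (inl A)) (into_r (inl B))) (copair (into_l (inr C)) (into_r (inr D)))"

datatype ('u, 'o) box = Box (inp: "('u, 'o) tset") (outp: "('u, 'o) tset")

datatype ('u, 'o) wiring =
  Wiring (src: "('u, 'o) box") (tgt: "('u, 'o) box")
    (win: "'u elt \<rightharpoonup> 'u elt") (wout: "'u elt \<rightharpoonup> 'u elt")

definition is_box :: "('o, 'm) cat \<Rightarrow> ('u, 'o) box \<Rightarrow> bool" where
  "is_box C X \<longleftrightarrow> is_tset C (inp X) \<and> is_tset C (outp X)"

definition is_wiring :: "('o, 'm) cat \<Rightarrow> ('u, 'o) wiring \<Rightarrow> bool" where
  "is_wiring C \<phi> \<longleftrightarrow> is_box C (src \<phi>) \<and> is_box C (tgt \<phi>) \<and>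
    typed_fun (inp (src \<phi>)) (tsum (outp (src \<phi>)) (inp (tgt \<phi>))) (win \<phi>) \<and>
    typed_fun (outp (tgt \<phi>)) (outp (src \<phi>)) (wout \<phi>)"

definition wiring_id :: "('u, 'o) box \<Rightarrow> ('u, 'o) wiring" where
  "wiring_id X = Wiring X X (inr (inp X)) (tid (outp X))"

text \<open>In \<open>win\<close>, the triple coproducts are bracketed to the right, and the leftmost factor is
  \<open>\<nabla> + 1 : X\<^sup>o\<^sup>u\<^sup>t + (X\<^sup>o\<^sup>u\<^sup>t + Z\<^sup>i\<^sup>n) \<rightarrow> X\<^sup>o\<^sup>u\<^sup>t + Z\<^sup>i\<^sup>n\<close>.\<close>

definition wiring_comp :: "('u, 'o) wiring \<Rightarrow> ('u, 'o) wiring \<Rightarrow> ('u, 'o) wiring" where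
  "wiring_comp \<psi> \<phi> =
    (let Xo = outp (src \<phi>); Zi = inp (tgt \<psi>) in
     Wiring (src \<phi>) (tgt \<psi>)
      (copair (inl Xo) (copair (inl Xo) (inr Zi)) \<circ>\<^sub>m fsum (tid Xo) (fsum (wout \<phi>) (tid Zi))
        \<circ>\<^sub>m fsum (tid Xo) (win \<psi>) \<circ>\<^sub>m win \<phi>)
      (wout \<phi> \<circ>\<^sub>m wout \<psi>))"

definition box_sum :: "('u, 'o) box \<Rightarrow> ('u, 'o) box \<Rightarrow> ('u, 'o) box" where
  "box_sum X Y = Box (tsum (inp X) (inp Y)) (tsum (outp X) (outp Y))"

definition wiring_sum :: "('u, 'o) wiring \<Rightarrow> ('u, 'o) wiring \<Rightarrow> ('u, 'o) wiring" where
  "wiring_sum \<phi> \<psi> =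
    Wiring (box_sum (src \<phi>) (src \<psi>)) (box_sum (tgt \<phi>) (tgt \<psi>))
      (tinterchange (outp (src \<phi>)) (inp (tgt \<phi>)) (outp (src \<psi>)) (inp (tgt \<psi>))
        \<circ>\<^sub>m fsum (win \<phi>) (win \<psi>))
      (fsum (wout \<phi>) (wout \<psi>))"

definition empty_box :: "('u, 'o) box" where
  "empty_box = Box Map.empty Map.empty"

text \<open>A pair of typed functions \<open>X\<^sup>i\<^sup>n \<rightarrow> Y\<^sup>i\<^sup>n\<close>, \<open>Y\<^sup>o\<^sup>u\<^sup>t \<rightarrow> X\<^sup>o\<^sup>u\<^sup>t\<close> is a wiring diagram without feedback; the
  structure isomorphisms are of this form.\<close>

definition wiring_category :: "('o, 'm) cat \<Rightarrow> (('u, 'o) box, ('u, 'o) wiring) moncat" where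
  "wiring_category C = \<lparr>
     Ob = {X. is_box C X}, Arr = {\<phi>. is_wiring C \<phi>}, Dom = src, Cod = tgt,
     Id = wiring_id, Comp = wiring_comp,
     tens_ob = box_sum, tens_arr = wiring_sum, tens_unit = empty_box,
     assoc = (\<lambda>X Y Z. Wiring (box_sum (box_sum X Y) Z) (box_sum X (box_sum Y Z))
       (into_r (tassoc (inp X) (inp Y) (inp Z))) (tassoc_inv (outp X) (outp Y) (outp Z))),
     lunit = (\<lambda>X. Wiring (box_sum empty_box X) X
       (into_r (copair Map.empty (tid (inp X)))) (inr (outp X))),
     runit = (\<lambda>X. Wiring (box_sum X empty_box) X
       (into_r (copair (tid (inp X)) Map.empty)) (inl (outp X))),
     braid = (\<lambda>X Y. Wiring (box_sum X Y) (box_sum Y X)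
       (into_r (tswap (inp X) (inp Y))) (tswap (outp Y) (outp X)))\<rparr>"


section \<open>Products of typed finite sets and spans\<close>

definition is_product ::
  "('o, 'm) cat \<Rightarrow> ('u, 'o) tset \<Rightarrow> 'o \<Rightarrow> ('u elt \<Rightarrow> 'm) \<Rightarrow> bool" where
  "is_product C X P p \<longleftrightarrow> P \<in> Ob C \<and> (\<forall>x \<in> dom X. p x \<in> hom C P (the (X x))) \<and>
    (\<forall>Q q. Q \<in> Ob C \<and> (\<forall>x \<in> dom X. q x \<in> hom C Q (the (X x))) \<longrightarrow>
      (\<exists>!h. h \<in> hom C Q P \<and> (\<forall>x \<in> dom X. p x \<cdot>\<^bsub>C\<^esub> h = q x)))"

definition hat :: "('o, 'm) cat \<Rightarrow> ('u, 'o) tset \<Rightarrow> 'o" where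
  "hat C X = (SOME P. \<exists>p. is_product C X P p)"

datatype ('o, 'm) span = Span (apex: 'o) (lleg: 'm) (rleg: 'm)

datatype ('o, 'm) span_map =
  SpanMap (sdom: "('o, 'm) span") (scod: "('o, 'm) span") (smap: 'm)

definition is_span :: "('o, 'm) cat \<Rightarrow> 'o \<Rightarrow> 'o \<Rightarrow> ('o, 'm) span \<Rightarrow> bool" where
  "is_span C A B s \<longleftrightarrow> apex s \<in> Ob C \<and> lleg s \<in> hom C (apex s) A \<and> rleg s \<in> hom C (apex s) B"

definition is_span_map :: "('o, 'm) cat \<Rightarrow> 'o \<Rightarrow> 'o \<Rightarrow> ('o, 'm) span_map \<Rightarrow> bool" where
  "is_span_map C A B f \<longleftrightarrow> is_span C A B (sdom f) \<and> is_span C A B (scod f) \<and>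
    smap f \<in> hom C (apex (sdom f)) (apex (scod f)) \<and>
    lleg (scod f) \<cdot>\<^bsub>C\<^esub> smap f = lleg (sdom f) \<and> rleg (scod f) \<cdot>\<^bsub>C\<^esub> smap f = rleg (sdom f)"

definition span_category ::
  "('o, 'm) cat \<Rightarrow> 'o \<Rightarrow> 'o \<Rightarrow> (('o, 'm) span, ('o, 'm) span_map) cat" where
  "span_category C A B = \<lparr>
     Ob = {s. is_span C A B s}, Arr = {f. is_span_map C A B f}, Dom = sdom, Cod = scod,
     Id = (\<lambda>s. SpanMap s s (Id C (apex s))),
     Comp = (\<lambda>g f. SpanMap (sdom f) (scod g) (smap g \<cdot>\<^bsub>C\<^esub> smap f))\<rparr>"

abbreviation wiring_algebra ::
  "('o, 'm) cat \<Rightarrow> (('u, 'o) box, ('u, 'o) wiring, 'a, 'b) lax_data \<Rightarrow> bool" where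
  "wiring_algebra C F \<equiv> symmetric_lax_monoidal_pseudofunctor (wiring_category C) F"

end

theory Submission
  imports Defs
begin

text \<open>A span \<open>a\<close> over a box \<open>X\<close> is an object of states together with the values that a state
  shows at the input and output ports of \<open>X\<close>. A wiring diagram \<open>\<phi> : X \<rightarrow> Y\<close> turns it into the
  span of pairs (state of \<open>a\<close>, values at the input ports of \<open>Y\<close>) in which every input port of \<open>X\<close>
  carries the value of the port that \<open>\<phi>\<close> wires it to: an equalizer of finite products. The lax
  structure takes products of the state objects. Limits being unique only up to isomorphism,
  the result is pseudofunctorial, and the work lies in the coherence cells and their equations.
  Two ideas reduce these to computations with partial functions.

  \<^item> On families of values at ports, a wiring diagram acts \<^emph>\<open>strictly\<close>: \<open>feed\<close> computes the values
    at the inner input ports from those at the inner output and outer input ports, and \<open>emit\<close>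
    forwards the output values. This action respects composition, sums and the structure
    isomorphisms on the nose, and it is faithful (\<open>wiring_eqI\<close>). The axioms of the symmetric
    monoidal category of wiring diagrams follow by evaluating both sides on arbitrary values.

  \<^item> Every span in the axioms is the value \<open>eval t\<close> of a formal expression \<open>t\<close> in which each variable
    occurs at most once. An arrow \<open>Q \<rightarrow> apex (eval t)\<close> is the same as a family of arrows from
    \<open>Q\<close> to the apexes of the variables together with values at the input ports, subject to the
    equations \<open>sat t\<close> (\<open>sat_proj\<close>, \<open>sat_realized\<close>, \<open>eval_jointly_monic\<close>). Because the action on values
    is strict, two expressions that should be related by a coherence cell have literally the same
    equations, hence there is one and only one map of spans between their values that commutes with
    the projections to the variables, and it is invertible (\<open>coherent_coherence_map\<close>,
    \<open>coherent_unique\<close>, \<open>coherent_iso\<close>).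

  Maps that commute with the projections are closed under composition, under the action of wiring
  diagrams and under the lax structure. In each coherence axiom both sides are therefore such maps
  between the values of the same two expressions, so they agree. Naturality of the
  cells holds for the same reason, with maps that lie over given maps of the variables
  (\<open>over_unique\<close>, \<open>naturality_square\<close>).\<close>

section \<open>Products of categories\<close>

lemma category_prod_cat:
  assumes "category C" "category D" shows "category (C \<times>\<^sub>C D)"
proof -
  interpret C: category C by fact
  interpret D: category D by fact
  show ?thesis
  proof
    fix f g h a b c d
    assume "f \<in> hom (C \<times>\<^sub>C D) a b" "g \<in> hom (C \<times>\<^sub>C D) b c" "h \<in> hom (C \<times>\<^sub>C D) c d"
    then show "Comp (C \<times>\<^sub>C D) (Comp (C \<times>\<^sub>C D) h g) f = Comp (C \<times>\<^sub>C D) h (Comp (C \<times>\<^sub>C D) g f)"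
      by (cases f, cases g, cases h) (auto simp: prod_cat_def hom_def
          intro!: C.Comp_assoc[OF _ _ _, unfolded hom_def] D.Comp_assoc[OF _ _ _, unfolded hom_def])
  next
    fix f g a b c
    assume "f \<in> hom (C \<times>\<^sub>C D) a b" "g \<in> hom (C \<times>\<^sub>C D) b c"
    then show "Comp (C \<times>\<^sub>C D) g f \<in> hom (C \<times>\<^sub>C D) a c"
      using C.Comp_in_hom D.Comp_in_hom by (cases f, cases g) (auto simp: prod_cat_def hom_def)
  qed (use C.dom_in_Ob D.dom_in_Ob C.cod_in_Ob D.cod_in_Ob C.Id_in_hom D.Id_in_hom C.Comp_Id_left
      D.Comp_Id_left C.Comp_Id_right D.Comp_Id_right in \<open>auto simp: prod_cat_def hom_def\<close>)
qed

lemma prod_cat_hom: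
  "f \<in> hom (C \<times>\<^sub>C D) a b \<longleftrightarrow> fst f \<in> hom C (fst a) (fst b) \<and> snd f \<in> hom D (snd a) (snd b)"
  by (cases f, cases a, cases b) (auto simp: hom_def prod_cat_def)

lemma prod_cat_sel [simp]:
  "Ob (C \<times>\<^sub>C D) = Ob C \<times> Ob D" "Id (C \<times>\<^sub>C D) = map_prod (Id C) (Id D)"
  "Comp (C \<times>\<^sub>C D) (g, g') (f, f') = (Comp C g f, Comp D g' f')"
  by (simp_all add: prod_cat_def)

lemma functor_id: "category D \<Longrightarrow> is_functor D D id_func"
  by (simp add: is_functor_def id_func_def)

lemma functor_comp: "is_functor A B F \<Longrightarrow> is_functor B D G \<Longrightarrow> is_functor A D (G \<circ>\<^sub>F F)"
  unfolding is_functor_def comp_func_def by simp metis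

lemma functor_prod:
  "is_functor A B F \<Longrightarrow> is_functor A' B' F' \<Longrightarrow> is_functor (A \<times>\<^sub>C A') (B \<times>\<^sub>C B') (F \<times>\<^sub>F F')"
  unfolding is_functor_def prod_func_def by (auto simp: prod_cat_hom category_prod_cat)

lemma functor_reassoc:
  "category A \<Longrightarrow> category B \<Longrightarrow> category D \<Longrightarrow>
    is_functor (A \<times>\<^sub>C B \<times>\<^sub>C D) ((A \<times>\<^sub>C B) \<times>\<^sub>C D) reassoc_func"
  unfolding is_functor_def reassoc_func_def by (auto simp: prod_cat_hom category_prod_cat)

lemma functor_swap:
  "category A \<Longrightarrow> category B \<Longrightarrow> is_functor (A \<times>\<^sub>C B) (B \<times>\<^sub>C A) swap_func"
  unfolding is_functor_def swap_func_def by (auto simp: prod_cat_hom category_prod_cat)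

lemma category_one: "category one_cat"
  by unfold_locales (auto simp: one_cat_def hom_def)

lemma one_cat_sel [simp]: "Ob one_cat = UNIV" "f \<in> hom one_cat a b"
  by (simp_all add: one_cat_def hom_def)

lemma functor_left_one: "category A \<Longrightarrow> is_functor A (one_cat \<times>\<^sub>C A) left_one_func"
  unfolding is_functor_def left_one_func_def
  by (auto simp: prod_cat_hom category_prod_cat category_one)

lemma functor_right_one: "category A \<Longrightarrow> is_functor A (A \<times>\<^sub>C one_cat) right_one_func"
  unfolding is_functor_def right_one_func_def
  by (auto simp: prod_cat_hom category_prod_cat category_one)

lemmas functor_intros = functor_id functor_comp functor_prod functor_reassoc functor_swap
  functor_left_one functor_right_one category_one

section \<open>Partial functions on disjoint unions\<close>

lemma map_comp_assoc: "(f \<circ>\<^sub>m g) \<circ>\<^sub>m h = f \<circ>\<^sub>m (g \<circ>\<^sub>m h)"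
  by (auto simp: map_comp_def fun_eq_iff split: option.splits)

lemma copair_simps [simp]:
  "copair f g (Atom u) = None" "copair f g (InL x) = f x" "copair f g (InR x) = g x"
  by (simp_all add: copair_def)

lemma copair_eqI:
  assumes "\<And>u. h (Atom u) = None" "\<And>x. h (InL x) = f x" "\<And>x. h (InR x) = g x"
  shows "h = copair f g"
proof
  fix x show "h x = copair f g x" using assms by (cases x) auto
qed

lemma copair_inject [simp]: "copair f g = copair f' g' \<longleftrightarrow> f = f' \<and> g = g'"
  by (metis (no_types) copair_simps(2,3) ext)

lemma dom_copair: "dom (copair f g) = InL ` dom f \<union> InR ` dom g"
proof -
  have "x \<in> dom (copair f g) \<longleftrightarrow> x \<in> InL ` dom f \<union> InR ` dom g" for x
    by (cases x) auto
  then show ?thesis by blast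
qed

lemma dom_copair_eq [simp]:
  "dom (copair f g) = dom (copair f' g') \<longleftrightarrow> dom f = dom f' \<and> dom g = dom g'"
proof
  assume d: "dom (copair f g) = dom (copair f' g')"
  have "x \<in> dom f \<longleftrightarrow> x \<in> dom f'" "x \<in> dom g \<longleftrightarrow> x \<in> dom g'" for x
    using arg_cong[OF d, of "\<lambda>S. InL x \<in> S"] arg_cong[OF d, of "\<lambda>S. InR x \<in> S"] by (simp_all add: domIff)
  then show "dom f = dom f' \<and> dom g = dom g'" by blast
qed (simp add: dom_copair)

text \<open>Families of values on a coproduct occur only as pairs of families; eliminating to this form
  lets the rewrite rules for \<^const>\<open>copair\<close> compute.\<close>
lemma copairE:
  assumes "dom v = dom (copair X Y)"
  obtains v1 v2 where "v = copair v1 v2" "dom v1 = dom X" "dom v2 = dom Y"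
proof -
  have "v (Atom u) = None" for u
    using assms by (metis copair_simps(1) domIff)
  then have v: "v = copair (v \<circ> InL) (v \<circ> InR)" by (intro copair_eqI) auto
  with assms have "dom (v \<circ> InL) = dom X" "dom (v \<circ> InR) = dom Y"
    by (metis dom_copair_eq)+
  with v that show ?thesis by blast
qed

lemma copair_comp_into_l: "copair f g \<circ>\<^sub>m into_l h = f \<circ>\<^sub>m h"
  by (auto simp: into_l_def map_comp_def fun_eq_iff split: option.splits)

lemma copair_comp_into_r: "copair f g \<circ>\<^sub>m into_r h = g \<circ>\<^sub>m h"
  by (auto simp: into_r_def map_comp_def fun_eq_iff split: option.splits)

lemma comp_copair: "h \<circ>\<^sub>m copair f g = copair (h \<circ>\<^sub>m f) (h \<circ>\<^sub>m g)"
  by (rule copair_eqI) (auto simp: map_comp_def)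

lemma comp_tid: "dom f = dom X \<Longrightarrow> f \<circ>\<^sub>m tid X = f"
  by (force simp: tid_def map_comp_def fun_eq_iff)

lemma copair_comp_inl: "dom f = dom X \<Longrightarrow> copair f g \<circ>\<^sub>m inl X = f"
  by (simp add: inl_def copair_comp_into_l comp_tid)

lemma copair_comp_inr: "dom g = dom X \<Longrightarrow> copair f g \<circ>\<^sub>m inr X = g"
  by (simp add: inr_def copair_comp_into_r comp_tid)

lemma copair_comp_fsum: "copair f g \<circ>\<^sub>m fsum h k = copair (f \<circ>\<^sub>m h) (g \<circ>\<^sub>m k)"
  by (simp add: fsum_def comp_copair copair_comp_into_l copair_comp_into_r)

lemma comp_empty: "v \<circ>\<^sub>m Map.empty = Map.empty"
  by (simp add: map_comp_def)

lemmas comp_simps = map_comp_assoc copair_comp_into_l copair_comp_into_r comp_copair comp_tid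
  copair_comp_inl copair_comp_inr copair_comp_fsum comp_empty

lemma typed_fun_iff:
  "typed_fun X Y f \<longleftrightarrow>
    (\<forall>x. case f x of None \<Rightarrow> X x = None | Some y \<Rightarrow> Y y = X x \<and> X x \<noteq> None)"
proof
  assume f: "typed_fun X Y f"
  have *: "f x = None \<longleftrightarrow> X x = None" for x
    using f unfolding typed_fun_def by (metis domIff)
  show "\<forall>x. case f x of None \<Rightarrow> X x = None | Some y \<Rightarrow> Y y = X x \<and> X x \<noteq> None"
  proof
    fix x show "case f x of None \<Rightarrow> X x = None | Some y \<Rightarrow> Y y = X x \<and> X x \<noteq> None"
      using f *[of x] by (cases "f x") (simp_all add: typed_fun_def)
  qed
next
  assume f: "\<forall>x. case f x of None \<Rightarrow> X x = None | Some y \<Rightarrow> Y y = X x \<and> X x \<noteq> None"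
  have "x \<in> dom f \<longleftrightarrow> x \<in> dom X" for x
    using f[rule_format, of x] by (auto simp: domIff split: option.splits)
  moreover have "y \<in> dom Y \<and> Y y = X x" if "f x = Some y" for x y
    using f[rule_format, of x] that by (auto simp: domIff)
  ultimately show "typed_fun X Y f" by (auto simp: typed_fun_def)
qed

lemma dom_comp:
  assumes "typed_fun X Y f" "dom v = dom Y"
  shows "dom (v \<circ>\<^sub>m f) = dom X"
proof -
  have "v y = None \<longleftrightarrow> Y y = None" for y using assms(2) by (metis domIff)
  then have "(v \<circ>\<^sub>m f) x = None \<longleftrightarrow> X x = None" for x
    using assms(1)[unfolded typed_fun_iff, rule_format, of x] by (cases "f x") auto
  then show ?thesis by (simp add: dom_def)
qed

text \<open>The types of a typed set are themselves a family of values, and being typed means that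
  precomposition sends the types of the codomain to those of the domain. In this form
  typedness passes to composites and copairings by rewriting.\<close>
lemma typed_fun_altdef: "typed_fun X Y f \<longleftrightarrow> dom f = dom X \<and> Y \<circ>\<^sub>m f = X"
proof
  assume f: "typed_fun X Y f"
  have "(Y \<circ>\<^sub>m f) x = X x" for x
    using f[unfolded typed_fun_iff, rule_format, of x] by (cases "f x") auto
  with f show "dom f = dom X \<and> Y \<circ>\<^sub>m f = X" by (auto simp: typed_fun_def)
next
  assume f: "dom f = dom X \<and> Y \<circ>\<^sub>m f = X"
  then have *: "f x = None \<longleftrightarrow> X x = None" for x by (metis domIff)
  show "typed_fun X Y f"
    unfolding typed_fun_iff
  proof
    fix x show "case f x of None \<Rightarrow> X x = None | Some y \<Rightarrow> Y y = X x \<and> X x \<noteq> None"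
      using fun_cong[OF conjunct2[OF f], of x] *[of x] by (cases "f x") simp_all
  qed
qed

lemma typed_comp:
  assumes "typed_fun X Y f" "typed_fun Y Z g" shows "typed_fun X Z (g \<circ>\<^sub>m f)"
proof -
  have "dom (g \<circ>\<^sub>m f) = dom X"
    using assms by (intro dom_comp) (auto simp: typed_fun_def)
  moreover have "Z \<circ>\<^sub>m (g \<circ>\<^sub>m f) = X"
    using assms by (simp add: typed_fun_altdef flip: map_comp_assoc)
  ultimately show ?thesis by (simp add: typed_fun_altdef)
qed

lemma typed_copair:
  assumes "typed_fun X Z f" "typed_fun Y Z g" shows "typed_fun (tsum X Y) Z (copair f g)"
  using assms by (simp add: typed_fun_altdef comp_copair)

lemma typed_tid: "typed_fun X X (tid X)"
  by (auto simp: typed_fun_def tid_def dom_def split: if_splits)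

lemma typed_into_l: "typed_fun X Y f \<Longrightarrow> typed_fun X (tsum Y Z) (into_l f)"
  by (force simp: typed_fun_iff into_l_def split: option.splits)

lemma typed_into_r: "typed_fun X Z f \<Longrightarrow> typed_fun X (tsum Y Z) (into_r f)"
  by (force simp: typed_fun_iff into_r_def split: option.splits)

lemma typed_inl: "typed_fun X (tsum X Y) (inl X)"
  unfolding inl_def by (intro typed_into_l typed_tid)

lemma typed_inr: "typed_fun Y (tsum X Y) (inr Y)"
  unfolding inr_def by (intro typed_into_r typed_tid)

lemma typed_fsum:
  "typed_fun X X' f \<Longrightarrow> typed_fun Y Y' g \<Longrightarrow> typed_fun (tsum X Y) (tsum X' Y') (fsum f g)"
  unfolding fsum_def by (intro typed_copair typed_into_l typed_into_r)

lemma typed_empty: "typed_fun Map.empty X Map.empty"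
  by (simp add: typed_fun_def)

lemmas typed_intros = typed_comp typed_copair typed_tid typed_into_l typed_into_r typed_inl
  typed_inr typed_fsum typed_empty

lemma is_tset_tsum: "is_tset C X \<Longrightarrow> is_tset C Y \<Longrightarrow> is_tset C (tsum X Y)"
proof -
  assume X: "is_tset C X" and Y: "is_tset C Y"
  have "ran (tsum X Y) \<subseteq> Ob C"
  proof
    fix z assume "z \<in> ran (tsum X Y)"
    then obtain x where x: "tsum X Y x = Some z" by (auto simp: ran_def)
    then have "z \<in> ran X \<union> ran Y" by (cases x) (auto simp: ran_def)
    with X Y show "z \<in> Ob C" by (auto simp: is_tset_def)
  qed
  with X Y show ?thesis by (simp add: is_tset_def dom_copair)
qed

lemma is_box_sum: "is_box C X \<Longrightarrow> is_box C Y \<Longrightarrow> is_box C (box_sum X Y)"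
  by (simp add: is_box_def box_sum_def is_tset_tsum)

lemma is_box_empty: "is_box C empty_box"
  by (simp add: is_box_def empty_box_def is_tset_def)

lemma box_sum_sel [simp]:
  "inp (box_sum X Y) = tsum (inp X) (inp Y)" "outp (box_sum X Y) = tsum (outp X) (outp Y)"
  by (simp_all add: box_sum_def)

lemma empty_box_sel [simp]: "inp empty_box = Map.empty" "outp empty_box = Map.empty"
  by (simp_all add: empty_box_def)

section \<open>The strict action of wiring diagrams on port values\<close>

text \<open>The value at an input port of the inner box is read off from the port to which it is wired,
  an output port of the inner box or an input port of the outer box.\<close>
definition feed :: "('u, 'o) wiring \<Rightarrow> ('u elt \<rightharpoonup> 'v) \<Rightarrow> ('u elt \<rightharpoonup> 'v) \<Rightarrow> ('u elt \<rightharpoonup> 'v)" where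
  "feed \<phi> o' i = copair o' i \<circ>\<^sub>m win \<phi>"

definition emit :: "('u, 'o) wiring \<Rightarrow> ('u elt \<rightharpoonup> 'v) \<Rightarrow> ('u elt \<rightharpoonup> 'v)" where
  "emit \<phi> o' = o' \<circ>\<^sub>m wout \<phi>"

lemma dom_feed [simp]:
  assumes "is_wiring C \<phi>" "dom o' = dom (outp (src \<phi>))" "dom i = dom (inp (tgt \<phi>))"
  shows "dom (feed \<phi> o' i) = dom (inp (src \<phi>))"
  unfolding feed_def
proof (rule dom_comp)
  show "typed_fun (inp (src \<phi>)) (tsum (outp (src \<phi>)) (inp (tgt \<phi>))) (win \<phi>)"
    using assms(1) by (simp add: is_wiring_def)
qed (use assms in simp)

lemma dom_emit [simp]:
  assumes "is_wiring C \<phi>" "dom o' = dom (outp (src \<phi>))"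
  shows "dom (emit \<phi> o') = dom (outp (tgt \<phi>))"
  using assms unfolding emit_def is_wiring_def by (metis dom_comp)

text \<open>The action is faithful: on the tautological values, where every port carries its own name as
  value, it returns the wiring diagram itself.\<close>
lemma wiring_eqI:
  fixes \<phi> \<phi>' :: "('u, 'o) wiring"
  assumes w: "is_wiring C \<phi>" "is_wiring C \<phi>'" and st: "src \<phi> = src \<phi>'" "tgt \<phi> = tgt \<phi>'"
    and feed: "\<And>o' i :: 'u elt \<rightharpoonup> 'u elt. dom o' = dom (outp (src \<phi>)) \<Longrightarrow> dom i = dom (inp (tgt \<phi>)) \<Longrightarrow>
      feed \<phi> o' i = feed \<phi>' o' i"
    and emit: "\<And>o' :: 'u elt \<rightharpoonup> 'u elt. dom o' = dom (outp (src \<phi>)) \<Longrightarrow> emit \<phi> o' = emit \<phi>' o'"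
  shows "\<phi> = \<phi>'"
proof -
  have id_comp: "tid Y \<circ>\<^sub>m f = f" if "typed_fun X Y f" for X Y :: "('u, 'o) tset" and f
    using that by (auto simp: tid_def map_comp_def fun_eq_iff typed_fun_def split: option.splits)
  have id: "copair (inl X) (inr Y) = tid (tsum X Y)" for X Y :: "('u, 'o) tset"
    by (rule copair_eqI[symmetric])
      (auto simp: tid_def inl_def inr_def into_l_def into_r_def dom_def)
  have [simp]: "dom (tid X) = dom X" "dom (inl X) = dom X" "dom (inr X) = dom X"
    for X :: "('u, 'o) tset"
    using typed_tid[of X] typed_inl[of X] typed_inr[of X] by (auto simp: typed_fun_def)
  have "win \<phi> = win \<phi>'"
    using feed[of "inl (outp (src \<phi>))" "inr (inp (tgt \<phi>))"] w st
    by (simp add: feed_def id is_wiring_def)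
      (metis (no_types, lifting) id_comp)
  moreover have "wout \<phi> = wout \<phi>'"
    using emit[of "tid (outp (src \<phi>))"] w st by (simp add: emit_def is_wiring_def) (metis id_comp)
  ultimately show ?thesis using st by (simp add: wiring.expand)
qed

lemma wiring_id_sel [simp]:
  "src (wiring_id X) = X" "tgt (wiring_id X) = X"
  by (simp_all add: wiring_id_def)

lemma is_wiring_id: "is_box C X \<Longrightarrow> is_wiring C (wiring_id X)"
  by (simp add: is_wiring_def wiring_id_def typed_intros)

lemma feed_id [simp]: "dom i = dom (inp X) \<Longrightarrow> feed (wiring_id X) o' i = i"
  by (simp add: feed_def wiring_id_def comp_simps)

lemma emit_id [simp]: "dom o' = dom (outp X) \<Longrightarrow> emit (wiring_id X) o' = o'"
  by (simp add: emit_def wiring_id_def comp_simps)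

lemma wiring_comp_sel [simp]:
  "src (wiring_comp \<psi> \<phi>) = src \<phi>" "tgt (wiring_comp \<psi> \<phi>) = tgt \<psi>"
  by (simp_all add: wiring_comp_def Let_def)

lemma is_wiring_comp:
  assumes "is_wiring C \<phi>" "is_wiring C \<psi>" "src \<psi> = tgt \<phi>"
  shows "is_wiring C (wiring_comp \<psi> \<phi>)"
  using assms unfolding is_wiring_def wiring_comp_def Let_def wiring.sel
  by (auto intro!: typed_intros intro: typed_comp)

text \<open>The triple coproducts in the definition of the composite only say this: the outer
  diagram is fed with the emitted values, and its result is fed to the inner diagram.\<close>
lemma feed_comp [simp]:
  assumes "dom o' = dom (outp (src \<phi>))" "dom i = dom (inp (tgt \<psi>))"
  shows "feed (wiring_comp \<psi> \<phi>) o' i = feed \<phi> o' (feed \<psi> (emit \<phi> o') i)"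
  using assms
  by (simp add: feed_def emit_def wiring_comp_def Let_def comp_simps flip: map_comp_assoc)

lemma emit_comp [simp]: "emit (wiring_comp \<psi> \<phi>) o' = emit \<psi> (emit \<phi> o')"
  by (simp add: emit_def wiring_comp_def Let_def comp_simps)

lemma wiring_sum_sel [simp]:
  "src (wiring_sum \<phi> \<psi>) = box_sum (src \<phi>) (src \<psi>)"
  "tgt (wiring_sum \<phi> \<psi>) = box_sum (tgt \<phi>) (tgt \<psi>)"
  by (simp_all add: wiring_sum_def)

lemma typed_tinterchange:
  "typed_fun (tsum (tsum A B) (tsum D E)) (tsum (tsum A D) (tsum B E)) (tinterchange A B D E)"
  unfolding tinterchange_def by (intro typed_intros)

lemma is_wiring_sum:
  assumes "is_wiring C \<phi>" "is_wiring C \<psi>" shows "is_wiring C (wiring_sum \<phi> \<psi>)"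
  using assms unfolding is_wiring_def
  by (auto simp: wiring_sum_def is_box_sum
      intro!: typed_fsum typed_comp[OF typed_fsum] typed_tinterchange)

lemma feed_sum [simp]:
  assumes "dom o1 = dom (outp (src \<phi>))" "dom i1 = dom (inp (tgt \<phi>))"
    and "dom o2 = dom (outp (src \<psi>))" "dom i2 = dom (inp (tgt \<psi>))"
  shows "feed (wiring_sum \<phi> \<psi>) (copair o1 o2) (copair i1 i2) = copair (feed \<phi> o1 i1) (feed \<psi> o2 i2)"
  using assms
  by (simp add: feed_def wiring_sum_def tinterchange_def comp_simps flip: map_comp_assoc)

lemma emit_sum [simp]:
  "emit (wiring_sum \<phi> \<psi>) (copair o1 o2) = copair (emit \<phi> o1) (emit \<psi> o2)"
  by (simp add: emit_def wiring_sum_def comp_simps)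

section \<open>The symmetric monoidal category of wiring diagrams\<close>

text \<open>A wiring diagram without feedback; all structure isomorphisms have this form.\<close>
definition relabel ::
  "('u, 'o) box \<Rightarrow> ('u, 'o) box \<Rightarrow> ('u elt \<rightharpoonup> 'u elt) \<Rightarrow> ('u elt \<rightharpoonup> 'u elt) \<Rightarrow> ('u, 'o) wiring" where
  "relabel X Y f g = Wiring X Y (into_r f) g"

lemma relabel_sel [simp]: "src (relabel X Y f g) = X" "tgt (relabel X Y f g) = Y"
  by (simp_all add: relabel_def)

lemma is_wiring_relabel:
  assumes "is_box C X" "is_box C Y" "typed_fun (inp X) (inp Y) f" "typed_fun (outp Y) (outp X) g"
  shows "is_wiring C (relabel X Y f g)"
  using assms by (simp add: is_wiring_def relabel_def typed_into_r)

lemma feed_relabel: "feed (relabel X Y f g) o' i = i \<circ>\<^sub>m f"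
  by (simp add: feed_def relabel_def comp_simps)

lemma emit_relabel: "emit (relabel X Y f g) o' = o' \<circ>\<^sub>m g"
  by (simp add: emit_def relabel_def)

definition wassoc :: "('u, 'o) box \<Rightarrow> ('u, 'o) box \<Rightarrow> ('u, 'o) box \<Rightarrow> ('u, 'o) wiring" where
  "wassoc X Y Z = relabel (box_sum (box_sum X Y) Z) (box_sum X (box_sum Y Z))
    (tassoc (inp X) (inp Y) (inp Z)) (tassoc_inv (outp X) (outp Y) (outp Z))"

definition wassoc_inv :: "('u, 'o) box \<Rightarrow> ('u, 'o) box \<Rightarrow> ('u, 'o) box \<Rightarrow> ('u, 'o) wiring" where
  "wassoc_inv X Y Z = relabel (box_sum X (box_sum Y Z)) (box_sum (box_sum X Y) Z)
    (tassoc_inv (inp X) (inp Y) (inp Z)) (tassoc (outp X) (outp Y) (outp Z))"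

definition wlunit :: "('u, 'o) box \<Rightarrow> ('u, 'o) wiring" where
  "wlunit X = relabel (box_sum empty_box X) X (copair Map.empty (tid (inp X))) (inr (outp X))"

definition wlunit_inv :: "('u, 'o) box \<Rightarrow> ('u, 'o) wiring" where
  "wlunit_inv X = relabel X (box_sum empty_box X) (inr (inp X)) (copair Map.empty (tid (outp X)))"

definition wrunit :: "('u, 'o) box \<Rightarrow> ('u, 'o) wiring" where
  "wrunit X = relabel (box_sum X empty_box) X (copair (tid (inp X)) Map.empty) (inl (outp X))"

definition wrunit_inv :: "('u, 'o) box \<Rightarrow> ('u, 'o) wiring" where
  "wrunit_inv X = relabel X (box_sum X empty_box) (inl (inp X)) (copair (tid (outp X)) Map.empty)"

definition wbraid :: "('u, 'o) box \<Rightarrow> ('u, 'o) box \<Rightarrow> ('u, 'o) wiring" where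
  "wbraid X Y = relabel (box_sum X Y) (box_sum Y X)
    (tswap (inp X) (inp Y)) (tswap (outp Y) (outp X))"

lemmas structure_defs = wassoc_def wassoc_inv_def wlunit_def wlunit_inv_def wrunit_def
  wrunit_inv_def wbraid_def

lemma structure_sel [simp]:
  "src (wassoc X Y Z) = box_sum (box_sum X Y) Z" "tgt (wassoc X Y Z) = box_sum X (box_sum Y Z)"
  "src (wassoc_inv X Y Z) = box_sum X (box_sum Y Z)"
  "tgt (wassoc_inv X Y Z) = box_sum (box_sum X Y) Z"
  "src (wlunit X) = box_sum empty_box X" "tgt (wlunit X) = X"
  "src (wlunit_inv X) = X" "tgt (wlunit_inv X) = box_sum empty_box X"
  "src (wrunit X) = box_sum X empty_box" "tgt (wrunit X) = X"
  "src (wrunit_inv X) = X" "tgt (wrunit_inv X) = box_sum X empty_box"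
  "src (wbraid X Y) = box_sum X Y" "tgt (wbraid X Y) = box_sum Y X"
  by (simp_all add: structure_defs)

lemma is_wiring_structure:
  "is_box C X \<Longrightarrow> is_box C Y \<Longrightarrow> is_box C Z \<Longrightarrow> is_wiring C (wassoc X Y Z)"
  "is_box C X \<Longrightarrow> is_box C Y \<Longrightarrow> is_box C Z \<Longrightarrow> is_wiring C (wassoc_inv X Y Z)"
  "is_box C X \<Longrightarrow> is_wiring C (wlunit X)"
  "is_box C X \<Longrightarrow> is_wiring C (wlunit_inv X)"
  "is_box C X \<Longrightarrow> is_wiring C (wrunit X)"
  "is_box C X \<Longrightarrow> is_wiring C (wrunit_inv X)"
  "is_box C X \<Longrightarrow> is_box C Y \<Longrightarrow> is_wiring C (wbraid X Y)"
  unfolding structure_defs tassoc_def tassoc_inv_def tswap_def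
  by (intro is_wiring_relabel is_box_sum is_box_empty; simp add: typed_intros)+

text \<open>The structure isomorphisms merely rebracket, swap or drop components of a family of values.\<close>
lemma act_structure:
  "\<lbrakk>dom i1 = dom (inp X); dom i2 = dom (inp Y); dom i3 = dom (inp Z)\<rbrakk> \<Longrightarrow>
    feed (wassoc X Y Z) v (copair i1 (copair i2 i3)) = copair (copair i1 i2) i3"
  "\<lbrakk>dom o1 = dom (outp X); dom o2 = dom (outp Y); dom o3 = dom (outp Z)\<rbrakk> \<Longrightarrow>
    emit (wassoc X Y Z) (copair (copair o1 o2) o3) = copair o1 (copair o2 o3)"
  "\<lbrakk>dom i1 = dom (inp X); dom i2 = dom (inp Y); dom i3 = dom (inp Z)\<rbrakk> \<Longrightarrow>
    feed (wassoc_inv X Y Z) v (copair (copair i1 i2) i3) = copair i1 (copair i2 i3)"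
  "\<lbrakk>dom o1 = dom (outp X); dom o2 = dom (outp Y); dom o3 = dom (outp Z)\<rbrakk> \<Longrightarrow>
    emit (wassoc_inv X Y Z) (copair o1 (copair o2 o3)) = copair (copair o1 o2) o3"
  "dom i1 = dom (inp X) \<Longrightarrow> feed (wlunit X) v i1 = copair Map.empty i1"
  "dom o1 = dom (outp X) \<Longrightarrow> emit (wlunit X) (copair v o1) = o1"
  "dom i1 = dom (inp X) \<Longrightarrow> feed (wlunit_inv X) v (copair w i1) = i1"
  "dom o1 = dom (outp X) \<Longrightarrow> emit (wlunit_inv X) o1 = copair Map.empty o1"
  "dom i1 = dom (inp X) \<Longrightarrow> feed (wrunit X) v i1 = copair i1 Map.empty"
  "dom o1 = dom (outp X) \<Longrightarrow> emit (wrunit X) (copair o1 v) = o1"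
  "dom i1 = dom (inp X) \<Longrightarrow> feed (wrunit_inv X) v (copair i1 w) = i1"
  "dom o1 = dom (outp X) \<Longrightarrow> emit (wrunit_inv X) o1 = copair o1 Map.empty"
  "\<lbrakk>dom i1 = dom (inp X); dom i2 = dom (inp Y)\<rbrakk> \<Longrightarrow>
    feed (wbraid X Y) v (copair i2 i1) = copair i1 i2"
  "\<lbrakk>dom o1 = dom (outp X); dom o2 = dom (outp Y)\<rbrakk> \<Longrightarrow>
    emit (wbraid X Y) (copair o1 o2) = copair o2 o1"
  by (simp_all add: structure_defs feed_relabel emit_relabel tassoc_def tassoc_inv_def tswap_def
      comp_simps)

lemma wiring_category_sel [simp]:
  "Ob (wiring_category C) = {X. is_box C X}" "Arr (wiring_category C) = {\<phi>. is_wiring C \<phi>}"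
  "Dom (wiring_category C) = src" "Cod (wiring_category C) = tgt"
  "Id (wiring_category C) = wiring_id" "Comp (wiring_category C) = wiring_comp"
  "tens_ob (wiring_category C) = box_sum" "tens_arr (wiring_category C) = wiring_sum"
  "tens_unit (wiring_category C) = empty_box"
  "assoc (wiring_category C) = wassoc" "lunit (wiring_category C) = wlunit"
  "runit (wiring_category C) = wrunit" "braid (wiring_category C) = wbraid"
  by (simp_all add: wiring_category_def fun_eq_iff structure_defs relabel_def)

lemma wiring_hom: "\<phi> \<in> hom (wiring_category C) X Y \<longleftrightarrow> is_wiring C \<phi> \<and> src \<phi> = X \<and> tgt \<phi> = Y"
  by (simp add: hom_def)

lemma is_wiring_boxes:
  assumes "is_wiring C \<phi>" shows "is_box C (src \<phi>)" "is_box C (tgt \<phi>)"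
  using assms by (simp_all add: is_wiring_def)

lemmas wiring_intros = is_wiring_comp is_wiring_sum is_wiring_structure is_wiring_id is_box_sum
  is_box_empty is_wiring_boxes

lemma category_wiring: "category (wiring_category C)"
proof
  fix \<phi> \<psi> \<chi> X Y Z T
  assume h: "\<phi> \<in> hom (wiring_category C) X Y" "\<psi> \<in> hom (wiring_category C) Y Z"
    "\<chi> \<in> hom (wiring_category C) Z T"
  show "Comp (wiring_category C) (Comp (wiring_category C) \<chi> \<psi>) \<phi> =
    Comp (wiring_category C) \<chi> (Comp (wiring_category C) \<psi> \<phi>)"
    using h by (auto simp: wiring_hom intro!: wiring_eqI wiring_intros)
qed (auto simp: wiring_hom intro!: wiring_intros intro: wiring_eqI[of C])

lemma wiring_isoI:
  assumes "is_wiring C \<phi>" "is_wiring C \<psi>" "src \<psi> = tgt \<phi>" "tgt \<psi> = src \<phi>"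
    and "wiring_comp \<psi> \<phi> = wiring_id (src \<phi>)" "wiring_comp \<phi> \<psi> = wiring_id (tgt \<phi>)"
  shows "is_iso (wiring_category C) \<phi>"
  using assms by (auto simp: is_iso_def wiring_hom)

text \<open>Each inverse undoes the rearrangement of values, so faithfulness of the action gives the two
  inverse laws.\<close>
lemma wiring_structure_iso:
  assumes "is_box C X" "is_box C Y" "is_box C Z"
  shows "is_iso (wiring_category C) (wassoc X Y Z)" "is_iso (wiring_category C) (wlunit X)"
    "is_iso (wiring_category C) (wrunit X)" "is_iso (wiring_category C) (wbraid X Y)"
proof -
  note [intro] = wiring_intros and [simp] = act_structure
  show "is_iso (wiring_category C) (wassoc X Y Z)"
    using assms by (intro wiring_isoI[where \<psi> = "wassoc_inv X Y Z"] wiring_eqI[of C])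
      (auto elim!: copairE)
  show "is_iso (wiring_category C) (wlunit X)"
    using assms by (intro wiring_isoI[where \<psi> = "wlunit_inv X"] wiring_eqI[of C])
      (auto elim!: copairE)
  show "is_iso (wiring_category C) (wrunit X)"
    using assms by (intro wiring_isoI[where \<psi> = "wrunit_inv X"] wiring_eqI[of C])
      (auto elim!: copairE)
  show "is_iso (wiring_category C) (wbraid X Y)"
    using assms by (intro wiring_isoI[where \<psi> = "wbraid Y X"] wiring_eqI[of C])
      (auto elim!: copairE)
qed

lemma wiring_sum_id:
  "is_box C X \<Longrightarrow> is_box C Y \<Longrightarrow> wiring_sum (wiring_id X) (wiring_id Y) = wiring_id (box_sum X Y)"
  by (rule wiring_eqI[of C]) (auto elim!: copairE intro!: wiring_intros)

lemma wiring_sum_comp: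
  assumes "is_wiring C \<phi>" "is_wiring C \<phi>'" "src \<phi>' = tgt \<phi>"
    and "is_wiring C \<psi>" "is_wiring C \<psi>'" "src \<psi>' = tgt \<psi>"
  shows "wiring_sum (wiring_comp \<phi>' \<phi>) (wiring_comp \<psi>' \<psi>) =
    wiring_comp (wiring_sum \<phi>' \<psi>') (wiring_sum \<phi> \<psi>)"
  using assms by (intro wiring_eqI[of C]) (auto elim!: copairE intro!: wiring_intros)

text \<open>By faithfulness, each axiom is an equation between two actions on values; after
  decomposing the values along the coproducts both sides rewrite to the same families.\<close>
lemma symmetric_monoidal_wiring:
  fixes C :: "('o, 'm) cat"
  shows "symmetric_monoidal (wiring_category C :: (('u, 'o) box, ('u, 'o) wiring) moncat)"
proof -
  note [intro] = wiring_intros and [simp] = act_structure wiring_hom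
  have eqI: "\<phi> = \<phi>'" if "is_wiring C \<phi> \<and> is_wiring C \<phi>' \<and> src \<phi> = src \<phi>' \<and> tgt \<phi> = tgt \<phi>'"
    "\<And>o' i :: 'u elt \<rightharpoonup> 'u elt. dom o' = dom (outp (src \<phi>)) \<Longrightarrow> dom i = dom (inp (tgt \<phi>)) \<Longrightarrow>
      feed \<phi> o' i = feed \<phi>' o' i"
    "\<And>o' :: 'u elt \<rightharpoonup> 'u elt. dom o' = dom (outp (src \<phi>)) \<Longrightarrow> emit \<phi> o' = emit \<phi>' o'"
    for \<phi> \<phi>' :: "('u, 'o) wiring"
    using wiring_eqI that by blast
  interpret W: category "wiring_category C :: (('u, 'o) box, ('u, 'o) wiring) moncat"
    by (rule category_wiring)
  show ?thesis
  proof
    show "is_functor (wiring_category C \<times>\<^sub>C wiring_category C) (wiring_category C)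
      \<lparr>on_ob = (\<lambda>(X, Y). tens_ob (wiring_category C) X Y),
       on_arr = (\<lambda>(\<phi>, \<psi>). tens_arr (wiring_category C) \<phi> \<psi>)\<rparr>"
      unfolding is_functor_def
      by (intro conjI ballI allI category_prod_cat category_wiring)
        (auto simp: prod_cat_hom wiring_sum_id[of C] wiring_sum_comp[of C])
  qed (auto elim!: copairE intro!: eqI wiring_structure_iso wiring_intros)
qed

section \<open>Finite products and equalizers\<close>

locale finitely_complete_category = category C
  for C :: "('o, 'm) cat" (structure) +
  assumes finitely_complete: "finitely_complete C"
begin

lemma limit_exists:
  fixes J :: "(nat, nat) cat"
  assumes "finite (Ob J)" "finite (Arr J)" "is_functor J C D"
  shows "\<exists>L p. is_limit C J D L p"
  using finitely_complete assms by (auto simp: finitely_complete_def)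

lemma comp_hom [simp]:
  "\<lbrakk>f \<in> Arr C; g \<in> Arr C; Dom C g = Cod C f\<rbrakk> \<Longrightarrow> g \<cdot> f \<in> Arr C"
  "\<lbrakk>f \<in> Arr C; g \<in> Arr C; Dom C g = Cod C f\<rbrakk> \<Longrightarrow> Dom C (g \<cdot> f) = Dom C f"
  "\<lbrakk>f \<in> Arr C; g \<in> Arr C; Dom C g = Cod C f\<rbrakk> \<Longrightarrow> Cod C (g \<cdot> f) = Cod C g"
  using Comp_in_hom[of f "Dom C f" "Cod C f" g "Cod C g"] by (auto simp: hom_def)

lemma comp_assoc:
  "\<lbrakk>f \<in> Arr C; g \<in> Arr C; h \<in> Arr C; Dom C g = Cod C f; Dom C h = Cod C g\<rbrakk> \<Longrightarrow>
    (h \<cdot> g) \<cdot> f = h \<cdot> g \<cdot> f"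
  using Comp_assoc[of f "Dom C f" "Cod C f" g "Cod C g" h "Cod C h"] by (auto simp: hom_def)

lemma id_hom [simp]:
  "a \<in> Ob C \<Longrightarrow> Id C a \<in> Arr C" "a \<in> Ob C \<Longrightarrow> Dom C (Id C a) = a"
  "a \<in> Ob C \<Longrightarrow> Cod C (Id C a) = a"
  using Id_in_hom by (auto simp: hom_def)

lemma comp_id [simp]:
  "f \<in> Arr C \<Longrightarrow> Cod C f = a \<Longrightarrow> Id C a \<cdot> f = f" "f \<in> Arr C \<Longrightarrow> Dom C f = a \<Longrightarrow> f \<cdot> Id C a = f"
  using Comp_Id_left[of f "Dom C f" "Cod C f"] Comp_Id_right[of f "Dom C f" "Cod C f"]
  by (auto simp: hom_def)

lemma finite_product_exists:
  fixes A :: "nat \<Rightarrow> 'o"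
  assumes A: "\<forall>j < n. A j \<in> Ob C"
  shows "\<exists>L p. L \<in> Ob C \<and> (\<forall>j < n. p j \<in> hom C L (A j)) \<and>
    (\<forall>Q q. Q \<in> Ob C \<and> (\<forall>j < n. q j \<in> hom C Q (A j)) \<longrightarrow>
      (\<exists>!h. h \<in> hom C Q L \<and> (\<forall>j < n. p j \<cdot> h = q j)))"
proof -
  define J :: "(nat, nat) cat" where
    "J = \<lparr>Ob = {..<n}, Arr = {..<n}, Dom = id, Cod = id, Id = id, Comp = (\<lambda>g f. f)\<rparr>"
  define D :: "(nat, nat, 'o, 'm) func" where "D = \<lparr>on_ob = A, on_arr = (\<lambda>j. Id C (A j))\<rparr>"
  have "category J" by unfold_locales (auto simp: J_def hom_def)
  then have "is_functor J C D"
    using A category_axioms by (auto simp: is_functor_def J_def D_def hom_def)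
  then obtain L p where L: "is_limit C J D L p"
    using limit_exists[of J D] by (auto simp: J_def)
  have cone: "is_cone C J D Q q \<longleftrightarrow> Q \<in> Ob C \<and> (\<forall>j < n. q j \<in> hom C Q (A j))" for Q q
    using A by (auto simp: is_cone_def J_def D_def hom_def)
  have "\<exists>!h. h \<in> hom C Q L \<and> (\<forall>j < n. p j \<cdot> h = q j)"
    if "Q \<in> Ob C \<and> (\<forall>j < n. q j \<in> hom C Q (A j))" for Q q
    using that L cone[of Q q] by (simp add: is_limit_def J_def Ball_def)
  moreover have "L \<in> Ob C" "\<forall>j < n. p j \<in> hom C L (A j)"
    using L cone[of L p] by (auto simp: is_limit_def)
  ultimately show ?thesis by blast
qed

text \<open>The index category has the objects \<open>0\<close> and \<open>1\<close>, with the arrows \<open>0\<close> and \<open>1\<close> as their identities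
  and \<open>2\<close> and \<open>3\<close> as the parallel pair from \<open>0\<close> to \<open>1\<close>.\<close>
lemma equalizer_exists:
  assumes f: "f \<in> hom C A B" and g: "g \<in> hom C A B"
  obtains E e where "E \<in> Ob C" "e \<in> hom C E A" "f \<cdot> e = g \<cdot> e"
    "\<And>Q q. \<lbrakk>q \<in> hom C Q A; f \<cdot> q = g \<cdot> q\<rbrakk> \<Longrightarrow> \<exists>!h. h \<in> hom C Q E \<and> e \<cdot> h = q"
proof -
  define J :: "(nat, nat) cat" where
    "J = \<lparr>Ob = {0, 1}, Arr = {0, 1, 2, 3}, Dom = (\<lambda>k. if k = 1 then 1 else 0),
      Cod = (\<lambda>k. if k = 0 then 0 else 1), Id = id, Comp = (\<lambda>l k. if l \<le> 1 then k else l)\<rparr>"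
  define D :: "(nat, nat, 'o, 'm) func" where "D = \<lparr>on_ob = (\<lambda>j. if j = 0 then A else B),
    on_arr = (\<lambda>k. if k = 0 then Id C A else if k = 1 then Id C B else if k = 2 then f else g)\<rparr>"
  have AB: "A \<in> Ob C" "B \<in> Ob C" using f dom_in_Ob cod_in_Ob by (auto simp: hom_def)
  have "category J" by unfold_locales (auto simp: J_def hom_def)
  then have "is_functor J C D"
    using AB f g category_axioms by (auto simp: is_functor_def J_def D_def hom_def)
  then obtain L p where L: "is_limit C J D L p"
    using limit_exists[of J D] by (auto simp: J_def)
  have cone: "is_cone C J D Q q \<longleftrightarrow> q 0 \<in> hom C Q A \<and> q 1 = f \<cdot> q 0 \<and> f \<cdot> q 0 = g \<cdot> q 0" for Q q
  proof
    assume "is_cone C J D Q q"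
    then have "q 0 \<in> hom C Q A"
      and *: "\<And>i j u. u \<in> hom J i j \<Longrightarrow> on_arr D u \<cdot> q i = q j"
      by (auto simp: is_cone_def J_def D_def)
    then show "q 0 \<in> hom C Q A \<and> q 1 = f \<cdot> q 0 \<and> f \<cdot> q 0 = g \<cdot> q 0"
      using *[of 2 0 1] *[of 3 0 1] by (simp add: J_def D_def hom_def)
  next
    assume q: "q 0 \<in> hom C Q A \<and> q 1 = f \<cdot> q 0 \<and> f \<cdot> q 0 = g \<cdot> q 0"
    then show "is_cone C J D Q q"
      using AB f g dom_in_Ob unfolding is_cone_def by (auto simp: J_def D_def hom_def)
  qed
  have fe: "f \<cdot> p 0 = g \<cdot> p 0" "p 0 \<in> hom C L A" "p 1 = f \<cdot> p 0"
    using L cone[of L p] by (auto simp: is_limit_def)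
  show thesis
  proof (rule that[of L "p 0"])
    show "\<exists>!h. h \<in> hom C Q L \<and> p 0 \<cdot> h = q" if q: "q \<in> hom C Q A" "f \<cdot> q = g \<cdot> q" for Q q
    proof -
      have "is_cone C J D Q (\<lambda>j. if j = 0 then q else f \<cdot> q)" using q cone by simp
      then have "\<exists>!h. h \<in> hom C Q L \<and> (\<forall>j \<in> Ob J. p j \<cdot> h = (if j = 0 then q else f \<cdot> q))"
        using L by (simp add: is_limit_def)
      moreover have "(\<forall>j \<in> Ob J. p j \<cdot> h = (if j = 0 then q else f \<cdot> q)) \<longleftrightarrow> p 0 \<cdot> h = q"
        if "h \<in> hom C Q L" for h
        using that fe(2,3) f by (auto simp: J_def hom_def comp_assoc)
      ultimately show ?thesis by (metis (no_types, lifting))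
    qed
  qed (use fe L in \<open>auto simp: is_limit_def is_cone_def\<close>)
qed

lemma product_exists:
  assumes "is_tset C X" obtains P p where "is_product C X P p"
proof -
  from assms have fin: "finite (dom X)" and Ob: "\<And>x. x \<in> dom X \<Longrightarrow> the (X x) \<in> Ob C"
    by (auto simp: is_tset_def ran_def)
  obtain e where e: "bij_betw e (dom X) {0..<card (dom X)}"
    using ex_bij_betw_finite_nat[OF fin] by blast
  define d where "d = inv_into (dom X) e"
  have d: "d j \<in> dom X" "e (d j) = j" if "j < card (dom X)" for j
    using that e by (auto simp: d_def bij_betw_def f_inv_into_f inv_into_into)
  have ed: "e x < card (dom X)" "d (e x) = x" if "x \<in> dom X" for x
    using that e bij_betw_apply[OF e that] by (auto simp: d_def bij_betw_def)
  have dOb: "\<forall>j < card (dom X). the (X (d j)) \<in> Ob C" using Ob d(1) by blast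
  obtain P p where P: "P \<in> Ob C" and p: "\<forall>j < card (dom X). p j \<in> hom C P (the (X (d j)))"
    and univ: "\<forall>Q q. Q \<in> Ob C \<and> (\<forall>j < card (dom X). q j \<in> hom C Q (the (X (d j)))) \<longrightarrow>
      (\<exists>!h. h \<in> hom C Q P \<and> (\<forall>j < card (dom X). p j \<cdot> h = q j))"
    using finite_product_exists[of "card (dom X)" "\<lambda>j. the (X (d j))", OF dOb]
    by (elim exE conjE) (rule that)
  have "is_product C X P (\<lambda>x. p (e x))"
    unfolding is_product_def
  proof (intro conjI ballI allI impI; (elim conjE)?)
    fix Q q assume Q: "Q \<in> Ob C" and q: "\<forall>x \<in> dom X. q x \<in> hom C Q (the (X x))"
    have "(\<forall>j < card (dom X). p j \<cdot> h = q (d j)) \<longleftrightarrow> (\<forall>x \<in> dom X. p (e x) \<cdot> h = q x)" for h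
      using d ed by metis
    then show "\<exists>!h. h \<in> hom C Q P \<and> (\<forall>x \<in> dom X. p (e x) \<cdot> h = q x)"
      using univ[rule_format, of Q "\<lambda>j. q (d j)"] Q q d(1) by simp
  qed (use P p ed in \<open>auto, metis option.sel domI\<close>)
  then show thesis by (rule that)
qed

lemma binary_product_exists:
  assumes "A \<in> Ob C" "B \<in> Ob C"
  obtains P p1 p2 where "P \<in> Ob C" "p1 \<in> hom C P A" "p2 \<in> hom C P B"
    "\<And>Q q1 q2. \<lbrakk>q1 \<in> hom C Q A; q2 \<in> hom C Q B\<rbrakk> \<Longrightarrow>
      \<exists>!h. h \<in> hom C Q P \<and> p1 \<cdot> h = q1 \<and> p2 \<cdot> h = q2"
proof -
  have two: "(\<forall>j < 2. R j) \<longleftrightarrow> R 0 \<and> R 1" for R :: "nat \<Rightarrow> bool"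
    by (auto simp: less_2_cases_iff)
  have AB: "\<forall>j < (2::nat). (if j = 0 then A else B) \<in> Ob C" using assms by simp
  obtain P p where P: "P \<in> Ob C" and p: "\<forall>j < 2. p j \<in> hom C P (if j = 0 then A else B)"
    and univ: "\<forall>Q q. Q \<in> Ob C \<and> (\<forall>j < 2. q j \<in> hom C Q (if j = 0 then A else B)) \<longrightarrow>
      (\<exists>!h. h \<in> hom C Q P \<and> (\<forall>j < (2::nat). p j \<cdot> h = q j))"
    using finite_product_exists[of 2 "\<lambda>j. if j = 0 then A else B", OF AB]
    by (elim exE conjE) (rule that)
  show thesis
  proof (rule that[of P "p 0" "p 1"])
    fix Q q1 q2 assume "q1 \<in> hom C Q A" "q2 \<in> hom C Q B"
    moreover from this have "Q \<in> Ob C" using dom_in_Ob by (auto simp: hom_def)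
    ultimately show "\<exists>!h. h \<in> hom C Q P \<and> p 0 \<cdot> h = q1 \<and> p 1 \<cdot> h = q2"
      using univ[rule_format, of Q "\<lambda>j. if j = 0 then q1 else q2"] by (simp add: two)
  qed (use P p[rule_format, of 0] p[rule_format, of 1] in auto)
qed

section \<open>Arrows into a product as port values\<close>

definition port :: "('u, 'o) tset \<Rightarrow> 'u elt \<Rightarrow> 'm" where
  "port X = (SOME p. is_product C X (hat C X) p)"

definition ports :: "('u, 'o) tset \<Rightarrow> 'm \<Rightarrow> ('u elt \<rightharpoonup> 'm)" where
  "ports X h = (\<lambda>x. if x \<in> dom X then Some (port X x \<cdot> h) else None)"

text \<open>An arrow \<open>Q \<rightarrow> hat C X\<close> amounts to one arrow \<open>Q \<rightarrow> \<tau> x\<close> for every port \<open>x\<close>, and \<open>ports\<close> and \<open>tuple\<close>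
  translate between the two. The families that arise in this way are the valuations; requiring
  \<open>Q \<in> Ob C\<close> matters when there are no ports.\<close>
definition valuation :: "'o \<Rightarrow> ('u, 'o) tset \<Rightarrow> ('u elt \<rightharpoonup> 'm) \<Rightarrow> bool" where
  "valuation Q X v \<longleftrightarrow> Q \<in> Ob C \<and>
    (\<forall>x. case v x of None \<Rightarrow> X x = None | Some f \<Rightarrow> f \<in> Arr C \<and> Dom C f = Q \<and> X x = Some (Cod C f))"

definition precomp :: "('u elt \<rightharpoonup> 'm) \<Rightarrow> 'm \<Rightarrow> ('u elt \<rightharpoonup> 'm)" where
  "precomp v k = map_option (\<lambda>f. f \<cdot> k) \<circ> v"

definition tuple :: "'o \<Rightarrow> ('u, 'o) tset \<Rightarrow> ('u elt \<rightharpoonup> 'm) \<Rightarrow> 'm" where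
  "tuple Q X v = (THE h. h \<in> hom C Q (hat C X) \<and> ports X h = v)"

lemma hat_product: "is_tset C X \<Longrightarrow> is_product C X (hat C X) (port X)"
  unfolding port_def hat_def using product_exists[of X]
  by (metis (mono_tags, lifting) someI)

lemma hat_in_Ob: "is_tset C X \<Longrightarrow> hat C X \<in> Ob C"
  using hat_product by (auto simp: is_product_def)

lemma port_hom:
  "is_tset C X \<Longrightarrow> x \<in> dom X \<Longrightarrow> port X x \<in> hom C (hat C X) (the (X x))"
  using hat_product by (auto simp: is_product_def)

lemma ports_comp:
  assumes "is_tset C X" "h \<in> hom C Q (hat C X)" "k \<in> hom C R Q"
  shows "ports X (h \<cdot> k) = precomp (ports X h) k"
  using assms port_hom[of X] by (auto simp: ports_def precomp_def hom_def comp_assoc fun_eq_iff)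

lemma valuation_ports:
  assumes "is_tset C X" "h \<in> hom C Q (hat C X)" shows "valuation Q X (ports X h)"
  using assms port_hom[of X] dom_in_Ob
  by (auto simp: valuation_def ports_def hom_def dest: domI)

lemma dom_valuation: "valuation Q X v \<Longrightarrow> dom v = dom X"
proof -
  assume v: "valuation Q X v"
  have "v x = None \<longleftrightarrow> X x = None" for x
    using v by (cases "v x") (auto simp: valuation_def dest: spec[of _ x])
  then show ?thesis by (simp add: dom_def)
qed

lemma tuple_unique:
  assumes X: "is_tset C X" and v: "valuation Q X v"
  shows "\<exists>!h. h \<in> hom C Q (hat C X) \<and> ports X h = v"
proof -
  have d: "dom v = dom X" using v by (rule dom_valuation)
  have "the (v x) \<in> hom C Q (the (X x))" if "x \<in> dom X" for x
  proof -
    from that have "x \<in> dom v" by (simp only: d)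
    then obtain f where "v x = Some f" by blast
    then show ?thesis using v[unfolded valuation_def, THEN conjunct2, rule_format, of x]
      by (simp add: hom_def)
  qed
  moreover have "Q \<in> Ob C" using v by (simp add: valuation_def)
  ultimately have "\<exists>!h. h \<in> hom C Q (hat C X) \<and> (\<forall>x \<in> dom X. port X x \<cdot> h = the (v x))"
    using hat_product[OF X] by (simp add: is_product_def)
  moreover have "(\<forall>x \<in> dom X. port X x \<cdot> h = the (v x)) \<longleftrightarrow> ports X h = v" for h
  proof
    assume h: "\<forall>x \<in> dom X. port X x \<cdot> h = the (v x)"
    show "ports X h = v"
    proof
      fix x show "ports X h x = v x"
        using h d domIff[of x v] by (cases "x \<in> dom X") (auto simp: ports_def)
    qed
  qed (auto simp: ports_def)
  ultimately show ?thesis by simp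
qed

lemma tuple:
  assumes "is_tset C X" "valuation Q X v"
  shows "tuple Q X v \<in> hom C Q (hat C X)" "ports X (tuple Q X v) = v"
  using theI'[OF tuple_unique[OF assms]] by (simp_all add: tuple_def)

lemma ports_inject:
  assumes "is_tset C X" "h \<in> hom C Q (hat C X)" "h' \<in> hom C Q (hat C X)" "ports X h = ports X h'"
  shows "h = h'"
  using tuple_unique[OF assms(1) valuation_ports[OF assms(1,2)]] assms by auto

lemma valuation_comp:
  assumes f: "typed_fun X Y f" and v: "valuation Q Y v" shows "valuation Q X (v \<circ>\<^sub>m f)"
  unfolding valuation_def
proof (intro conjI allI)
  show "Q \<in> Ob C" using v by (simp add: valuation_def)
  have v': "case v y of None \<Rightarrow> Y y = None
      | Some f \<Rightarrow> f \<in> Arr C \<and> Dom C f = Q \<and> Y y = Some (Cod C f)" for y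
    using v by (simp add: valuation_def)
  fix x show "case (v \<circ>\<^sub>m f) x of None \<Rightarrow> X x = None
      | Some f \<Rightarrow> f \<in> Arr C \<and> Dom C f = Q \<and> X x = Some (Cod C f)"
  proof (cases "f x")
    case None then show ?thesis using f[unfolded typed_fun_iff, rule_format, of x] by simp
  next
    case (Some y)
    then have "Y y = X x" "X x \<noteq> None" using f[unfolded typed_fun_iff, rule_format, of x] by auto
    then show ?thesis using Some v'[of y] by (cases "v y") auto
  qed
qed

lemma valuation_copair:
  fixes X Y :: "('u, 'o) tset"
  shows "valuation Q (tsum X Y) (copair v w) \<longleftrightarrow> valuation Q X v \<and> valuation Q Y w"
proof -
  have all: "(\<forall>p. R p) \<longleftrightarrow> (\<forall>u. R (Atom u)) \<and> (\<forall>x. R (InL x)) \<and> (\<forall>y. R (InR y))"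
    for R :: "'u elt \<Rightarrow> bool"
    by (metis elt.exhaust)
  show ?thesis unfolding valuation_def by (subst all, unfold copair_simps) auto
qed

lemma valuation_feed:
  assumes "is_wiring C \<phi>" "valuation Q (outp (src \<phi>)) v" "valuation Q (inp (tgt \<phi>)) w"
  shows "valuation Q (inp (src \<phi>)) (feed \<phi> v w)"
  unfolding feed_def
  by (rule valuation_comp[of _ "tsum (outp (src \<phi>)) (inp (tgt \<phi>))"])
    (use assms in \<open>auto simp: is_wiring_def valuation_copair\<close>)

lemma valuation_emit:
  assumes "is_wiring C \<phi>" "valuation Q (outp (src \<phi>)) v"
  shows "valuation Q (outp (tgt \<phi>)) (emit \<phi> v)"
  unfolding emit_def by (rule valuation_comp) (use assms in \<open>auto simp: is_wiring_def\<close>)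

text \<open>Wiring diagrams act on port values by reindexing, which commutes with precomposition. So the
  equations that define the action on spans can be checked on generalized elements.\<close>
lemma precomp_map_comp: "precomp (v \<circ>\<^sub>m f) k = precomp v k \<circ>\<^sub>m f"
  by (auto simp: precomp_def map_comp_def fun_eq_iff split: option.splits)

lemma precomp_copair [simp]: "precomp (copair v w) k = copair (precomp v k) (precomp w k)"
  by (rule copair_eqI) (auto simp: precomp_def)

lemma precomp_feed [simp]: "precomp (feed \<phi> v w) k = feed \<phi> (precomp v k) (precomp w k)"
  by (simp add: feed_def precomp_map_comp)

lemma precomp_emit [simp]: "precomp (emit \<phi> v) k = emit \<phi> (precomp v k)"
  by (simp add: emit_def precomp_map_comp)

section \<open>Spans acted on by a wiring diagram, and spans in parallel\<close>

abbreviation box_span :: "('u, 'o) box \<Rightarrow> ('o, 'm) span \<Rightarrow> bool" where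
  "box_span X a \<equiv> is_span C (hat C (inp X)) (hat C (outp X)) a"

text \<open>The pair \<open>(s, i)\<close> is a generalized element of the state object of the new span: a state of \<open>a\<close>
  and outer input values, such that the inner input values are those that the wiring prescribes.\<close>
definition consistent ::
  "('u, 'o) wiring \<Rightarrow> ('o, 'm) span \<Rightarrow> 'o \<Rightarrow> 'm \<Rightarrow> 'm \<Rightarrow> bool" where
  "consistent \<phi> a Q s i \<longleftrightarrow> s \<in> hom C Q (apex a) \<and> i \<in> hom C Q (hat C (inp (tgt \<phi>))) \<and>
    ports (inp (src \<phi>)) (lleg a \<cdot> s) =
      feed \<phi> (ports (outp (src \<phi>)) (rleg a \<cdot> s)) (ports (inp (tgt \<phi>)) i)"

definition is_act :: "('u, 'o) wiring \<Rightarrow> ('o, 'm) span \<Rightarrow> 'o \<times> 'm \<times> 'm \<Rightarrow> bool" where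
  "is_act \<phi> a = (\<lambda>(T, t, u). consistent \<phi> a T t u \<and>
    (\<forall>Q s i. consistent \<phi> a Q s i \<longrightarrow> (\<exists>!h. h \<in> hom C Q T \<and> t \<cdot> h = s \<and> u \<cdot> h = i)))"

lemma wiring_tsets:
  assumes "is_wiring C \<phi>"
  shows "is_tset C (inp (src \<phi>))" "is_tset C (outp (src \<phi>))"
    "is_tset C (inp (tgt \<phi>))" "is_tset C (outp (tgt \<phi>))"
  using assms by (auto simp: is_wiring_def is_box_def)

lemma hom_comp: "f \<in> hom C a b \<Longrightarrow> g \<in> hom C b c \<Longrightarrow> g \<cdot> f \<in> hom C a c"
  by (rule Comp_in_hom)

lemma hom_Dom_in_Ob: "f \<in> hom C a b \<Longrightarrow> a \<in> Ob C"
  using dom_in_Ob by (auto simp: hom_def)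

lemma comp_assoc_hom:
  "f \<in> hom C a b \<Longrightarrow> g \<in> hom C b c \<Longrightarrow> h \<in> hom C c d \<Longrightarrow> h \<cdot> g \<cdot> f = (h \<cdot> g) \<cdot> f"
  by (simp add: Comp_assoc)

text \<open>The pairs of a state and of outer input values form a binary product, and the consistency
  condition compares two arrows from it to the product of the inner input types. Their equalizer
  represents the consistent pairs.\<close>
lemma act_exists:
  assumes \<phi>: "is_wiring C \<phi>" and a: "box_span (src \<phi>) a"
  shows "\<exists>r. is_act \<phi> a r"
proof -
  note ts = wiring_tsets[OF \<phi>]
  let ?Xi = "inp (src \<phi>)" and ?Xo = "outp (src \<phi>)" and ?Yi = "inp (tgt \<phi>)"
  have legs: "lleg a \<in> hom C (apex a) (hat C ?Xi)" "rleg a \<in> hom C (apex a) (hat C ?Xo)"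
    and Ob: "apex a \<in> Ob C" "hat C ?Yi \<in> Ob C"
    using a ts hat_in_Ob by (auto simp: is_span_def)
  obtain P p1 p2 where P: "P \<in> Ob C" and p: "p1 \<in> hom C P (apex a)" "p2 \<in> hom C P (hat C ?Yi)"
    and Puniv: "\<And>Q q1 q2. \<lbrakk>q1 \<in> hom C Q (apex a); q2 \<in> hom C Q (hat C ?Yi)\<rbrakk> \<Longrightarrow>
      \<exists>!h. h \<in> hom C Q P \<and> p1 \<cdot> h = q1 \<and> p2 \<cdot> h = q2"
    by (rule binary_product_exists[OF Ob]) (rule that)
  define v where "v = feed \<phi> (ports ?Xo (rleg a \<cdot> p1)) (ports ?Yi p2)"
  have v: "valuation P ?Xi v"
    unfolding v_def by (intro valuation_feed valuation_ports \<phi> ts hom_comp[OF p(1)] legs p)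
  define g where "g = tuple P ?Xi v"
  have g: "g \<in> hom C P (hat C ?Xi)" "ports ?Xi g = v"
    unfolding g_def using tuple[OF ts(1) v] by auto
  have f: "lleg a \<cdot> p1 \<in> hom C P (hat C ?Xi)" using legs p by (blast intro: hom_comp)
  obtain E e where E: "E \<in> Ob C" and e: "e \<in> hom C E P" and eq: "(lleg a \<cdot> p1) \<cdot> e = g \<cdot> e"
    and Euniv: "\<And>Q q. \<lbrakk>q \<in> hom C Q P; (lleg a \<cdot> p1) \<cdot> q = g \<cdot> q\<rbrakk> \<Longrightarrow>
      \<exists>!h. h \<in> hom C Q E \<and> e \<cdot> h = q"
    by (rule equalizer_exists[OF f g(1)]) (rule that)
  have gk: "ports ?Xi (g \<cdot> k) = feed \<phi> (ports ?Xo (rleg a \<cdot> p1 \<cdot> k)) (ports ?Yi (p2 \<cdot> k))"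
    if k: "k \<in> hom C Q P" for Q k
    using k p legs
    by (simp add: ports_comp[OF ts(1) g(1) k] g(2) v_def ports_comp[OF ts(3) p(2) k]
        comp_assoc_hom[OF k p(1) legs(2)] ports_comp[OF ts(2) hom_comp[OF p(1) legs(2)] k])
  have cons: "consistent \<phi> a Q (p1 \<cdot> k) (p2 \<cdot> k) \<longleftrightarrow> (lleg a \<cdot> p1) \<cdot> k = g \<cdot> k"
    if k: "k \<in> hom C Q P" for Q k
  proof -
    have "ports ?Xi (lleg a \<cdot> p1 \<cdot> k) = ports ?Xi (g \<cdot> k) \<longleftrightarrow> (lleg a \<cdot> p1) \<cdot> k = g \<cdot> k"
      unfolding comp_assoc_hom[OF k p(1) legs(1)]
      using ports_inject[OF ts(1) hom_comp[OF k f] hom_comp[OF k g(1)]] by auto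
    then show ?thesis
      using hom_comp[OF k] p unfolding consistent_def by (simp add: gk[OF k])
  qed
  have "is_act \<phi> a (E, p1 \<cdot> e, p2 \<cdot> e)"
    unfolding is_act_def prod.case
  proof (intro conjI allI impI)
    show "consistent \<phi> a E (p1 \<cdot> e) (p2 \<cdot> e)" using cons[OF e] eq by simp
  next
    fix Q s i assume si: "consistent \<phi> a Q s i"
    then obtain k where k: "k \<in> hom C Q P" "p1 \<cdot> k = s" "p2 \<cdot> k = i"
      and ku: "\<And>k'. k' \<in> hom C Q P \<Longrightarrow> p1 \<cdot> k' = s \<Longrightarrow> p2 \<cdot> k' = i \<Longrightarrow> k' = k"
      using Puniv[of s Q i] unfolding consistent_def by metis
    have "(lleg a \<cdot> p1) \<cdot> k = g \<cdot> k" using cons[OF k(1)] k si by simp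
    then have "\<exists>!h. h \<in> hom C Q E \<and> e \<cdot> h = k" using Euniv k by blast
    moreover have "e \<cdot> h = k \<longleftrightarrow> (p1 \<cdot> e) \<cdot> h = s \<and> (p2 \<cdot> e) \<cdot> h = i" if h: "h \<in> hom C Q E" for h
      using ku[OF hom_comp[OF h e]] k comp_assoc_hom[OF h e p(1)] comp_assoc_hom[OF h e p(2)] by metis
    ultimately show "\<exists>!h. h \<in> hom C Q E \<and> (p1 \<cdot> e) \<cdot> h = s \<and> (p2 \<cdot> e) \<cdot> h = i"
      by (metis (no_types, lifting))
  qed
  then show ?thesis by blast
qed

definition act_rep :: "('u, 'o) wiring \<Rightarrow> ('o, 'm) span \<Rightarrow> 'o \<times> 'm \<times> 'm" where
  "act_rep \<phi> a = (SOME r. is_act \<phi> a r)"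

definition act_state :: "('u, 'o) wiring \<Rightarrow> ('o, 'm) span \<Rightarrow> 'm" where
  "act_state \<phi> a = fst (snd (act_rep \<phi> a))"

text \<open>The left leg of the new span is the projection to the outer input values.\<close>
definition act :: "('u, 'o) wiring \<Rightarrow> ('o, 'm) span \<Rightarrow> ('o, 'm) span" where
  "act \<phi> a = (let T = fst (act_rep \<phi> a) in Span T (snd (snd (act_rep \<phi> a)))
    (tuple T (outp (tgt \<phi>)) (emit \<phi> (ports (outp (src \<phi>)) (rleg a \<cdot> act_state \<phi> a)))))"

context
  fixes \<phi> :: "('u, 'o) wiring" and a
  assumes \<phi>: "is_wiring C \<phi>" and a: "box_span (src \<phi>) a"
begin

lemma act_consistent: "consistent \<phi> a (apex (act \<phi> a)) (act_state \<phi> a) (lleg (act \<phi> a))"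
  and act_univ: "consistent \<phi> a Q s i \<Longrightarrow>
    \<exists>!h. h \<in> hom C Q (apex (act \<phi> a)) \<and> act_state \<phi> a \<cdot> h = s \<and> lleg (act \<phi> a) \<cdot> h = i"
proof -
  obtain T t u where r: "act_rep \<phi> a = (T, t, u)" by (rule prod_cases3)
  have "is_act \<phi> a (act_rep \<phi> a)"
    unfolding act_rep_def using act_exists[OF \<phi> a] by (rule someI_ex)
  then show "consistent \<phi> a (apex (act \<phi> a)) (act_state \<phi> a) (lleg (act \<phi> a))"
    and "consistent \<phi> a Q s i \<Longrightarrow>
      \<exists>!h. h \<in> hom C Q (apex (act \<phi> a)) \<and> act_state \<phi> a \<cdot> h = s \<and> lleg (act \<phi> a) \<cdot> h = i"
    by (simp_all add: act_def act_state_def is_act_def r)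
qed

lemma act_state_hom: "act_state \<phi> a \<in> hom C (apex (act \<phi> a)) (apex a)"
  using act_consistent by (simp add: consistent_def)

lemma act_out:
  "rleg (act \<phi> a) \<in> hom C (apex (act \<phi> a)) (hat C (outp (tgt \<phi>)))"
  "ports (outp (tgt \<phi>)) (rleg (act \<phi> a)) =
    emit \<phi> (ports (outp (src \<phi>)) (rleg a \<cdot> act_state \<phi> a))"
proof -
  have "rleg a \<in> hom C (apex a) (hat C (outp (src \<phi>)))" using a by (simp add: is_span_def)
  then have v: "valuation (apex (act \<phi> a)) (outp (tgt \<phi>))
      (emit \<phi> (ports (outp (src \<phi>)) (rleg a \<cdot> act_state \<phi> a)))"
    by (intro valuation_emit valuation_ports \<phi> wiring_tsets[OF \<phi>] hom_comp[OF act_state_hom])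
  show "rleg (act \<phi> a) \<in> hom C (apex (act \<phi> a)) (hat C (outp (tgt \<phi>)))"
    "ports (outp (tgt \<phi>)) (rleg (act \<phi> a)) =
      emit \<phi> (ports (outp (src \<phi>)) (rleg a \<cdot> act_state \<phi> a))"
    using tuple[OF wiring_tsets(4)[OF \<phi>] v] by (simp_all add: act_def Let_def)
qed

lemma act_span: "box_span (tgt \<phi>) (act \<phi> a)"
  using act_consistent act_out by (auto simp: is_span_def consistent_def dest: hom_Dom_in_Ob)

lemma act_state_in:
  assumes h: "h \<in> hom C Q (apex (act \<phi> a))"
  shows "ports (inp (src \<phi>)) (lleg a \<cdot> act_state \<phi> a \<cdot> h) =
    feed \<phi> (ports (outp (src \<phi>)) (rleg a \<cdot> act_state \<phi> a \<cdot> h))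
      (ports (inp (tgt \<phi>)) (lleg (act \<phi> a) \<cdot> h))"
proof -
  have legs: "lleg a \<in> hom C (apex a) (hat C (inp (src \<phi>)))"
      "rleg a \<in> hom C (apex a) (hat C (outp (src \<phi>)))"
      "lleg (act \<phi> a) \<in> hom C (apex (act \<phi> a)) (hat C (inp (tgt \<phi>)))"
    using a act_span by (auto simp: is_span_def)
  note ts = wiring_tsets[OF \<phi>] and st = act_state_hom
  show ?thesis
    using act_consistent
    by (simp add: consistent_def comp_assoc_hom[OF h st legs(1)] comp_assoc_hom[OF h st legs(2)]
        ports_comp[OF ts(1) hom_comp[OF st legs(1)] h] ports_comp[OF ts(3) legs(3) h]
        ports_comp[OF ts(2) hom_comp[OF st legs(2)] h])
qed

lemma act_state_out:
  assumes h: "h \<in> hom C Q (apex (act \<phi> a))"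
  shows "ports (outp (tgt \<phi>)) (rleg (act \<phi> a) \<cdot> h) =
    emit \<phi> (ports (outp (src \<phi>)) (rleg a \<cdot> act_state \<phi> a \<cdot> h))"
proof -
  have legs: "rleg a \<in> hom C (apex a) (hat C (outp (src \<phi>)))" using a by (simp add: is_span_def)
  note ts = wiring_tsets[OF \<phi>] and st = act_state_hom
  show ?thesis
    by (simp add: ports_comp[OF ts(4) act_out(1) h] act_out(2) comp_assoc_hom[OF h st legs]
        ports_comp[OF ts(2) hom_comp[OF st legs] h])
qed

end

definition is_binary_product :: "'o \<Rightarrow> 'o \<Rightarrow> 'o \<times> 'm \<times> 'm \<Rightarrow> bool" where
  "is_binary_product A B = (\<lambda>(P, p1, p2). P \<in> Ob C \<and> p1 \<in> hom C P A \<and> p2 \<in> hom C P B \<and>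
    (\<forall>Q q1 q2. q1 \<in> hom C Q A \<and> q2 \<in> hom C Q B \<longrightarrow>
      (\<exists>!h. h \<in> hom C Q P \<and> p1 \<cdot> h = q1 \<and> p2 \<cdot> h = q2)))"

definition prod_rep :: "('o, 'm) span \<Rightarrow> ('o, 'm) span \<Rightarrow> 'o \<times> 'm \<times> 'm" where
  "prod_rep a b = (SOME r. is_binary_product (apex a) (apex b) r)"

definition fst_state :: "('o, 'm) span \<Rightarrow> ('o, 'm) span \<Rightarrow> 'm" where
  "fst_state a b = fst (snd (prod_rep a b))"

definition snd_state :: "('o, 'm) span \<Rightarrow> ('o, 'm) span \<Rightarrow> 'm" where
  "snd_state a b = snd (snd (prod_rep a b))"

text \<open>The state object is the product of the two state objects; the legs pair up the port values.\<close>
definition par ::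
  "('u, 'o) box \<Rightarrow> ('u, 'o) box \<Rightarrow> ('o, 'm) span \<Rightarrow> ('o, 'm) span \<Rightarrow> ('o, 'm) span" where
  "par X Y a b = (let P = fst (prod_rep a b) in Span P
    (tuple P (tsum (inp X) (inp Y)) (copair (ports (inp X) (lleg a \<cdot> fst_state a b))
      (ports (inp Y) (lleg b \<cdot> snd_state a b))))
    (tuple P (tsum (outp X) (outp Y)) (copair (ports (outp X) (rleg a \<cdot> fst_state a b))
      (ports (outp Y) (rleg b \<cdot> snd_state a b)))))"

context
  fixes X Y :: "('u, 'o) box" and a b
  assumes X: "is_box C X" and Y: "is_box C Y" and a: "box_span X a" and b: "box_span Y b"
begin

lemma par_states:
  "fst_state a b \<in> hom C (apex (par X Y a b)) (apex a)"
  "snd_state a b \<in> hom C (apex (par X Y a b)) (apex b)"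
  and par_univ: "s \<in> hom C Q (apex a) \<Longrightarrow> s' \<in> hom C Q (apex b) \<Longrightarrow>
    \<exists>!h. h \<in> hom C Q (apex (par X Y a b)) \<and> fst_state a b \<cdot> h = s \<and> snd_state a b \<cdot> h = s'"
proof -
  have "apex a \<in> Ob C" "apex b \<in> Ob C" using a b by (auto simp: is_span_def)
  then obtain P p1 p2 where P: "P \<in> Ob C" "p1 \<in> hom C P (apex a)" "p2 \<in> hom C P (apex b)"
    and Puniv: "\<And>Q q1 q2. \<lbrakk>q1 \<in> hom C Q (apex a); q2 \<in> hom C Q (apex b)\<rbrakk> \<Longrightarrow>
      \<exists>!h. h \<in> hom C Q P \<and> p1 \<cdot> h = q1 \<and> p2 \<cdot> h = q2"
    by (rule binary_product_exists) (rule that)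
  have "is_binary_product (apex a) (apex b) (P, p1, p2)"
    unfolding is_binary_product_def using P Puniv by simp
  then have r: "is_binary_product (apex a) (apex b) (prod_rep a b)"
    unfolding prod_rep_def by (rule someI)
  obtain T t u where "prod_rep a b = (T, t, u)" by (rule prod_cases3)
  with r show "fst_state a b \<in> hom C (apex (par X Y a b)) (apex a)"
    "snd_state a b \<in> hom C (apex (par X Y a b)) (apex b)"
    "s \<in> hom C Q (apex a) \<Longrightarrow> s' \<in> hom C Q (apex b) \<Longrightarrow>
      \<exists>!h. h \<in> hom C Q (apex (par X Y a b)) \<and> fst_state a b \<cdot> h = s \<and> snd_state a b \<cdot> h = s'"
    by (simp_all add: par_def fst_state_def snd_state_def is_binary_product_def)
qed

lemma par_legs:
  "lleg (par X Y a b) \<in> hom C (apex (par X Y a b)) (hat C (tsum (inp X) (inp Y)))"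
  "ports (tsum (inp X) (inp Y)) (lleg (par X Y a b)) =
    copair (ports (inp X) (lleg a \<cdot> fst_state a b)) (ports (inp Y) (lleg b \<cdot> snd_state a b))"
  "rleg (par X Y a b) \<in> hom C (apex (par X Y a b)) (hat C (tsum (outp X) (outp Y)))"
  "ports (tsum (outp X) (outp Y)) (rleg (par X Y a b)) =
    copair (ports (outp X) (rleg a \<cdot> fst_state a b)) (ports (outp Y) (rleg b \<cdot> snd_state a b))"
proof -
  have ts: "is_tset C (inp X)" "is_tset C (inp Y)" "is_tset C (outp X)" "is_tset C (outp Y)"
    using X Y by (auto simp: is_box_def)
  have legs: "lleg a \<in> hom C (apex a) (hat C (inp X))" "rleg a \<in> hom C (apex a) (hat C (outp X))"
    "lleg b \<in> hom C (apex b) (hat C (inp Y))" "rleg b \<in> hom C (apex b) (hat C (outp Y))"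
    using a b by (auto simp: is_span_def)
  have l: "valuation (apex (par X Y a b)) (tsum (inp X) (inp Y))
     (copair (ports (inp X) (lleg a \<cdot> fst_state a b)) (ports (inp Y) (lleg b \<cdot> snd_state a b)))"
    unfolding valuation_copair
    by (intro conjI valuation_ports ts hom_comp[OF par_states(1)] hom_comp[OF par_states(2)] legs)
  have r: "valuation (apex (par X Y a b)) (tsum (outp X) (outp Y))
     (copair (ports (outp X) (rleg a \<cdot> fst_state a b)) (ports (outp Y) (rleg b \<cdot> snd_state a b)))"
    unfolding valuation_copair
    by (intro conjI valuation_ports ts hom_comp[OF par_states(1)] hom_comp[OF par_states(2)] legs)
  show "lleg (par X Y a b) \<in> hom C (apex (par X Y a b)) (hat C (tsum (inp X) (inp Y)))"
    "ports (tsum (inp X) (inp Y)) (lleg (par X Y a b)) =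
      copair (ports (inp X) (lleg a \<cdot> fst_state a b)) (ports (inp Y) (lleg b \<cdot> snd_state a b))"
    using tuple[OF is_tset_tsum[OF ts(1,2)] l] by (simp_all add: par_def Let_def)
  show "rleg (par X Y a b) \<in> hom C (apex (par X Y a b)) (hat C (tsum (outp X) (outp Y)))"
    "ports (tsum (outp X) (outp Y)) (rleg (par X Y a b)) =
      copair (ports (outp X) (rleg a \<cdot> fst_state a b)) (ports (outp Y) (rleg b \<cdot> snd_state a b))"
    using tuple[OF is_tset_tsum[OF ts(3,4)] r] by (simp_all add: par_def Let_def)
qed

lemma par_span: "box_span (box_sum X Y) (par X Y a b)"
  using par_legs par_states by (auto simp: is_span_def dest: hom_Dom_in_Ob)

lemma par_at:
  assumes h: "h \<in> hom C Q (apex (par X Y a b))"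
  shows "ports (tsum (inp X) (inp Y)) (lleg (par X Y a b) \<cdot> h) =
      copair (ports (inp X) (lleg a \<cdot> fst_state a b \<cdot> h)) (ports (inp Y) (lleg b \<cdot> snd_state a b \<cdot> h))"
    "ports (tsum (outp X) (outp Y)) (rleg (par X Y a b) \<cdot> h) =
      copair (ports (outp X) (rleg a \<cdot> fst_state a b \<cdot> h)) (ports (outp Y) (rleg b \<cdot> snd_state a b \<cdot> h))"
proof -
  have ts: "is_tset C (inp X)" "is_tset C (inp Y)" "is_tset C (outp X)" "is_tset C (outp Y)"
    using X Y by (auto simp: is_box_def)
  have legs: "lleg a \<in> hom C (apex a) (hat C (inp X))" "rleg a \<in> hom C (apex a) (hat C (outp X))"
    "lleg b \<in> hom C (apex b) (hat C (inp Y))" "rleg b \<in> hom C (apex b) (hat C (outp Y))"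
    using a b by (auto simp: is_span_def)
  note st = par_states
  show "ports (tsum (inp X) (inp Y)) (lleg (par X Y a b) \<cdot> h) =
      copair (ports (inp X) (lleg a \<cdot> fst_state a b \<cdot> h)) (ports (inp Y) (lleg b \<cdot> snd_state a b \<cdot> h))"
    by (simp add: ports_comp[OF is_tset_tsum[OF ts(1,2)] par_legs(1) h] par_legs(2)
        comp_assoc_hom[OF h st(1) legs(1)] comp_assoc_hom[OF h st(2) legs(3)]
        ports_comp[OF ts(1) hom_comp[OF st(1) legs(1)] h]
        ports_comp[OF ts(2) hom_comp[OF st(2) legs(3)] h])
  show "ports (tsum (outp X) (outp Y)) (rleg (par X Y a b) \<cdot> h) =
      copair (ports (outp X) (rleg a \<cdot> fst_state a b \<cdot> h)) (ports (outp Y) (rleg b \<cdot> snd_state a b \<cdot> h))"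
    by (simp add: ports_comp[OF is_tset_tsum[OF ts(3,4)] par_legs(3) h] par_legs(4)
        comp_assoc_hom[OF h st(1) legs(2)] comp_assoc_hom[OF h st(2) legs(4)]
        ports_comp[OF ts(3) hom_comp[OF st(1) legs(2)] h]
        ports_comp[OF ts(4) hom_comp[OF st(2) legs(4)] h])
qed

end

text \<open>The box is an argument because the type of port names does not occur in the type of spans; it is
  applied to the empty box only.\<close>
definition unit_span :: "('u, 'o) box \<Rightarrow> ('o, 'm) span" where
  "unit_span I = Span (hat C (inp I)) (Id C (hat C (inp I))) (Id C (hat C (outp I)))"

lemma unit_span: "box_span (empty_box :: ('u, 'o) box) (unit_span (empty_box :: ('u, 'o) box))"
  using hat_in_Ob[of "Map.empty :: ('u, 'o) tset"]
  by (simp add: unit_span_def is_span_def is_tset_def hom_def)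

lemma unit_univ:
  assumes "Q \<in> Ob C"
  shows "\<exists>!h. h \<in> hom C Q (apex (unit_span (empty_box :: ('u, 'o) box)))"
  using hat_product[of "Map.empty :: ('u, 'o) tset"] assms
  by (simp add: unit_span_def is_product_def is_tset_def)

end

lemma span_category_sel [simp]:
  "Ob (span_category C A B) = {s. is_span C A B s}"
  "Id (span_category C A B) = (\<lambda>s. SpanMap s s (Id C (apex s)))"
  "Comp (span_category C A B) = (\<lambda>g f. SpanMap (sdom f) (scod g) (Comp C (smap g) (smap f)))"
  "Dom (span_category C A B) = sdom" "Cod (span_category C A B) = scod"
  by (simp_all add: span_category_def)

lemma span_hom:
  "f \<in> hom (span_category C A B) a b \<longleftrightarrow> sdom f = a \<and> scod f = b \<and> is_span C A B a \<and> is_span C A B b \<and>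
    smap f \<in> hom C (apex a) (apex b) \<and> Comp C (lleg b) (smap f) = lleg a \<and> Comp C (rleg b) (smap f) = rleg a"
  by (auto simp: hom_def span_category_def is_span_map_def)

context finitely_complete_category
begin

lemma category_spans: "category (span_category C A B)"
proof
  fix f g a b c
  assume f: "f \<in> hom (span_category C A B) a b" and g: "g \<in> hom (span_category C A B) b c"
  show "Comp (span_category C A B) g f \<in> hom (span_category C A B) a c"
    using f g unfolding span_hom by (auto simp: is_span_def comp_assoc_hom intro: hom_comp)
next
  fix f g h a b c d
  assume "f \<in> hom (span_category C A B) a b" "g \<in> hom (span_category C A B) b c"
    "h \<in> hom (span_category C A B) c d"
  then show "Comp (span_category C A B) (Comp (span_category C A B) h g) f =
    Comp (span_category C A B) h (Comp (span_category C A B) g f)"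
    unfolding span_hom by (auto simp: hom_def comp_assoc)
qed (auto simp: span_hom hom_def span_category_def is_span_map_def is_span_def intro: span_map.expand)

abbreviation spans :: "('u, 'o) box \<Rightarrow> (('o, 'm) span, ('o, 'm) span_map) cat" where
  "spans X \<equiv> span_category C (hat C (inp X)) (hat C (outp X))"

definition act_map :: "('u, 'o) wiring \<Rightarrow> ('o, 'm) span_map \<Rightarrow> ('o, 'm) span_map" where
  "act_map \<phi> f = SpanMap (act \<phi> (sdom f)) (act \<phi> (scod f))
    (THE h. h \<in> hom C (apex (act \<phi> (sdom f))) (apex (act \<phi> (scod f))) \<and>
      act_state \<phi> (scod f) \<cdot> h = smap f \<cdot> act_state \<phi> (sdom f) \<and>
      lleg (act \<phi> (scod f)) \<cdot> h = lleg (act \<phi> (sdom f)))"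

definition par_map ::
  "('u, 'o) box \<Rightarrow> ('u, 'o) box \<Rightarrow> ('o, 'm) span_map \<Rightarrow> ('o, 'm) span_map \<Rightarrow> ('o, 'm) span_map" where
  "par_map X Y f g = SpanMap (par X Y (sdom f) (sdom g)) (par X Y (scod f) (scod g))
    (THE h. h \<in> hom C (apex (par X Y (sdom f) (sdom g))) (apex (par X Y (scod f) (scod g))) \<and>
      fst_state (scod f) (scod g) \<cdot> h = smap f \<cdot> fst_state (sdom f) (sdom g) \<and>
      snd_state (scod f) (scod g) \<cdot> h = smap g \<cdot> snd_state (sdom f) (sdom g))"

text \<open>A map of spans preserves the port values of states, so it sends consistent pairs to
  consistent pairs and induces a map of the representing objects.\<close>
lemma act_map:
  assumes \<phi>: "is_wiring C \<phi>" and f: "f \<in> hom (spans (src \<phi>)) a b"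
  shows "act_map \<phi> f \<in> hom (spans (tgt \<phi>)) (act \<phi> a) (act \<phi> b)"
    "act_state \<phi> b \<cdot> smap (act_map \<phi> f) = smap f \<cdot> act_state \<phi> a"
proof -
  have ab: "box_span (src \<phi>) a" "box_span (src \<phi>) b" and fm: "smap f \<in> hom C (apex a) (apex b)"
    and fl: "lleg b \<cdot> smap f = lleg a" "rleg b \<cdot> smap f = rleg a" and sf: "sdom f = a" "scod f = b"
    using f by (auto simp: span_hom)
  have bl: "lleg b \<in> hom C (apex b) (hat C (inp (src \<phi>)))" "rleg b \<in> hom C (apex b) (hat C (outp (src \<phi>)))"
    using ab by (auto simp: is_span_def)
  note st = act_state_hom[OF \<phi> ab(1)]
  let ?A = "apex (act \<phi> a)" and ?B = "apex (act \<phi> b)"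
  have l: "lleg b \<cdot> smap f \<cdot> act_state \<phi> a = lleg a \<cdot> act_state \<phi> a"
    "rleg b \<cdot> smap f \<cdot> act_state \<phi> a = rleg a \<cdot> act_state \<phi> a"
    using fl comp_assoc_hom[OF st fm bl(1)] comp_assoc_hom[OF st fm bl(2)] by simp_all
  have "consistent \<phi> b ?A (smap f \<cdot> act_state \<phi> a) (lleg (act \<phi> a))"
    using act_consistent[OF \<phi> ab(1)] hom_comp[OF st fm] l by (simp add: consistent_def)
  from theI'[OF act_univ[OF \<phi> ab(2) this]]
  have h: "smap (act_map \<phi> f) \<in> hom C ?A ?B"
    "act_state \<phi> b \<cdot> smap (act_map \<phi> f) = smap f \<cdot> act_state \<phi> a"
    "lleg (act \<phi> b) \<cdot> smap (act_map \<phi> f) = lleg (act \<phi> a)"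
    by (simp_all add: act_map_def sf)
  show "act_state \<phi> b \<cdot> smap (act_map \<phi> f) = smap f \<cdot> act_state \<phi> a" by fact
  have "ports (outp (tgt \<phi>)) (rleg (act \<phi> b) \<cdot> smap (act_map \<phi> f)) =
      ports (outp (tgt \<phi>)) (rleg (act \<phi> a))"
    using act_state_out[OF \<phi> ab(2) h(1)] act_out(2)[OF \<phi> ab(1)] h(2) l by simp
  then have "rleg (act \<phi> b) \<cdot> smap (act_map \<phi> f) = rleg (act \<phi> a)"
    using ports_inject[OF wiring_tsets(4)[OF \<phi>] hom_comp[OF h(1) act_out(1)[OF \<phi> ab(2)]]
        act_out(1)[OF \<phi> ab(1)]] by blast
  then show "act_map \<phi> f \<in> hom (spans (tgt \<phi>)) (act \<phi> a) (act \<phi> b)"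
    using h act_span[OF \<phi> ab(1)] act_span[OF \<phi> ab(2)] by (simp add: span_hom, simp add: act_map_def sf)
qed

lemma par_map:
  assumes X: "is_box C X" and Y: "is_box C Y"
    and f: "f \<in> hom (spans X) a a'" and g: "g \<in> hom (spans Y) b b'"
  shows "par_map X Y f g \<in> hom (spans (box_sum X Y)) (par X Y a b) (par X Y a' b')"
    "fst_state a' b' \<cdot> smap (par_map X Y f g) = smap f \<cdot> fst_state a b"
    "snd_state a' b' \<cdot> smap (par_map X Y f g) = smap g \<cdot> snd_state a b"
proof -
  have sp: "box_span X a" "box_span X a'" "box_span Y b" "box_span Y b'"
    and m: "smap f \<in> hom C (apex a) (apex a')" "smap g \<in> hom C (apex b) (apex b')"
    and fl: "lleg a' \<cdot> smap f = lleg a" "rleg a' \<cdot> smap f = rleg a"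
    and gl: "lleg b' \<cdot> smap g = lleg b" "rleg b' \<cdot> smap g = rleg b"
    and sf: "sdom f = a" "scod f = a'" "sdom g = b" "scod g = b'"
    using f g by (auto simp: span_hom)
  have al: "lleg a' \<in> hom C (apex a') (hat C (inp X))" "rleg a' \<in> hom C (apex a') (hat C (outp X))"
    and bl: "lleg b' \<in> hom C (apex b') (hat C (inp Y))" "rleg b' \<in> hom C (apex b') (hat C (outp Y))"
    using sp by (auto simp: is_span_def)
  note st = par_states[OF X Y sp(1,3)]
  let ?A = "par X Y a b" and ?B = "par X Y a' b'"
  have l: "lleg a' \<cdot> smap f \<cdot> fst_state a b = lleg a \<cdot> fst_state a b"
    "rleg a' \<cdot> smap f \<cdot> fst_state a b = rleg a \<cdot> fst_state a b"
    "lleg b' \<cdot> smap g \<cdot> snd_state a b = lleg b \<cdot> snd_state a b"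
    "rleg b' \<cdot> smap g \<cdot> snd_state a b = rleg b \<cdot> snd_state a b"
    using fl gl comp_assoc_hom[OF st(1) m(1) al(1)] comp_assoc_hom[OF st(1) m(1) al(2)]
      comp_assoc_hom[OF st(2) m(2) bl(1)] comp_assoc_hom[OF st(2) m(2) bl(2)] by simp_all
  let ?h = "smap (par_map X Y f g)"
  from theI'[OF par_univ[OF X Y sp(2,4) hom_comp[OF st(1) m(1)] hom_comp[OF st(2) m(2)]]]
  have h: "?h \<in> hom C (apex ?A) (apex ?B)" "fst_state a' b' \<cdot> ?h = smap f \<cdot> fst_state a b"
    "snd_state a' b' \<cdot> ?h = smap g \<cdot> snd_state a b"
    by (simp_all add: par_map_def sf)
  show "fst_state a' b' \<cdot> ?h = smap f \<cdot> fst_state a b"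
    "snd_state a' b' \<cdot> ?h = smap g \<cdot> snd_state a b" by fact+
  have ts: "is_tset C (tsum (inp X) (inp Y))" "is_tset C (tsum (outp X) (outp Y))"
    using X Y by (auto simp: is_box_def is_tset_tsum)
  have "lleg ?B \<cdot> ?h = lleg ?A"
    by (rule ports_inject[OF ts(1) hom_comp[OF h(1) par_legs(1)[OF X Y sp(2,4)]]
          par_legs(1)[OF X Y sp(1,3)]])
      (simp add: par_at(1)[OF X Y sp(2,4) h(1)] h l par_legs(2)[OF X Y sp(1,3)])
  moreover have "rleg ?B \<cdot> ?h = rleg ?A"
    by (rule ports_inject[OF ts(2) hom_comp[OF h(1) par_legs(3)[OF X Y sp(2,4)]]
          par_legs(3)[OF X Y sp(1,3)]])
      (simp add: par_at(2)[OF X Y sp(2,4) h(1)] h l par_legs(4)[OF X Y sp(1,3)])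
  ultimately show "par_map X Y f g \<in> hom (spans (box_sum X Y)) ?A ?B"
    using h par_span[OF X Y sp(1,3)] par_span[OF X Y sp(2,4)]
    by (simp add: span_hom, simp add: par_map_def sf)
qed

end

section \<open>Formal expressions for spans\<close>

text \<open>Formal expressions for the spans that occur in the axioms. A variable carries its name, its box
  and the span that it denotes.\<close>
datatype ('u, 'o, 'm) expr =
    Var nat "('u, 'o) box" "('o, 'm) span"
  | Act "('u, 'o) wiring" "('u, 'o, 'm) expr"
  | Par "('u, 'o, 'm) expr" "('u, 'o, 'm) expr"
  | Unit

primrec vars :: "('u, 'o, 'm) expr \<Rightarrow> nat set" where
  "vars (Var n X a) = {n}"
| "vars (Act \<phi> t) = vars t"
| "vars (Par s t) = vars s \<union> vars t"
| "vars Unit = {}"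

primrec box_of :: "('u, 'o, 'm) expr \<Rightarrow> ('u, 'o) box" where
  "box_of (Var n X a) = X"
| "box_of (Act \<phi> t) = tgt \<phi>"
| "box_of (Par s t) = box_sum (box_of s) (box_of t)"
| "box_of Unit = empty_box"

primrec plug :: "(nat \<Rightarrow> ('u, 'o, 'm) expr) \<Rightarrow> ('u, 'o, 'm) expr \<Rightarrow> ('u, 'o, 'm) expr" where
  "plug \<sigma> (Var n X a) = \<sigma> n"
| "plug \<sigma> (Act \<phi> t) = Act \<phi> (plug \<sigma> t)"
| "plug \<sigma> (Par s t) = Par (plug \<sigma> s) (plug \<sigma> t)"
| "plug \<sigma> Unit = Unit"

primrec base :: "('u, 'o, 'm) expr \<Rightarrow> nat \<Rightarrow> 'o" where
  "base (Var k X a) n = apex a"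
| "base (Act \<phi> t) n = base t n"
| "base (Par s t) n = (if n \<in> vars s then base s n else base t n)"
| "base Unit n = undefined"

context finitely_complete_category
begin

text \<open>Variables may not be repeated: then a state of \<open>eval t\<close> projects to a single state of each variable.\<close>
primrec well_typed :: "('u, 'o, 'm) expr \<Rightarrow> bool" where
  "well_typed (Var n X a) \<longleftrightarrow> is_box C X \<and> box_span X a"
| "well_typed (Act \<phi> t) \<longleftrightarrow> is_wiring C \<phi> \<and> src \<phi> = box_of t \<and> well_typed t"
| "well_typed (Par s t) \<longleftrightarrow> well_typed s \<and> well_typed t \<and> vars s \<inter> vars t = {}"
| "well_typed Unit \<longleftrightarrow> True"

primrec eval :: "('u, 'o, 'm) expr \<Rightarrow> ('o, 'm) span" where
  "eval (Var n X a) = a"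
| "eval (Act \<phi> t) = act \<phi> (eval t)"
| "eval (Par s t) = par (box_of s) (box_of t) (eval s) (eval t)"
| "eval Unit = unit_span (empty_box :: ('u, 'o) box)"

primrec proj :: "('u, 'o, 'm) expr \<Rightarrow> nat \<Rightarrow> 'm" where
  "proj (Var k X a) n = Id C (apex a)"
| "proj (Act \<phi> t) n = proj t n \<cdot> act_state \<phi> (eval t)"
| "proj (Par s t) n = (if n \<in> vars s then proj s n \<cdot> fst_state (eval s) (eval t)
    else proj t n \<cdot> snd_state (eval s) (eval t))"
| "proj Unit n = undefined"

text \<open>The port values at the output of \<open>eval t\<close> when variable \<open>n\<close> is in the state \<open>e n\<close>. They do not
  depend on the values at the input.\<close>
primrec out_val :: "('u, 'o, 'm) expr \<Rightarrow> (nat \<Rightarrow> 'm) \<Rightarrow> ('u elt \<rightharpoonup> 'm)" where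
  "out_val (Var n X a) e = ports (outp X) (rleg a \<cdot> e n)"
| "out_val (Act \<phi> t) e = emit \<phi> (out_val t e)"
| "out_val (Par s t) e = copair (out_val s e) (out_val t e)"
| "out_val Unit e = Map.empty"

text \<open>The equations that states \<open>e\<close> of the variables and values \<open>i\<close> at the input ports must satisfy to
  come from a state of \<open>eval t\<close>. Wiring diagrams enter only through their strict
  action on values, so that expressions which are merely isomorphic as spans get equal equations.\<close>
primrec sat :: "('u, 'o, 'm) expr \<Rightarrow> 'o \<Rightarrow> (nat \<Rightarrow> 'm) \<Rightarrow> ('u elt \<rightharpoonup> 'm) \<Rightarrow> bool" where
  "sat (Var n X a) Q e i \<longleftrightarrow> e n \<in> hom C Q (apex a) \<and> ports (inp X) (lleg a \<cdot> e n) = i"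
| "sat (Act \<phi> t) Q e i \<longleftrightarrow> valuation Q (inp (tgt \<phi>)) i \<and> sat t Q e (feed \<phi> (out_val t e) i)"
| "sat (Par s t) Q e i \<longleftrightarrow> (\<exists>j k. i = copair j k \<and> sat s Q e j \<and> sat t Q e k)"
| "sat Unit Q e i \<longleftrightarrow> Q \<in> Ob C \<and> i = Map.empty"

lemma out_val_cong: "(\<And>n. n \<in> vars t \<Longrightarrow> e n = e' n) \<Longrightarrow> out_val t e = out_val t e'"
  by (induction t) auto

lemma sat_cong: "(\<And>n. n \<in> vars t \<Longrightarrow> e n = e' n) \<Longrightarrow> sat t Q e i = sat t Q e' i"
proof (induction t arbitrary: i)
  case (Act \<phi> t)
  then show ?case using out_val_cong[of t e e'] by simp
next
  case (Par s t)
  then show ?case by simp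
qed auto

lemma eval_span: "well_typed t \<Longrightarrow> is_box C (box_of t) \<and> box_span (box_of t) (eval t)"
proof (induction t)
  case (Act \<phi> t)
  then show ?case using act_span[of \<phi> "eval t"] is_wiring_boxes[of C \<phi>] by simp
next
  case (Par s t)
  then show ?case using par_span[of "box_of s" "box_of t" "eval s" "eval t"] by (simp add: is_box_sum)
next
  case Unit
  then show ?case by (simp add: unit_span is_box_empty del: empty_box_sel)
qed auto

lemma eval_legs:
  assumes "well_typed t"
  shows "lleg (eval t) \<in> hom C (apex (eval t)) (hat C (inp (box_of t)))"
    "rleg (eval t) \<in> hom C (apex (eval t)) (hat C (outp (box_of t)))"
    "is_tset C (inp (box_of t))" "is_tset C (outp (box_of t))" "apex (eval t) \<in> Ob C"
  using eval_span[OF assms] by (auto simp: is_span_def is_box_def)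

lemma act_state_eval:
  "well_typed (Act \<phi> t) \<Longrightarrow> act_state \<phi> (eval t) \<in> hom C (apex (eval (Act \<phi> t))) (apex (eval t))"
  using act_state_hom[of \<phi> "eval t"] eval_span[of t] by simp

lemma par_states_eval:
  assumes "well_typed (Par s t)"
  shows "fst_state (eval s) (eval t) \<in> hom C (apex (eval (Par s t))) (apex (eval s))"
    "snd_state (eval s) (eval t) \<in> hom C (apex (eval (Par s t))) (apex (eval t))"
  using par_states[of "box_of s" "box_of t" "eval s" "eval t"] eval_span[of s] eval_span[of t] assms
  by simp_all

lemma proj_hom: "well_typed t \<Longrightarrow> n \<in> vars t \<Longrightarrow> proj t n \<in> hom C (apex (eval t)) (base t n)"
proof (induction t)
  case (Var k X a)
  then show ?case by (simp add: is_span_def hom_def)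
next
  case (Act \<phi> t)
  then show ?case using act_state_eval[of \<phi> t] by (auto intro: hom_comp)
next
  case (Par s t)
  then show ?case using par_states_eval[of s t] by (auto intro: hom_comp)
qed auto

lemma proj_Act:
  assumes "well_typed (Act \<phi> t)" "n \<in> vars t" "h \<in> hom C Q (apex (eval (Act \<phi> t)))"
  shows "proj (Act \<phi> t) n \<cdot> h = proj t n \<cdot> act_state \<phi> (eval t) \<cdot> h"
  using comp_assoc_hom[OF assms(3) act_state_eval[OF assms(1)] proj_hom[of t n]] assms by simp

lemma proj_Par:
  assumes "well_typed (Par s t)" "h \<in> hom C Q (apex (eval (Par s t)))"
  shows "n \<in> vars s \<Longrightarrow> proj (Par s t) n \<cdot> h = proj s n \<cdot> fst_state (eval s) (eval t) \<cdot> h"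
    "n \<in> vars t \<Longrightarrow> proj (Par s t) n \<cdot> h = proj t n \<cdot> snd_state (eval s) (eval t) \<cdot> h"
  using comp_assoc_hom[OF assms(2) par_states_eval(1)[OF assms(1)] proj_hom[of s n]]
    comp_assoc_hom[OF assms(2) par_states_eval(2)[OF assms(1)] proj_hom[of t n]] assms(1) by auto

lemma out_val_proj:
  "well_typed t \<Longrightarrow> h \<in> hom C Q (apex (eval t)) \<Longrightarrow>
    out_val t (\<lambda>n. proj t n \<cdot> h) = ports (outp (box_of t)) (rleg (eval t) \<cdot> h)"
proof (induction t arbitrary: h)
  case (Var k X a)
  then show ?case by (simp add: hom_def)
next
  case (Act \<phi> t)
  let ?h = "act_state \<phi> (eval t) \<cdot> h"
  have h: "?h \<in> hom C Q (apex (eval t))"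
    using hom_comp[OF Act.prems(2) act_state_eval[OF Act.prems(1)]] .
  have "out_val t (\<lambda>n. proj (Act \<phi> t) n \<cdot> h) = out_val t (\<lambda>n. proj t n \<cdot> ?h)"
    by (rule out_val_cong) (use proj_Act Act.prems in blast)
  then show ?case
    using act_state_out[of \<phi> "eval t" h Q] Act h eval_span[of t] by simp
next
  case (Par s t)
  let ?h = "fst_state (eval s) (eval t) \<cdot> h" and ?h' = "snd_state (eval s) (eval t) \<cdot> h"
  have h: "?h \<in> hom C Q (apex (eval s))" "?h' \<in> hom C Q (apex (eval t))"
    using hom_comp[OF Par.prems(2)] par_states_eval[OF Par.prems(1)] by auto
  have "out_val s (\<lambda>n. proj (Par s t) n \<cdot> h) = out_val s (\<lambda>n. proj s n \<cdot> ?h)"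
    "out_val t (\<lambda>n. proj (Par s t) n \<cdot> h) = out_val t (\<lambda>n. proj t n \<cdot> ?h')"
    by (rule out_val_cong, use proj_Par Par.prems in blast)+
  then show ?case
    using par_at(2)[of "box_of s" "box_of t" "eval s" "eval t" h Q] Par h
      eval_span[of s] eval_span[of t] by simp
next
  case Unit
  then show ?case by (simp add: ports_def)
qed

text \<open>Every generalized element of the state object solves the equations; the consistency condition of
  each wiring diagram in the expression provides one step.\<close>
lemma sat_proj:
  "well_typed t \<Longrightarrow> h \<in> hom C Q (apex (eval t)) \<Longrightarrow>
    sat t Q (\<lambda>n. proj t n \<cdot> h) (ports (inp (box_of t)) (lleg (eval t) \<cdot> h))"
proof (induction t arbitrary: h)
  case (Var k X a)
  then show ?case by (simp add: hom_def)
next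
  case (Act \<phi> t)
  let ?h = "act_state \<phi> (eval t) \<cdot> h"
  have h: "?h \<in> hom C Q (apex (eval t))"
    using hom_comp[OF Act.prems(2) act_state_eval[OF Act.prems(1)]] .
  have "out_val t (\<lambda>n. proj (Act \<phi> t) n \<cdot> h) = out_val t (\<lambda>n. proj t n \<cdot> ?h)"
    "sat t Q (\<lambda>n. proj (Act \<phi> t) n \<cdot> h) i = sat t Q (\<lambda>n. proj t n \<cdot> ?h) i" for i
    by (rule out_val_cong sat_cong, use proj_Act Act.prems in blast)+
  moreover have "valuation Q (inp (tgt \<phi>)) (ports (inp (tgt \<phi>)) (lleg (eval (Act \<phi> t)) \<cdot> h))"
    using eval_legs[OF Act.prems(1)] Act.prems by (auto intro!: valuation_ports hom_comp)
  ultimately show ?case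
    using act_state_in[of \<phi> "eval t" h Q] Act.IH[OF _ h] Act.prems h eval_span[of t]
    by (simp add: out_val_proj)
next
  case (Par s t)
  let ?h = "fst_state (eval s) (eval t) \<cdot> h" and ?h' = "snd_state (eval s) (eval t) \<cdot> h"
  have h: "?h \<in> hom C Q (apex (eval s))" "?h' \<in> hom C Q (apex (eval t))"
    using hom_comp[OF Par.prems(2)] par_states_eval[OF Par.prems(1)] by auto
  have "sat s Q (\<lambda>n. proj (Par s t) n \<cdot> h) i = sat s Q (\<lambda>n. proj s n \<cdot> ?h) i"
    "sat t Q (\<lambda>n. proj (Par s t) n \<cdot> h) i = sat t Q (\<lambda>n. proj t n \<cdot> ?h') i" for i
    by (rule sat_cong, use proj_Par Par.prems in blast)+
  then show ?case
    using par_at(1)[of "box_of s" "box_of t" "eval s" "eval t" h Q] Par h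
      eval_span[of s] eval_span[of t] by simp
next
  case Unit
  then show ?case by (auto simp: ports_def dest: hom_Dom_in_Ob)
qed

text \<open>Conversely every solution comes from a generalized element, obtained by following the
  universal properties of the equalizers and products through the expression.\<close>
lemma sat_realized:
  "well_typed t \<Longrightarrow> sat t Q e i \<Longrightarrow> \<exists>h. h \<in> hom C Q (apex (eval t)) \<and>
    (\<forall>n \<in> vars t. proj t n \<cdot> h = e n) \<and> ports (inp (box_of t)) (lleg (eval t) \<cdot> h) = i"
proof (induction t arbitrary: i)
  case (Var k X a)
  then show ?case by (intro exI[of _ "e k"]) (auto simp: hom_def)
next
  case (Act \<phi> t)
  then obtain h where h: "h \<in> hom C Q (apex (eval t))" "\<forall>n \<in> vars t. proj t n \<cdot> h = e n"
    "ports (inp (box_of t)) (lleg (eval t) \<cdot> h) = feed \<phi> (out_val t e) i" by auto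
  have o': "out_val t e = ports (outp (box_of t)) (rleg (eval t) \<cdot> h)"
    using out_val_proj[of t h Q] out_val_cong[of t e "\<lambda>n. proj t n \<cdot> h"] h Act.prems by simp
  have ts: "is_tset C (inp (tgt \<phi>))" using Act.prems(1) wiring_tsets[of \<phi>] by simp
  have v: "valuation Q (inp (tgt \<phi>)) i" using Act.prems by simp
  have "consistent \<phi> (eval t) Q h (tuple Q (inp (tgt \<phi>)) i)"
    using h o' tuple[OF ts v] Act.prems by (simp add: consistent_def)
  then obtain k where k: "k \<in> hom C Q (apex (eval (Act \<phi> t)))" "act_state \<phi> (eval t) \<cdot> k = h"
    "lleg (eval (Act \<phi> t)) \<cdot> k = tuple Q (inp (tgt \<phi>)) i"
    using act_univ[of \<phi> "eval t" Q h "tuple Q (inp (tgt \<phi>)) i"] Act.prems eval_span[of t] by auto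
  have "proj (Act \<phi> t) n \<cdot> k = e n" if "n \<in> vars t" for n
    using proj_Act[OF Act.prems(1) that k(1)] k(2) h(2) that by simp
  then show ?case
    using k tuple[OF ts v] by (intro exI[of _ k]) simp
next
  case (Par s t)
  then obtain i1 i2 where i: "i = copair i1 i2" "sat s Q e i1" "sat t Q e i2" by auto
  obtain h1 where h1: "h1 \<in> hom C Q (apex (eval s))" "\<forall>n \<in> vars s. proj s n \<cdot> h1 = e n"
    "ports (inp (box_of s)) (lleg (eval s) \<cdot> h1) = i1" using Par.IH(1)[OF _ i(2)] Par.prems by auto
  obtain h2 where h2: "h2 \<in> hom C Q (apex (eval t))" "\<forall>n \<in> vars t. proj t n \<cdot> h2 = e n"
    "ports (inp (box_of t)) (lleg (eval t) \<cdot> h2) = i2" using Par.IH(2)[OF _ i(3)] Par.prems by auto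
  have sp: "is_box C (box_of s)" "is_box C (box_of t)" "box_span (box_of s) (eval s)"
    "box_span (box_of t) (eval t)"
    using eval_span[of s] eval_span[of t] Par.prems by auto
  obtain k where k: "k \<in> hom C Q (apex (eval (Par s t)))"
    "fst_state (eval s) (eval t) \<cdot> k = h1" "snd_state (eval s) (eval t) \<cdot> k = h2"
    using par_univ[OF sp h1(1) h2(1)] by auto
  have "proj (Par s t) n \<cdot> k = e n" if "n \<in> vars (Par s t)" for n
    using proj_Par[OF Par.prems(1) k(1), of n] k h1 h2 that by auto
  moreover have "ports (inp (box_of (Par s t))) (lleg (eval (Par s t)) \<cdot> k) = i"
    using par_at(1)[OF sp, of k Q] k h1 h2 i by simp
  ultimately show ?case using k(1) by blast
next
  case Unit
  then show ?case using unit_univ[of Q] by (auto simp: ports_def)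
qed

text \<open>The values at inner input ports are never remembered by the projections, but they
  are determined: outputs depend on the states of the variables only, and the consistency
  condition computes inner inputs from outputs and outer inputs.\<close>
lemma eval_jointly_monic:
  "\<lbrakk>well_typed t; h \<in> hom C Q (apex (eval t)); h' \<in> hom C Q (apex (eval t));
    \<And>n. n \<in> vars t \<Longrightarrow> proj t n \<cdot> h = proj t n \<cdot> h';
    ports (inp (box_of t)) (lleg (eval t) \<cdot> h) = ports (inp (box_of t)) (lleg (eval t) \<cdot> h')\<rbrakk> \<Longrightarrow>
    h = h'"
proof (induction t arbitrary: h h')
  case (Var k X a)
  then show ?case by (simp add: hom_def)
next
  case (Act \<phi> t)
  note wf = Act.prems(1) and h = Act.prems(2) and h' = Act.prems(3)
  let ?k = "act_state \<phi> (eval t) \<cdot> h" and ?k' = "act_state \<phi> (eval t) \<cdot> h'"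
  have wt: "well_typed t" "is_wiring C \<phi>" "box_of t = src \<phi>" "box_span (src \<phi>) (eval t)"
    using wf eval_span[of t] by auto
  have k: "?k \<in> hom C Q (apex (eval t))" "?k' \<in> hom C Q (apex (eval t))"
    using hom_comp[OF h act_state_eval[OF wf]] hom_comp[OF h' act_state_eval[OF wf]] by auto
  have p: "proj t n \<cdot> ?k = proj t n \<cdot> ?k'" if "n \<in> vars t" for n
    using Act.prems(4)[of n] proj_Act[OF wf that h] proj_Act[OF wf that h'] that by simp
  have "ports (outp (box_of t)) (rleg (eval t) \<cdot> ?k) = ports (outp (box_of t)) (rleg (eval t) \<cdot> ?k')"
    using out_val_proj[OF wt(1) k(1)] out_val_proj[OF wt(1) k(2)]
      out_val_cong[of t "\<lambda>n. proj t n \<cdot> ?k" "\<lambda>n. proj t n \<cdot> ?k'", OF p] by simp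
  then have lp: "ports (inp (box_of t)) (lleg (eval t) \<cdot> ?k) = ports (inp (box_of t)) (lleg (eval t) \<cdot> ?k')"
    using act_state_in[OF wt(2,4) h[unfolded eval.simps]]
      act_state_in[OF wt(2,4) h'[unfolded eval.simps]] Act.prems(5)
    unfolding wt(3) eval.simps box_of.simps by argo
  have eq: "?k = ?k'" by (rule Act.IH[OF wt(1) k]) (rule p lp, assumption?)+
  have l: "lleg (eval (Act \<phi> t)) \<cdot> h = lleg (eval (Act \<phi> t)) \<cdot> h'"
    using ports_inject[OF eval_legs(3)[OF wf] hom_comp[OF h eval_legs(1)[OF wf]]
        hom_comp[OF h' eval_legs(1)[OF wf]]] Act.prems(5) by blast
  have "consistent \<phi> (eval t) Q ?k (lleg (eval (Act \<phi> t)) \<cdot> h)"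
    using act_state_in[OF wt(2,4), of h Q] h k hom_comp[OF h eval_legs(1)[OF wf]]
    by (simp add: consistent_def)
  from act_univ[OF wt(2,4) this] show ?case using h h' eq l by auto
next
  case (Par s t)
  note wf = Par.prems(1) and h = Par.prems(2) and h' = Par.prems(3)
  let ?k = "fst_state (eval s) (eval t) \<cdot> h" and ?k' = "fst_state (eval s) (eval t) \<cdot> h'"
  let ?l = "snd_state (eval s) (eval t) \<cdot> h" and ?l' = "snd_state (eval s) (eval t) \<cdot> h'"
  have sp: "is_box C (box_of s)" "is_box C (box_of t)" "box_span (box_of s) (eval s)"
    "box_span (box_of t) (eval t)" and wst: "well_typed s" "well_typed t"
    using eval_span[of s] eval_span[of t] wf by auto
  note st = par_states_eval[OF wf]
  have k: "?k \<in> hom C Q (apex (eval s))" "?k' \<in> hom C Q (apex (eval s))"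
    and l: "?l \<in> hom C Q (apex (eval t))" "?l' \<in> hom C Q (apex (eval t))"
    using hom_comp[OF h] hom_comp[OF h'] st by auto
  have p: "proj s n \<cdot> ?k = proj s n \<cdot> ?k'" if "n \<in> vars s" for n
    using Par.prems(4)[of n] proj_Par(1)[OF wf h that] proj_Par(1)[OF wf h' that] that by simp
  have q: "proj t n \<cdot> ?l = proj t n \<cdot> ?l'" if "n \<in> vars t" for n
    using Par.prems(4)[of n] proj_Par(2)[OF wf h that] proj_Par(2)[OF wf h' that] that by simp
  have lp: "ports (inp (box_of s)) (lleg (eval s) \<cdot> ?k) = ports (inp (box_of s)) (lleg (eval s) \<cdot> ?k')"
    "ports (inp (box_of t)) (lleg (eval t) \<cdot> ?l) = ports (inp (box_of t)) (lleg (eval t) \<cdot> ?l')"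
    using Par.prems(5) par_at(1)[OF sp, of h Q] par_at(1)[OF sp, of h' Q] h h' by simp_all
  have "?k = ?k'" by (rule Par.IH(1)[OF wst(1) k]) (rule p lp, assumption?)+
  moreover have "?l = ?l'" by (rule Par.IH(2)[OF wst(2) l]) (rule q lp, assumption?)+
  ultimately show ?case using par_univ[OF sp k(1) l(1)] h h' by auto
next
  case Unit
  then show ?case using unit_univ[of Q] by (auto dest: hom_Dom_in_Ob)
qed

section \<open>Maps of spans compatible with the projections to the variables\<close>

text \<open>The map \<open>f\<close> acts on the state of variable \<open>n\<close> as \<open>g n\<close>. Coherence maps are those over identities;
  the others arise from functoriality and serve to prove naturality.\<close>
definition over ::
  "(nat \<Rightarrow> 'm) \<Rightarrow> ('u, 'o, 'm) expr \<Rightarrow> ('u, 'o, 'm) expr \<Rightarrow> ('o, 'm) span_map \<Rightarrow> bool" where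
  "over g s t f \<longleftrightarrow> well_typed s \<and> well_typed t \<and> box_of s = box_of t \<and> vars s = vars t \<and>
    f \<in> hom (spans (box_of t)) (eval s) (eval t) \<and>
    (\<forall>n \<in> vars t. g n \<in> hom C (base s n) (base t n) \<and> proj t n \<cdot> smap f = g n \<cdot> proj s n)"

definition coherent :: "('u, 'o, 'm) expr \<Rightarrow> ('u, 'o, 'm) expr \<Rightarrow> ('o, 'm) span_map \<Rightarrow> bool" where
  "coherent s t f \<longleftrightarrow> over (\<lambda>n. Id C (base s n)) s t f"

abbreviation scomp :: "('o, 'm) span_map \<Rightarrow> ('o, 'm) span_map \<Rightarrow> ('o, 'm) span_map" (infixr "\<bullet>" 55) where
  "g \<bullet> f \<equiv> SpanMap (sdom f) (scod g) (smap g \<cdot> smap f)"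

text \<open>A map of spans preserves input values, and its effect on the states of the variables is
  prescribed; together these determine it.\<close>
lemma over_unique:
  assumes f: "over g s t f" and f': "over g' s t f'" and g: "\<And>n. n \<in> vars t \<Longrightarrow> g n = g' n"
  shows "f = f'"
proof -
  have wf: "well_typed t" and h: "smap f \<in> hom C (apex (eval s)) (apex (eval t))"
    "smap f' \<in> hom C (apex (eval s)) (apex (eval t))"
    and l: "lleg (eval t) \<cdot> smap f = lleg (eval s)" "lleg (eval t) \<cdot> smap f' = lleg (eval s)"
    and sd: "sdom f = sdom f'" "scod f = scod f'"
    using f f' by (auto simp: over_def span_hom)
  have "smap f = smap f'"
    by (rule eval_jointly_monic[OF wf h]) (use f f' g l in \<open>auto simp: over_def\<close>)
  then show ?thesis using sd by (simp add: span_map.expand)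
qed

lemma over_comp:
  assumes f: "over g s t f" and f': "over g' t u f'"
  shows "over (\<lambda>n. g' n \<cdot> g n) s u (f' \<bullet> f)"
proof -
  have wf: "well_typed s" "well_typed t" "well_typed u" and eq: "box_of s = box_of u" "box_of t = box_of u"
    "vars s = vars u" "vars t = vars u"
    and fh: "f \<in> hom (spans (box_of u)) (eval s) (eval t)"
    and fh': "f' \<in> hom (spans (box_of u)) (eval t) (eval u)"
    using f f' by (auto simp: over_def)
  have "f' \<bullet> f \<in> hom (spans (box_of u)) (eval s) (eval u)"
    using category.Comp_in_hom[OF category_spans fh fh'] by simp
  moreover have "proj u n \<cdot> smap f' \<cdot> smap f = (g' n \<cdot> g n) \<cdot> proj s n"
    "g' n \<cdot> g n \<in> hom C (base s n) (base u n)" if n: "n \<in> vars u" for n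
  proof -
    have g: "g n \<in> hom C (base s n) (base t n)" "g' n \<in> hom C (base t n) (base u n)"
      and p: "proj t n \<cdot> smap f = g n \<cdot> proj s n" "proj u n \<cdot> smap f' = g' n \<cdot> proj t n"
      using f f' n eq by (auto simp: over_def)
    have h: "smap f \<in> hom C (apex (eval s)) (apex (eval t))"
      "smap f' \<in> hom C (apex (eval t)) (apex (eval u))"
      using fh fh' by (auto simp: span_hom)
    have ps: "proj s n \<in> hom C (apex (eval s)) (base s n)" "proj t n \<in> hom C (apex (eval t)) (base t n)"
      "proj u n \<in> hom C (apex (eval u)) (base u n)"
      using proj_hom wf n eq by auto
    have "proj u n \<cdot> smap f' \<cdot> smap f = (g' n \<cdot> proj t n) \<cdot> smap f"
      using comp_assoc_hom[OF h ps(3)] p by simp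
    also have "\<dots> = g' n \<cdot> g n \<cdot> proj s n"
      using comp_assoc_hom[OF h(1) ps(2) g(2)] p by simp
    finally show "proj u n \<cdot> smap f' \<cdot> smap f = (g' n \<cdot> g n) \<cdot> proj s n"
      using comp_assoc_hom[OF ps(1) g] by simp
    show "g' n \<cdot> g n \<in> hom C (base s n) (base u n)" using g by (rule hom_comp)
  qed
  ultimately show ?thesis using wf eq by (simp add: over_def)
qed

lemma over_cong:
  assumes "over g s t f" "\<And>n. n \<in> vars t \<Longrightarrow> g n = g' n" shows "over g' s t f"
  using assms by (auto simp: over_def)

lemma base_in_Ob: "well_typed t \<Longrightarrow> n \<in> vars t \<Longrightarrow> base t n \<in> Ob C"
  using proj_hom[of t n] cod_in_Ob[of "proj t n"] by (auto simp: hom_def)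

lemma base_eq: "over (\<lambda>n. Id C (base s n)) s t f \<Longrightarrow> n \<in> vars t \<Longrightarrow> base s n = base t n"
  using base_in_Ob[of s n] by (auto simp: over_def hom_def)

lemma over_comp_coherent:
  assumes f: "over g s t f" and f': "coherent t u f'" shows "over g s u (f' \<bullet> f)"
proof -
  have "Id C (base t n) \<cdot> g n = g n" if "n \<in> vars u" for n
    using f f' that by (auto simp: coherent_def over_def hom_def)
  then show ?thesis using over_cong[OF over_comp[OF f f'[unfolded coherent_def]]] by blast
qed

lemma coherent_comp_over:
  assumes f: "coherent s t f" and f': "over g t u f'" shows "over g s u (f' \<bullet> f)"
proof -
  have "g n \<cdot> Id C (base s n) = g n" if "n \<in> vars u" for n
    using base_eq[OF f[unfolded coherent_def], of n] f' that by (auto simp: over_def hom_def)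
  then show ?thesis using over_cong[OF over_comp[OF f[unfolded coherent_def] f']] by blast
qed

lemma coherent_comp: "coherent s t f \<Longrightarrow> coherent t u f' \<Longrightarrow> coherent s u (f' \<bullet> f)"
  using over_comp_coherent coherent_def by blast

lemma coherent_unique: "coherent s t f \<Longrightarrow> coherent s t f' \<Longrightarrow> f = f'"
  unfolding coherent_def by (rule over_unique) simp_all

text \<open>Both composites lie over \<open>g\<close>. This gives naturality of all coherence cells at once.\<close>
lemma naturality_square:
  assumes "over g s s' f" "over g t t' f'" "coherent s t \<theta>" "coherent s' t' \<theta>'"
  shows "f' \<bullet> \<theta> = \<theta>' \<bullet> f"
  using over_unique[OF coherent_comp_over[OF assms(3,2)] over_comp_coherent[OF assms(1,4)]] by simp

lemma coherent_id:
  assumes "well_typed t" shows "coherent t t (SpanMap (eval t) (eval t) (Id C (apex (eval t))))"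
proof -
  have "SpanMap (eval t) (eval t) (Id C (apex (eval t))) \<in> hom (spans (box_of t)) (eval t) (eval t)"
    using category.Id_in_hom[OF category_spans] eval_span[OF assms] by auto
  moreover have "proj t n \<cdot> Id C (apex (eval t)) = Id C (base t n) \<cdot> proj t n" if "n \<in> vars t" for n
    using proj_hom[OF assms that] by (auto simp: hom_def)
  ultimately show ?thesis
    using assms Id_in_hom[OF base_in_Ob[OF assms]] by (simp add: coherent_def over_def)
qed

lemma over_Var:
  assumes "is_box C X" "f \<in> hom (spans X) a b" "g n = smap f"
  shows "over g (Var n X a) (Var n X b) f"
  using assms by (auto simp: over_def span_hom) (auto simp: hom_def)

lemma over_Act:
  assumes f: "over g s t f" and \<phi>: "is_wiring C \<phi>" "src \<phi> = box_of t"
  shows "over g (Act \<phi> s) (Act \<phi> t) (act_map \<phi> f)"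
proof -
  have wf: "well_typed (Act \<phi> s)" "well_typed (Act \<phi> t)" and eq: "vars s = vars t" "box_of s = box_of t"
    and fh: "f \<in> hom (spans (src \<phi>)) (eval s) (eval t)"
    using f \<phi> by (auto simp: over_def)
  note m = act_map[OF \<phi>(1) fh]
  have mh: "smap (act_map \<phi> f) \<in> hom C (apex (eval (Act \<phi> s))) (apex (eval (Act \<phi> t)))"
    using m by (simp add: span_hom)
  have "proj (Act \<phi> t) n \<cdot> smap (act_map \<phi> f) = g n \<cdot> proj (Act \<phi> s) n" if n: "n \<in> vars t" for n
  proof -
    have fm: "smap f \<in> hom C (apex (eval s)) (apex (eval t))" using fh by (simp add: span_hom)
    have g: "g n \<in> hom C (base s n) (base t n)" "proj t n \<cdot> smap f = g n \<cdot> proj s n"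
      using f n by (auto simp: over_def)
    have ps: "proj s n \<in> hom C (apex (eval s)) (base s n)" "proj t n \<in> hom C (apex (eval t)) (base t n)"
      using wf proj_hom n eq by auto
    show ?thesis
      using proj_Act[OF wf(2) n mh] m(2) comp_assoc_hom[OF act_state_eval[OF wf(1)] fm ps(2)] g(2)
        comp_assoc_hom[OF act_state_eval[OF wf(1)] ps(1) g(1)] by simp
  qed
  then show ?thesis using f wf m(1) eq by (simp add: over_def)
qed

lemma over_Par:
  assumes f: "over g s t f" and f': "over g s' t' f'" and disj: "vars t \<inter> vars t' = {}"
  shows "over g (Par s s') (Par t t') (par_map (box_of t) (box_of t') f f')"
proof -
  let ?m = "par_map (box_of t) (box_of t') f f'"
  have wf: "well_typed (Par s s')" "well_typed (Par t t')" and eq: "vars s = vars t" "vars s' = vars t'"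
    "box_of s = box_of t" "box_of s' = box_of t'"
    and fh: "f \<in> hom (spans (box_of t)) (eval s) (eval t)"
    "f' \<in> hom (spans (box_of t')) (eval s') (eval t')"
    using f f' disj by (auto simp: over_def)
  have bx: "is_box C (box_of t)" "is_box C (box_of t')" using eval_span wf by auto
  note m = par_map[OF bx fh]
  have mh: "smap ?m \<in> hom C (apex (eval (Par s s'))) (apex (eval (Par t t')))"
    using m(1) eq by (simp add: span_hom)
  have fm: "smap f \<in> hom C (apex (eval s)) (apex (eval t))"
    "smap f' \<in> hom C (apex (eval s')) (apex (eval t'))" using fh by (auto simp: span_hom)
  note st = par_states_eval[OF wf(1)]
  have 1: "proj (Par t t') n \<cdot> smap ?m = g n \<cdot> proj (Par s s') n \<and>
      g n \<in> hom C (base (Par s s') n) (base (Par t t') n)" if n: "n \<in> vars t" for n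
  proof -
    have g: "g n \<in> hom C (base s n) (base t n)" "proj t n \<cdot> smap f = g n \<cdot> proj s n"
      using f n by (auto simp: over_def)
    have ps: "proj s n \<in> hom C (apex (eval s)) (base s n)" "proj t n \<in> hom C (apex (eval t)) (base t n)"
      using wf proj_hom n eq by auto
    show ?thesis
      using proj_Par(1)[OF wf(2) mh n] m(2) comp_assoc_hom[OF st(1) fm(1) ps(2)] g n eq
        comp_assoc_hom[OF st(1) ps(1) g(1)] by simp
  qed
  have 2: "proj (Par t t') n \<cdot> smap ?m = g n \<cdot> proj (Par s s') n \<and>
      g n \<in> hom C (base (Par s s') n) (base (Par t t') n)" if n: "n \<in> vars t'" for n
  proof -
    have n': "n \<notin> vars t" using n disj by auto
    have g: "g n \<in> hom C (base s' n) (base t' n)" "proj t' n \<cdot> smap f' = g n \<cdot> proj s' n"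
      using f' n by (auto simp: over_def)
    have ps: "proj s' n \<in> hom C (apex (eval s')) (base s' n)"
      "proj t' n \<in> hom C (apex (eval t')) (base t' n)"
      using wf proj_hom n eq by auto
    show ?thesis
      using proj_Par(2)[OF wf(2) mh n] m(3) comp_assoc_hom[OF st(2) fm(2) ps(2)] g n n' eq
        comp_assoc_hom[OF st(2) ps(1) g(1)] by simp
  qed
  have "proj (Par t t') n \<cdot> smap ?m = g n \<cdot> proj (Par s s') n \<and>
      g n \<in> hom C (base (Par s s') n) (base (Par t t') n)" if "n \<in> vars (Par t t')" for n
    using that 1[of n] 2[of n] unfolding vars.simps by blast
  then show ?thesis using wf eq m(1) by (auto simp: over_def simp del: proj.simps base.simps)
qed

lemma coherent_Act:
  assumes "coherent s t f" "is_wiring C \<phi>" "src \<phi> = box_of t"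
  shows "coherent (Act \<phi> s) (Act \<phi> t) (act_map \<phi> f)"
  using over_Act[OF assms[unfolded coherent_def]] by (simp add: coherent_def)

lemma coherent_Par:
  assumes f: "coherent s t f" and f': "coherent s' t' f'" and disj: "vars t \<inter> vars t' = {}"
  shows "coherent (Par s s') (Par t t') (par_map (box_of t) (box_of t') f f')"
proof -
  let ?g = "\<lambda>n. Id C (base (Par s s') n)"
  have "vars s = vars t" "vars s' = vars t'" using f f' by (auto simp: coherent_def over_def)
  then have "over ?g s t f" "over ?g s' t' f'"
    using f f' disj unfolding coherent_def by (auto elim!: over_cong)
  from over_Par[OF this disj] show ?thesis by (simp add: coherent_def)
qed

section \<open>Coherence isomorphisms between expressions\<close>

text \<open>The equations need only agree where the states and values have the right types, since other
  families satisfy the equations of neither expression.\<close>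
definition equivalent :: "('u, 'o, 'm) expr \<Rightarrow> ('u, 'o, 'm) expr \<Rightarrow> bool" where
  "equivalent s t \<longleftrightarrow> well_typed s \<and> well_typed t \<and> box_of s = box_of t \<and> vars s = vars t \<and>
    (\<forall>n \<in> vars t. base s n = base t n) \<and>
    (\<forall>Q e i. valuation Q (inp (box_of t)) i \<and> (\<forall>n \<in> vars t. e n \<in> hom C Q (base t n)) \<longrightarrow>
      (sat s Q e i \<longleftrightarrow> sat t Q e i) \<and> out_val s e = out_val t e)"

text \<open>Only compatibility with the left legs is demanded; for the right legs it follows because the
  output values agree.\<close>
definition coherence_map :: "('u, 'o, 'm) expr \<Rightarrow> ('u, 'o, 'm) expr \<Rightarrow> ('o, 'm) span_map" where
  "coherence_map s t = SpanMap (eval s) (eval t)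
    (THE h. h \<in> hom C (apex (eval s)) (apex (eval t)) \<and>
      (\<forall>n \<in> vars t. proj t n \<cdot> h = proj s n) \<and> lleg (eval t) \<cdot> h = lleg (eval s))"

lemma equivalent_sym: "equivalent s t \<Longrightarrow> equivalent t s"
  by (auto simp: equivalent_def)

text \<open>The projections and the left leg of \<open>eval s\<close> solve the equations of \<open>s\<close>, hence those of \<open>t\<close>, so
  they define an arrow from the apex of \<open>eval s\<close> to that of \<open>eval t\<close>.\<close>
lemma coherent_coherence_map:
  assumes eq: "equivalent s t" shows "coherent s t (coherence_map s t)"
proof -
  have wf: "well_typed s" "well_typed t" and eqs: "box_of s = box_of t" "vars s = vars t"
    and bs: "\<And>n. n \<in> vars t \<Longrightarrow> base s n = base t n"
    using eq by (auto simp: equivalent_def)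
  note ls = eval_legs[OF wf(1)] and lt = eval_legs[OF wf(2)]
  let ?A = "apex (eval s)" and ?B = "apex (eval t)" and ?i = "ports (inp (box_of t)) (lleg (eval s))"
  have id: "Id C ?A \<in> hom C ?A ?A" using ls(5) by (rule Id_in_hom)
  have pid: "proj s n \<cdot> Id C ?A = proj s n" if "n \<in> vars t" for n
    using proj_hom[OF wf(1)] that eqs by (auto simp: hom_def)
  have "sat s ?A (\<lambda>n. proj s n \<cdot> Id C ?A) ?i"
    using sat_proj[OF wf(1) id] ls(1) eqs by (simp add: hom_def)
  then have "sat s ?A (proj s) ?i"
    using sat_cong[of s "\<lambda>n. proj s n \<cdot> Id C ?A" "proj s"] pid eqs by simp
  moreover have "valuation ?A (inp (box_of t)) ?i" using valuation_ports[OF ls(3,1)] eqs by simp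
  moreover have "\<forall>n \<in> vars t. proj s n \<in> hom C ?A (base t n)"
    using proj_hom[OF wf(1)] eqs bs by auto
  ultimately have sat: "sat t ?A (proj s) ?i" and out: "out_val s (proj s) = out_val t (proj s)"
    using eq unfolding equivalent_def by blast+
  obtain h where h: "h \<in> hom C ?A ?B" "\<forall>n \<in> vars t. proj t n \<cdot> h = proj s n"
    "ports (inp (box_of t)) (lleg (eval t) \<cdot> h) = ?i"
    using sat_realized[OF wf(2) sat] by blast
  have l: "lleg (eval t) \<cdot> h = lleg (eval s)"
    using ports_inject[OF lt(3) hom_comp[OF h(1) lt(1)] ls(1)[unfolded eqs] h(3)] .
  have "coherence_map s t = SpanMap (eval s) (eval t) h"
    unfolding coherence_map_def span_map.inject
  proof (intro conjI refl the_equality)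
    fix h' assume "h' \<in> hom C ?A ?B \<and> (\<forall>n \<in> vars t. proj t n \<cdot> h' = proj s n) \<and>
      lleg (eval t) \<cdot> h' = lleg (eval s)"
    then show "h' = h" using h l by (intro eval_jointly_monic[OF wf(2), of h' ?A h]) auto
  qed (use h l in auto)
  moreover have "rleg (eval t) \<cdot> h = rleg (eval s)"
  proof (rule ports_inject[OF lt(4) hom_comp[OF h(1) lt(2)] ls(2)[unfolded eqs]])
    have "ports (outp (box_of t)) (rleg (eval t) \<cdot> h) = out_val t (\<lambda>n. proj t n \<cdot> h)"
      using out_val_proj[OF wf(2) h(1)] by simp
    also have "\<dots> = out_val t (proj s)" by (rule out_val_cong) (use h in blast)
    also have "\<dots> = out_val s (\<lambda>n. proj s n \<cdot> Id C ?A)"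
      unfolding out[symmetric] by (rule out_val_cong) (use pid eqs in simp)
    also have "\<dots> = ports (outp (box_of t)) (rleg (eval s))"
      using out_val_proj[OF wf(1) id] ls(2) eqs by (simp add: hom_def)
    finally show "ports (outp (box_of t)) (rleg (eval t) \<cdot> h) = ports (outp (box_of t)) (rleg (eval s))" .
  qed
  moreover have "Id C (base s n) \<cdot> proj s n = proj s n" "Id C (base s n) \<in> hom C (base s n) (base t n)"
    if "n \<in> vars t" for n
    using proj_hom[OF wf(1), of n] base_in_Ob[OF wf(1), of n] that eqs bs[OF that] by (auto simp: hom_def)
  ultimately show ?thesis
    using wf eqs h l eval_span[OF wf(1)] eval_span[OF wf(2)]
    by (simp add: coherent_def over_def span_hom)
qed

text \<open>The two composites commute with the projections, as do the identities, so uniqueness applies.\<close>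
lemma coherent_iso:
  assumes f: "coherent s t f" and f': "coherent t s f'" shows "is_iso (spans (box_of t)) f"
proof -
  have eq: "box_of s = box_of t" "well_typed s" "well_typed t" using f by (auto simp: coherent_def over_def)
  have h: "f \<in> hom (spans (box_of t)) (eval s) (eval t)" "f' \<in> hom (spans (box_of t)) (eval t) (eval s)"
    using f f' eq(1) by (auto simp: coherent_def over_def)
  have "f' \<bullet> f = SpanMap (eval s) (eval s) (Id C (apex (eval s)))"
    "f \<bullet> f' = SpanMap (eval t) (eval t) (Id C (apex (eval t)))"
    using coherent_unique[OF coherent_comp[OF f f'] coherent_id] 
      coherent_unique[OF coherent_comp[OF f' f] coherent_id] eq by auto
  moreover have "sdom f = eval s" "scod f = eval t" using h by (auto simp: span_hom)
  moreover have "f \<in> Arr (spans (box_of t))" using h by (auto simp: hom_def)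
  ultimately show ?thesis unfolding is_iso_def using h(2) by auto
qed

text \<open>The cells are defined for spans, that is for expressions with plain variables. In the
  axioms they occur at composite spans; substituting expressions with the right values for the
  variables transports coherence to these.\<close>
primrec fits :: "(nat \<Rightarrow> ('u, 'o, 'm) expr) \<Rightarrow> ('u, 'o, 'm) expr \<Rightarrow> bool" where
  "fits \<sigma> (Var n X a) \<longleftrightarrow> well_typed (\<sigma> n) \<and> box_of (\<sigma> n) = X \<and> eval (\<sigma> n) = a"
| "fits \<sigma> (Act \<phi> t) \<longleftrightarrow> fits \<sigma> t"
| "fits \<sigma> (Par s t) \<longleftrightarrow> fits \<sigma> s \<and> fits \<sigma> t"
| "fits \<sigma> Unit \<longleftrightarrow> True"

lemma vars_plug: "vars (plug \<sigma> t) = (\<Union>n \<in> vars t. vars (\<sigma> n))"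
  by (induction t) auto

lemma box_of_plug: "fits \<sigma> t \<Longrightarrow> box_of (plug \<sigma> t) = box_of t"
  by (induction t) auto

lemma eval_plug: "fits \<sigma> t \<Longrightarrow> eval (plug \<sigma> t) = eval t"
  by (induction t) (auto simp: box_of_plug)

lemma fits_vars:
  "well_typed t \<Longrightarrow> fits \<sigma> t \<Longrightarrow> n \<in> vars t \<Longrightarrow> well_typed (\<sigma> n) \<and> apex (eval (\<sigma> n)) = base t n"
  by (induction t) auto

lemma plug_projections:
  assumes "well_typed t" "fits \<sigma> t"
    and "\<And>n m. n \<in> vars t \<Longrightarrow> m \<in> vars t \<Longrightarrow> n \<noteq> m \<Longrightarrow> vars (\<sigma> n) \<inter> vars (\<sigma> m) = {}"
  shows "well_typed (plug \<sigma> t) \<and> (\<forall>n \<in> vars t. \<forall>m \<in> vars (\<sigma> n).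
    proj (plug \<sigma> t) m = proj (\<sigma> n) m \<cdot> proj t n \<and> base (plug \<sigma> t) m = base (\<sigma> n) m)"
  using assms
proof (induction t)
  case (Var k X a)
  then show ?case using proj_hom[of "\<sigma> k"] by (auto simp: hom_def)
next
  case (Act \<phi> t)
  then have IH: "well_typed (plug \<sigma> t)" "\<And>n m. n \<in> vars t \<Longrightarrow> m \<in> vars (\<sigma> n) \<Longrightarrow>
    proj (plug \<sigma> t) m = proj (\<sigma> n) m \<cdot> proj t n \<and> base (plug \<sigma> t) m = base (\<sigma> n) m" by auto
  have wf: "well_typed (Act \<phi> t)" "well_typed t" using Act.prems by auto
  have "(proj (\<sigma> n) m \<cdot> proj t n) \<cdot> act_state \<phi> (eval t) = proj (\<sigma> n) m \<cdot> proj t n \<cdot> act_state \<phi> (eval t)"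
    if "n \<in> vars t" "m \<in> vars (\<sigma> n)" for n m
    using comp_assoc_hom[OF act_state_eval[OF wf(1)] proj_hom[OF wf(2) that(1)], of "proj (\<sigma> n) m"]
      proj_hom[of "\<sigma> n" m] fits_vars[OF wf(2) _ that(1)] that Act.prems(2) by auto
  then show ?case using IH Act.prems by (auto simp: box_of_plug eval_plug)
next
  case (Par s t)
  then have IH: "well_typed (plug \<sigma> s)" "well_typed (plug \<sigma> t)" "\<And>n m. n \<in> vars s \<Longrightarrow> m \<in> vars (\<sigma> n) \<Longrightarrow>
    proj (plug \<sigma> s) m = proj (\<sigma> n) m \<cdot> proj s n \<and> base (plug \<sigma> s) m = base (\<sigma> n) m"
    "\<And>n m. n \<in> vars t \<Longrightarrow> m \<in> vars (\<sigma> n) \<Longrightarrow>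
    proj (plug \<sigma> t) m = proj (\<sigma> n) m \<cdot> proj t n \<and> base (plug \<sigma> t) m = base (\<sigma> n) m" by auto
  have wf: "well_typed (Par s t)" "well_typed s" "well_typed t" and fits: "fits \<sigma> s" "fits \<sigma> t" using Par.prems by auto
  have assoc: "n \<in> vars s \<Longrightarrow> m \<in> vars (\<sigma> n) \<Longrightarrow>
      (proj (\<sigma> n) m \<cdot> proj s n) \<cdot> fst_state (eval s) (eval t) =
      proj (\<sigma> n) m \<cdot> proj s n \<cdot> fst_state (eval s) (eval t)"
    "n \<in> vars t \<Longrightarrow> m \<in> vars (\<sigma> n) \<Longrightarrow>
      (proj (\<sigma> n) m \<cdot> proj t n) \<cdot> snd_state (eval s) (eval t) =
      proj (\<sigma> n) m \<cdot> proj t n \<cdot> snd_state (eval s) (eval t)" for n m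
    using comp_assoc_hom[OF par_states_eval(1)[OF wf(1)] proj_hom[OF wf(2)], of n "proj (\<sigma> n) m"]
      comp_assoc_hom[OF par_states_eval(2)[OF wf(1)] proj_hom[OF wf(3)], of n "proj (\<sigma> n) m"]
      proj_hom[of "\<sigma> n" m] fits_vars[OF wf(2) fits(1), of n] fits_vars[OF wf(3) fits(2), of n]
    by auto
  have disj: "vars (\<sigma> n) \<inter> vars (\<sigma> m) = {}" if "n \<in> vars s" "m \<in> vars t" for n m
    using that wf(1) by (intro Par.prems(3)) auto
  then have "vars (plug \<sigma> s) \<inter> vars (plug \<sigma> t) = {}"
    unfolding vars_plug by blast
  then have wf': "well_typed (plug \<sigma> (Par s t))" using IH by simp
  have "proj (plug \<sigma> (Par s t)) m = proj (\<sigma> n) m \<cdot> proj (Par s t) n \<and>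
      base (plug \<sigma> (Par s t)) m = base (\<sigma> n) m" if n: "n \<in> vars (Par s t)" "m \<in> vars (\<sigma> n)" for n m
  proof (cases "n \<in> vars s")
    case True
    then have "m \<in> vars (plug \<sigma> s)" using n by (auto simp: vars_plug)
    then show ?thesis using True IH n assoc fits by (simp add: eval_plug)
  next
    case False
    then have nt: "n \<in> vars t" using n by simp
    then have "m \<notin> vars (plug \<sigma> s)" using disj n by (auto simp: vars_plug)
    then show ?thesis using False nt IH n assoc fits by (simp add: eval_plug)
  qed
  then show ?case using wf' by blast
next
  case Unit
  then show ?case by simp
qed

text \<open>The projections of a substituted expression factor through those of the original one, so
  a map that commutes with the latter commutes with the former.\<close>
lemma coherent_plug:
  assumes f: "coherent s t f" and fits: "fits \<sigma> s" "fits \<sigma> t"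
    and disj: "\<And>n m. n \<in> vars t \<Longrightarrow> m \<in> vars t \<Longrightarrow> n \<noteq> m \<Longrightarrow> vars (\<sigma> n) \<inter> vars (\<sigma> m) = {}"
  shows "coherent (plug \<sigma> s) (plug \<sigma> t) f"
proof -
  have wf: "well_typed s" "well_typed t" and eq: "box_of s = box_of t" "vars s = vars t"
    and fh: "f \<in> hom (spans (box_of t)) (eval s) (eval t)"
    and p: "\<And>n. n \<in> vars t \<Longrightarrow> proj t n \<cdot> smap f = Id C (base s n) \<cdot> proj s n"
    using f by (auto simp: coherent_def over_def)
  note ss = plug_projections[OF wf(1) fits(1)] and st = plug_projections[OF wf(2) fits(2) disj]
  have "proj (plug \<sigma> t) m \<cdot> smap f = Id C (base (plug \<sigma> s) m) \<cdot> proj (plug \<sigma> s) m \<and>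
      Id C (base (plug \<sigma> s) m) \<in> hom C (base (plug \<sigma> s) m) (base (plug \<sigma> t) m)"
    if m: "m \<in> vars (plug \<sigma> t)" for m
  proof -
    obtain n where n: "n \<in> vars t" "m \<in> vars (\<sigma> n)" using m by (auto simp: vars_plug)
    have wn: "well_typed (\<sigma> n)" "apex (eval (\<sigma> n)) = base t n" using fits_vars[OF wf(2) fits(2) n(1)] by auto
    have fm: "smap f \<in> hom C (apex (eval s)) (apex (eval t))" using fh by (simp add: span_hom)
    have ps: "proj s n \<in> hom C (apex (eval s)) (base s n)" using proj_hom[OF wf(1)] n eq by simp
    have pn: "proj (\<sigma> n) m \<in> hom C (base t n) (base (\<sigma> n) m)" using proj_hom[OF wn(1) n(2)] wn by simp
    have b: "base s n = base t n" using base_eq f n by (auto simp: coherent_def)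
    have "(proj (\<sigma> n) m \<cdot> proj t n) \<cdot> smap f = proj (\<sigma> n) m \<cdot> proj s n"
      using comp_assoc_hom[OF fm proj_hom[OF wf(2) n(1)] pn] p[OF n(1)] ps by (simp add: hom_def)
    moreover have "proj (plug \<sigma> t) m = proj (\<sigma> n) m \<cdot> proj t n" "base (plug \<sigma> t) m = base (\<sigma> n) m"
      "proj (plug \<sigma> s) m = proj (\<sigma> n) m \<cdot> proj s n" "base (plug \<sigma> s) m = base (\<sigma> n) m"
      using ss st disj n eq by auto
    moreover have "Id C (base (\<sigma> n) m) \<cdot> proj (\<sigma> n) m \<cdot> proj s n = proj (\<sigma> n) m \<cdot> proj s n"
      using hom_comp[OF ps pn[folded b]] by (simp add: hom_def)
    ultimately show ?thesis using Id_in_hom[OF base_in_Ob[OF wn(1) n(2)]] by simp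
  qed
  moreover have "well_typed (plug \<sigma> s)" "well_typed (plug \<sigma> t)" using ss st disj eq by auto
  ultimately show ?thesis
    using fh eq fits by (simp add: coherent_def over_def box_of_plug eval_plug vars_plug)
qed

section \<open>The coherence cells\<close>

lemma dom_ports [simp]: "dom (ports X h) = dom X"
  by (auto simp: ports_def split: if_splits)

lemma valuation_tsum:
  "valuation Q (tsum X Y) i \<longleftrightarrow> (\<exists>j k. i = copair j k \<and> valuation Q X j \<and> valuation Q Y k)"
  using copairE[OF dom_valuation, of Q X Y i] valuation_copair by metis

lemma valuation_empty [simp]: "valuation Q Map.empty i \<longleftrightarrow> Q \<in> Ob C \<and> i = Map.empty"
  using dom_valuation[of Q Map.empty i] by (auto simp: valuation_def)

lemma valuation_rleg:
  "\<lbrakk>is_box C X; box_span X a; s \<in> hom C Q (apex a)\<rbrakk> \<Longrightarrow>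
    valuation Q (outp X) (ports (outp X) (rleg a \<cdot> s))"
  by (auto simp: is_box_def is_span_def intro!: valuation_ports hom_comp)

text \<open>For each of the seven kinds of cells the two expressions have the same equations; this is
  the strictness of the action on values.\<close>
lemma equivalent_comp:
  assumes "is_wiring C \<phi>" "is_wiring C \<psi>" "src \<psi> = tgt \<phi>" "box_span (src \<phi>) a"
  shows "equivalent (Act \<psi> (Act \<phi> (Var 0 (src \<phi>) a))) (Act (wiring_comp \<psi> \<phi>) (Var 0 (src \<phi>) a))"
proof -
  have "valuation Q (inp (tgt \<phi>)) (feed \<psi> (emit \<phi> (ports (outp (src \<phi>)) (rleg a \<cdot> s))) i)"
    if "valuation Q (inp (tgt \<psi>)) i" "s \<in> hom C Q (apex a)" for Q i s
    using valuation_feed[OF assms(2) _ that(1)] valuation_emit[OF assms(1)]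
      valuation_rleg[OF is_wiring_boxes(1)[OF assms(1)] assms(4) that(2)] assms(3) by metis
  then show ?thesis
    using assms by (auto simp: equivalent_def is_wiring_comp is_wiring_boxes dom_valuation)
qed

lemma equivalent_id:
  assumes "is_box C X" "box_span X a"
  shows "equivalent (Var 0 X a) (Act (wiring_id X) (Var 0 X a))"
  using assms by (auto simp: equivalent_def is_wiring_id dom_valuation)

lemma equivalent_mult:
  assumes "is_wiring C \<phi>" "is_wiring C \<psi>" "box_span (src \<phi>) a" "box_span (src \<psi>) b"
  shows "equivalent (Par (Act \<phi> (Var 0 (src \<phi>) a)) (Act \<psi> (Var 1 (src \<psi>) b)))
    (Act (wiring_sum \<phi> \<psi>) (Par (Var 0 (src \<phi>) a) (Var 1 (src \<psi>) b)))"
  using assms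
  by (auto simp: equivalent_def is_wiring_sum is_wiring_boxes valuation_tsum dom_valuation)

lemma equivalent_assoc:
  assumes "is_box C X" "box_span X a" "is_box C Y" "box_span Y b" "is_box C Z" "box_span Z c"
  shows "equivalent (Par (Var 0 X a) (Par (Var 1 Y b) (Var 2 Z c)))
    (Act (wassoc X Y Z) (Par (Par (Var 0 X a) (Var 1 Y b)) (Var 2 Z c)))"
  using assms
  by (auto simp: equivalent_def is_wiring_structure valuation_tsum dom_valuation act_structure)

lemma equivalent_lunit:
  assumes "is_box C X" "box_span X a"
  shows "equivalent (Var 0 X a) (Act (wlunit X) (Par Unit (Var 0 X a)))"
  using assms
  by (auto simp: equivalent_def is_wiring_structure dom_valuation act_structure valuation_def)

lemma equivalent_runit:
  assumes "is_box C X" "box_span X a"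
  shows "equivalent (Var 0 X a) (Act (wrunit X) (Par (Var 0 X a) Unit))"
  using assms
  by (auto simp: equivalent_def is_wiring_structure dom_valuation act_structure valuation_def)

lemma equivalent_braid:
  assumes "is_box C X" "box_span X a" "is_box C Y" "box_span Y b"
  shows "equivalent (Par (Var 1 Y b) (Var 0 X a)) (Act (wbraid X Y) (Par (Var 0 X a) (Var 1 Y b)))"
  using assms
  by (auto simp: equivalent_def is_wiring_structure valuation_tsum dom_valuation act_structure)

text \<open>The variable names \<open>0\<close>, \<open>1\<close>, \<open>2\<close> below are arbitrary as long as they are distinct.\<close>
definition comp_coh :: "('u, 'o) wiring \<Rightarrow> ('u, 'o) wiring \<Rightarrow> ('o, 'm) span \<Rightarrow> ('o, 'm) span_map" where
  "comp_coh \<psi> \<phi> a = coherence_map (Act \<psi> (Act \<phi> (Var 0 (src \<phi>) a)))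
    (Act (wiring_comp \<psi> \<phi>) (Var 0 (src \<phi>) a))"

definition id_coh :: "('u, 'o) box \<Rightarrow> ('o, 'm) span \<Rightarrow> ('o, 'm) span_map" where
  "id_coh X a = coherence_map (Var 0 X a) (Act (wiring_id X) (Var 0 X a))"

definition mult_coh ::
  "('u, 'o) wiring \<Rightarrow> ('u, 'o) wiring \<Rightarrow> ('o, 'm) span \<Rightarrow> ('o, 'm) span \<Rightarrow> ('o, 'm) span_map" where
  "mult_coh \<phi> \<psi> a b = coherence_map (Par (Act \<phi> (Var 0 (src \<phi>) a)) (Act \<psi> (Var 1 (src \<psi>) b)))
    (Act (wiring_sum \<phi> \<psi>) (Par (Var 0 (src \<phi>) a) (Var 1 (src \<psi>) b)))"

definition assoc_coh :: "('u, 'o) box \<Rightarrow> ('u, 'o) box \<Rightarrow> ('u, 'o) box \<Rightarrow>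
    ('o, 'm) span \<Rightarrow> ('o, 'm) span \<Rightarrow> ('o, 'm) span \<Rightarrow> ('o, 'm) span_map" where
  "assoc_coh X Y Z a b c = coherence_map (Par (Var 0 X a) (Par (Var 1 Y b) (Var 2 Z c)))
    (Act (wassoc X Y Z) (Par (Par (Var 0 X a) (Var 1 Y b)) (Var 2 Z c)))"

definition lunit_coh :: "('u, 'o) box \<Rightarrow> ('o, 'm) span \<Rightarrow> ('o, 'm) span_map" where
  "lunit_coh X a = coherence_map (Var 0 X a) (Act (wlunit X) (Par Unit (Var 0 X a)))"

definition runit_coh :: "('u, 'o) box \<Rightarrow> ('o, 'm) span \<Rightarrow> ('o, 'm) span_map" where
  "runit_coh X a = coherence_map (Var 0 X a) (Act (wrunit X) (Par (Var 0 X a) Unit))"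

definition braid_coh ::
  "('u, 'o) box \<Rightarrow> ('u, 'o) box \<Rightarrow> ('o, 'm) span \<Rightarrow> ('o, 'm) span \<Rightarrow> ('o, 'm) span_map" where
  "braid_coh X Y a b = coherence_map (Par (Var 1 Y b) (Var 0 X a))
    (Act (wbraid X Y) (Par (Var 0 X a) (Var 1 Y b)))"

text \<open>In the following rules the arguments of the cells are linked to the expressions by equations
  instead of being written as values. This makes them applicable to concrete spans when
  the source expression is known; the target expression is then computed.\<close>
lemma coherent_comp_coh:
  assumes "well_typed t" "is_wiring C \<phi>" "is_wiring C \<psi>" "src \<phi> = box_of t" "src \<psi> = tgt \<phi>" "a = eval t"
  shows "coherent (Act \<psi> (Act \<phi> t)) (Act (wiring_comp \<psi> \<phi>) t) (comp_coh \<psi> \<phi> a)"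
  using coherent_plug[OF coherent_coherence_map[OF equivalent_comp[of \<phi> \<psi> "eval t"]], of "\<lambda>_. t"]
    assms eval_span[of t] by (simp add: comp_coh_def)

lemma coherent_id_coh:
  assumes "well_typed t" "X = box_of t" "a = eval t"
  shows "coherent t (Act (wiring_id X) t) (id_coh X a)"
  using coherent_plug[OF coherent_coherence_map[OF equivalent_id[of X a]], of "\<lambda>_. t"]
    assms eval_span[of t] by (simp add: id_coh_def)

lemma coherent_mult_coh:
  assumes "well_typed s" "well_typed t" "vars s \<inter> vars t = {}" "is_wiring C \<phi>" "is_wiring C \<psi>"
    "src \<phi> = box_of s" "src \<psi> = box_of t" "a = eval s" "b = eval t"
  shows "coherent (Par (Act \<phi> s) (Act \<psi> t)) (Act (wiring_sum \<phi> \<psi>) (Par s t)) (mult_coh \<phi> \<psi> a b)"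
proof -
  let ?\<sigma> = "\<lambda>n :: nat. if n = 0 then s else t"
  have "coherent (plug ?\<sigma> s') (plug ?\<sigma> t') (coherence_map s' t')"
    if "equivalent s' t'" "fits ?\<sigma> s'" "fits ?\<sigma> t'" "vars t' \<subseteq> {0, 1}" for s' t'
    by (rule coherent_plug[OF coherent_coherence_map]) (use that assms in auto)
  from this[OF equivalent_mult[of \<phi> \<psi> a b]] show ?thesis
    using assms eval_span[of s] eval_span[of t] by (simp add: mult_coh_def)
qed

lemma coherent_assoc_coh:
  assumes "well_typed r" "well_typed s" "well_typed t" "vars r \<inter> vars s = {}" "vars r \<inter> vars t = {}" "vars s \<inter> vars t = {}"
    "X = box_of r" "Y = box_of s" "Z = box_of t" "a = eval r" "b = eval s" "c = eval t"
  shows "coherent (Par r (Par s t)) (Act (wassoc X Y Z) (Par (Par r s) t)) (assoc_coh X Y Z a b c)"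
proof -
  let ?\<sigma> = "\<lambda>n :: nat. if n = 0 then r else if n = 1 then s else t"
  have disj: "vars (?\<sigma> n) \<inter> vars (?\<sigma> m) = {}" if "n \<in> {0, 1, 2}" "m \<in> {0, 1, 2}" "n \<noteq> m" for n m :: nat
    using that assms by auto
  have "coherent (plug ?\<sigma> s') (plug ?\<sigma> t') (coherence_map s' t')"
    if "equivalent s' t'" "fits ?\<sigma> s'" "fits ?\<sigma> t'" "vars t' \<subseteq> {0, 1, 2}" for s' t'
    by (rule coherent_plug[OF coherent_coherence_map[OF that(1)] that(2,3)])
      (rule disj[OF subsetD[OF that(4)] subsetD[OF that(4)]])
  from this[OF equivalent_assoc[of X a Y b Z c]] show ?thesis
    using assms eval_span[of r] eval_span[of s] eval_span[of t] by (simp add: assoc_coh_def insert_commute)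
qed

lemma coherent_lunit_coh:
  assumes "well_typed t" "X = box_of t" "a = eval t"
  shows "coherent t (Act (wlunit X) (Par Unit t)) (lunit_coh X a)"
  using coherent_plug[OF coherent_coherence_map[OF equivalent_lunit[of X a]], of "\<lambda>_. t"]
    assms eval_span[of t] by (simp add: lunit_coh_def)

lemma coherent_runit_coh:
  assumes "well_typed t" "X = box_of t" "a = eval t"
  shows "coherent t (Act (wrunit X) (Par t Unit)) (runit_coh X a)"
  using coherent_plug[OF coherent_coherence_map[OF equivalent_runit[of X a]], of "\<lambda>_. t"]
    assms eval_span[of t] by (simp add: runit_coh_def)

lemma coherent_braid_coh:
  assumes "well_typed s" "well_typed t" "vars s \<inter> vars t = {}" "X = box_of s" "Y = box_of t" "a = eval s" "b = eval t"
  shows "coherent (Par t s) (Act (wbraid X Y) (Par s t)) (braid_coh X Y a b)"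
proof -
  let ?\<sigma> = "\<lambda>n :: nat. if n = 0 then s else t"
  have "coherent (plug ?\<sigma> s') (plug ?\<sigma> t') (coherence_map s' t')"
    if "equivalent s' t'" "fits ?\<sigma> s'" "fits ?\<sigma> t'" "vars t' \<subseteq> {0, 1}" for s' t'
    by (rule coherent_plug[OF coherent_coherence_map]) (use that assms in auto)
  from this[OF equivalent_braid[of X a Y b]] show ?thesis
    using assms eval_span[of s] eval_span[of t] by (simp add: braid_coh_def)
qed

lemma over_Par_eq:
  "\<lbrakk>over g s t f; over g s' t' f'; X = box_of t; Y = box_of t'; vars t \<inter> vars t' = {}\<rbrakk> \<Longrightarrow>
    over g (Par s s') (Par t t') (par_map X Y f f')"
  using over_Par by simp

lemma coherent_Par_eq:
  "\<lbrakk>coherent s t f; coherent s' t' f'; X = box_of t; Y = box_of t'; vars t \<inter> vars t' = {}\<rbrakk> \<Longrightarrow>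
    coherent (Par s s') (Par t t') (par_map X Y f f')"
  using coherent_Par by simp

lemma coherent_id_eq: "well_typed t \<Longrightarrow> a = eval t \<Longrightarrow> coherent t t (SpanMap a a (Id C (apex a)))"
  using coherent_id by simp

lemma over_Unit:
  fixes g :: "nat \<Rightarrow> 'm"
  defines "I \<equiv> unit_span (empty_box :: ('u, 'o) box)"
  shows "over g (Unit :: ('u, 'o, 'm) expr) Unit (SpanMap I I (Id C (apex I)))"
  using coherent_id_eq[of "Unit :: ('u, 'o, 'm) expr" I] by (auto simp: I_def coherent_def over_def)

lemmas coherent_rules = coherent_comp coherent_Act coherent_Par_eq coherent_id_eq
  coherent_comp_coh coherent_id_coh coherent_mult_coh coherent_assoc_coh coherent_lunit_coh
  coherent_runit_coh coherent_braid_coh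

lemmas over_rules = over_Act over_Par_eq over_Unit over_Var

section \<open>The algebra of spans\<close>

definition Spn :: "(('u, 'o) box, ('u, 'o) wiring, ('o, 'm) span, ('o, 'm) span_map) lax_data" where
  "Spn = \<lparr>cat_of = spans, fun_of = (\<lambda>\<phi>. \<lparr>on_ob = act \<phi>, on_arr = act_map \<phi>\<rparr>),
     comp_cell = comp_coh, id_cell = id_coh,
     mult = (\<lambda>X Y. \<lparr>on_ob = (\<lambda>(a, b). par X Y a b), on_arr = (\<lambda>(f, g). par_map X Y f g)\<rparr>),
     unit_fun = \<lparr>on_ob = (\<lambda>_. unit_span (empty_box :: ('u, 'o) box)),
       on_arr = (\<lambda>_. let I = unit_span (empty_box :: ('u, 'o) box) in SpanMap I I (Id C (apex I)))\<rparr>,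
     mult_cell = (\<lambda>\<phi> \<psi> (a, b). mult_coh \<phi> \<psi> a b),
     assoc_cell = (\<lambda>X Y Z (a, b, c). assoc_coh X Y Z a b c),
     lunit_cell = lunit_coh, runit_cell = runit_coh,
     braid_cell = (\<lambda>X Y (a, b). braid_coh X Y a b)\<rparr>"

lemma Spn_sel [simp]:
  "cat_of Spn X = spans X" "on_ob (fun_of Spn \<phi>) = act \<phi>" "on_arr (fun_of Spn \<phi>) = act_map \<phi>"
  "comp_cell Spn = comp_coh" "id_cell Spn = id_coh"
  "on_ob (mult Spn X Y) (a, b) = par X Y a b" "on_arr (mult Spn X Y) (f, g) = par_map X Y f g"
  "on_ob (unit_fun (Spn :: (('u, 'o) box, ('u, 'o) wiring, _, _) lax_data)) e =
    unit_span (empty_box :: ('u, 'o) box)"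
  "on_arr (unit_fun (Spn :: (('u, 'o) box, ('u, 'o) wiring, _, _) lax_data)) e =
    (let I = unit_span (empty_box :: ('u, 'o) box) in SpanMap I I (Id C (apex I)))"
  "mult_cell Spn \<phi> \<psi> (a, b) = mult_coh \<phi> \<psi> a b"
  "assoc_cell Spn X Y Z (a, b, c) = assoc_coh X Y Z a b c"
  "lunit_cell Spn = lunit_coh" "runit_cell Spn = runit_coh"
  "braid_cell Spn X Y (a, b) = braid_coh X Y a b"
  by (simp_all add: Spn_def)

lemma act_functor:
  assumes "is_wiring C \<phi>"
  shows "is_functor (spans (src \<phi>)) (spans (tgt \<phi>)) (fun_of Spn \<phi>)"
proof -
  let ?X = "src \<phi>"
  have X: "is_box C ?X" using assms by (rule is_wiring_boxes)
  have "act_map \<phi> (SpanMap a a (Id C (apex a))) =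
      SpanMap (act \<phi> a) (act \<phi> a) (Id C (apex (act \<phi> a)))" if "box_span ?X a" for a
    by (rule coherent_unique[of "Act \<phi> (Var 0 ?X a)"])
      (rule coherent_rules | use X assms that in simp; fail)+
  moreover have "act_map \<phi> (g \<bullet> f) = act_map \<phi> g \<bullet> act_map \<phi> f"
    if f: "f \<in> hom (spans ?X) a b" and g: "g \<in> hom (spans ?X) b c" for f g a b c
  proof -
    let ?A = "\<lambda>a. Var 0 ?X a"
    have gf: "g \<bullet> f \<in> hom (spans ?X) a c"
      using category.Comp_in_hom[OF category_spans f g] by simp
    have o': "over (\<lambda>_. smap h) (Act \<phi> (?A p)) (Act \<phi> (?A q)) (act_map \<phi> h)"
      if "h \<in> hom (spans ?X) p q" for h p q
      using that X assms by (intro over_rules) auto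
    show ?thesis by (rule over_unique[OF o'[OF gf] over_comp[OF o'[OF f] o'[OF g]]]) simp
  qed
  ultimately show ?thesis
    using act_span[OF assms] act_map(1)[OF assms]
    by (auto simp: is_functor_def category_spans)
qed

lemma par_functor:
  assumes "is_box C X" "is_box C Y"
  shows "is_functor (spans X \<times>\<^sub>C spans Y) (spans (box_sum X Y)) (mult Spn X Y)"
proof -
  have "par_map X Y (SpanMap a a (Id C (apex a))) (SpanMap b b (Id C (apex b))) =
      SpanMap (par X Y a b) (par X Y a b) (Id C (apex (par X Y a b)))"
    if "box_span X a" "box_span Y b" for a b
    by (rule coherent_unique[of "Par (Var 0 X a) (Var 1 Y b)"])
      (rule coherent_rules | use assms that in simp; fail)+
  moreover have "par_map X Y (g \<bullet> f) (g' \<bullet> f') = par_map X Y g g' \<bullet> par_map X Y f f'"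
    if f: "f \<in> hom (spans X) a b" and g: "g \<in> hom (spans X) b c"
      and f': "f' \<in> hom (spans Y) a' b'" and g': "g' \<in> hom (spans Y) b' c'"
    for f g f' g' a b c a' b' c'
  proof -
    have gf: "g \<bullet> f \<in> hom (spans X) a c" "g' \<bullet> f' \<in> hom (spans Y) a' c'"
      using category.Comp_in_hom[OF category_spans f g] category.Comp_in_hom[OF category_spans f' g']
      by simp_all
    have o': "over (\<lambda>n. if n = 0 then smap h else smap h') (Par (Var 0 X p) (Var 1 Y p'))
        (Par (Var 0 X q) (Var 1 Y q')) (par_map X Y h h')"
      if "h \<in> hom (spans X) p q" "h' \<in> hom (spans Y) p' q'" for h h' p q p' q'
      using that assms by (intro over_rules) auto
    show ?thesis
      by (rule over_unique[OF o'[OF gf] over_comp[OF o'[OF f f'] o'[OF g g']]]) simp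
  qed
  ultimately show ?thesis
    using par_span[OF assms] par_map(1)[OF assms]
    by (auto simp: is_functor_def category_spans category_prod_cat prod_cat_hom)
qed

lemma unit_functor: "is_functor one_cat (spans (empty_box :: ('u, 'o) box)) (unit_fun
    (Spn :: (('u, 'o) box, ('u, 'o) wiring, _, _) lax_data))"
proof -
  let ?I = "unit_span (empty_box :: ('u, 'o) box)"
  have I: "box_span (empty_box :: ('u, 'o) box) ?I" by (rule unit_span)
  then have "apex ?I \<in> Ob C" by (simp add: is_span_def)
  moreover have "SpanMap ?I ?I (Id C (apex ?I)) \<in> hom (spans (empty_box :: ('u, 'o) box)) ?I ?I"
    using category.Id_in_hom[OF category_spans, of ?I] I by simp
  ultimately show ?thesis
    using I unfolding is_functor_def
    by (auto simp: category_one category_spans Let_def simp del: empty_box_sel)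
qed

text \<open>Both functors are computed by families of expressions, of which the pairs at each object have the
  same equations. All naturality conditions for the cells are instances.\<close>
lemma nat_iso_of_coherence:
  assumes F: "is_functor D (spans X) F" and G: "is_functor D (spans X) G"
    and eq: "\<And>a. a \<in> Ob D \<Longrightarrow> equivalent (s a) (t a) \<and> box_of (t a) = X \<and>
      \<theta> a = coherence_map (s a) (t a) \<and> eval (s a) = on_ob F a \<and> eval (t a) = on_ob G a"
    and ov: "\<And>a b f. f \<in> hom D a b \<Longrightarrow>
      over (g f) (s a) (s b) (on_arr F f) \<and> over (g f) (t a) (t b) (on_arr G f)"
  shows "is_nat_iso D (spans X) F G \<theta>"
proof -
  have coh: "coherent (s a) (t a) (\<theta> a)" if "a \<in> Ob D" for a
    using coherent_coherence_map[of "s a" "t a"] eq[OF that] by simp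
  interpret D: category D using F by (simp add: is_functor_def)
  show ?thesis
    unfolding is_nat_iso_def
  proof (intro conjI ballI allI F G)
    fix a assume a: "a \<in> Ob D"
    show "\<theta> a \<in> hom (spans X) (on_ob F a) (on_ob G a)"
      using coh[OF a] eq[OF a] by (simp add: coherent_def over_def)
    show "is_iso (spans X) (\<theta> a)"
      using coherent_iso[OF coh[OF a] coherent_coherence_map[OF equivalent_sym]] eq[OF a] by simp
  next
    fix a b f assume f: "f \<in> hom D a b"
    then have "a \<in> Ob D" "b \<in> Ob D" using D.dom_in_Ob D.cod_in_Ob by (auto simp: hom_def)
    then show "Comp (spans X) (on_arr G f) (\<theta> a) = Comp (spans X) (\<theta> b) (on_arr F f)"
      using naturality_square[OF conjunct1[OF ov[OF f]] conjunct2[OF ov[OF f]] coh coh] by simp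
  qed
qed

lemma comp_nat_iso:
  assumes "is_wiring C \<phi>" "is_wiring C \<psi>" "src \<psi> = tgt \<phi>"
  shows "is_nat_iso (spans (src \<phi>)) (spans (tgt \<psi>)) (fun_of Spn \<psi> \<circ>\<^sub>F fun_of Spn \<phi>)
    (fun_of Spn (wiring_comp \<psi> \<phi>)) (comp_coh \<psi> \<phi>)"
proof (rule nat_iso_of_coherence[where s = "\<lambda>a. Act \<psi> (Act \<phi> (Var 0 (src \<phi>) a))"
      and t = "\<lambda>a. Act (wiring_comp \<psi> \<phi>) (Var 0 (src \<phi>) a)" and g = "\<lambda>f _. smap f"])
  show "is_functor (spans (src \<phi>)) (spans (tgt \<psi>)) (fun_of Spn \<psi> \<circ>\<^sub>F fun_of Spn \<phi>)"
    using functor_comp[OF act_functor[OF assms(1)]] act_functor[OF assms(2)] assms(3) by simp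
  show "is_functor (spans (src \<phi>)) (spans (tgt \<psi>)) (fun_of Spn (wiring_comp \<psi> \<phi>))"
    using act_functor[OF is_wiring_comp[OF assms]] by simp
  fix a assume "a \<in> Ob (spans (src \<phi>))"
  then show "equivalent (Act \<psi> (Act \<phi> (Var 0 (src \<phi>) a))) (Act (wiring_comp \<psi> \<phi>) (Var 0 (src \<phi>) a)) \<and>
    box_of (Act (wiring_comp \<psi> \<phi>) (Var 0 (src \<phi>) a)) = tgt \<psi> \<and>
    comp_coh \<psi> \<phi> a = coherence_map (Act \<psi> (Act \<phi> (Var 0 (src \<phi>) a)))
      (Act (wiring_comp \<psi> \<phi>) (Var 0 (src \<phi>) a)) \<and>
    eval (Act \<psi> (Act \<phi> (Var 0 (src \<phi>) a))) = on_ob (fun_of Spn \<psi> \<circ>\<^sub>F fun_of Spn \<phi>) a \<and>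
    eval (Act (wiring_comp \<psi> \<phi>) (Var 0 (src \<phi>) a)) = on_ob (fun_of Spn (wiring_comp \<psi> \<phi>)) a"
    using equivalent_comp[OF assms] by (simp add: comp_coh_def comp_func_def)
qed (use assms in \<open>auto simp: comp_func_def is_wiring_boxes is_wiring_comp intro!: over_rules\<close>)

lemma id_nat_iso:
  assumes X: "is_box C X"
  shows "is_nat_iso (spans X) (spans X) id_func (fun_of Spn (wiring_id X)) (id_coh X)"
proof (rule nat_iso_of_coherence[where s = "Var 0 X" and t = "\<lambda>a. Act (wiring_id X) (Var 0 X a)"
      and g = "\<lambda>f _. smap f"])
  show "is_functor (spans X) (spans X) (fun_of Spn (wiring_id X))"
    using act_functor[OF is_wiring_id[OF X]] by simp
qed (use X equivalent_id[OF X] in \<open>auto simp: id_coh_def id_func_def is_wiring_id category_spans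
    intro!: over_rules functor_id[unfolded id_func_def]\<close>)

lemma mult_nat_iso:
  assumes "is_wiring C \<phi>" "is_wiring C \<psi>"
  shows "is_nat_iso (spans (src \<phi>) \<times>\<^sub>C spans (src \<psi>)) (spans (box_sum (tgt \<phi>) (tgt \<psi>)))
    (mult Spn (tgt \<phi>) (tgt \<psi>) \<circ>\<^sub>F (fun_of Spn \<phi> \<times>\<^sub>F fun_of Spn \<psi>))
    (fun_of Spn (wiring_sum \<phi> \<psi>) \<circ>\<^sub>F mult Spn (src \<phi>) (src \<psi>)) (mult_cell Spn \<phi> \<psi>)"
proof (rule nat_iso_of_coherence[where
      s = "\<lambda>(a, b). Par (Act \<phi> (Var 0 (src \<phi>) a)) (Act \<psi> (Var 1 (src \<psi>) b))"
      and t = "\<lambda>(a, b). Act (wiring_sum \<phi> \<psi>) (Par (Var 0 (src \<phi>) a) (Var 1 (src \<psi>) b))"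
      and g = "\<lambda>(f, f') n. if n = 0 then smap f else smap f'"])
  note bx = is_wiring_boxes[OF assms(1)] is_wiring_boxes[OF assms(2)]
  show "is_functor (spans (src \<phi>) \<times>\<^sub>C spans (src \<psi>)) (spans (box_sum (tgt \<phi>) (tgt \<psi>)))
    (mult Spn (tgt \<phi>) (tgt \<psi>) \<circ>\<^sub>F (fun_of Spn \<phi> \<times>\<^sub>F fun_of Spn \<psi>))"
    by (rule functor_comp[OF functor_prod] act_functor par_functor assms bx)+
  show "is_functor (spans (src \<phi>) \<times>\<^sub>C spans (src \<psi>)) (spans (box_sum (tgt \<phi>) (tgt \<psi>)))
    (fun_of Spn (wiring_sum \<phi> \<psi>) \<circ>\<^sub>F mult Spn (src \<phi>) (src \<psi>))"
    using functor_comp[OF par_functor] act_functor[OF is_wiring_sum[OF assms]] bx by simp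
qed (use assms equivalent_mult[OF assms] in \<open>auto simp: mult_coh_def comp_func_def prod_func_def
    is_wiring_boxes is_wiring_sum prod_cat_hom intro!: over_rules\<close>)

lemma assoc_nat_iso:
  assumes "is_box C X" "is_box C Y" "is_box C Z"
  shows "is_nat_iso (spans X \<times>\<^sub>C spans Y \<times>\<^sub>C spans Z) (spans (box_sum X (box_sum Y Z)))
    (mult Spn X (box_sum Y Z) \<circ>\<^sub>F (id_func \<times>\<^sub>F mult Spn Y Z))
    (fun_of Spn (wassoc X Y Z) \<circ>\<^sub>F mult Spn (box_sum X Y) Z \<circ>\<^sub>F (mult Spn X Y \<times>\<^sub>F id_func)
      \<circ>\<^sub>F reassoc_func) (assoc_cell Spn X Y Z)"
proof (rule nat_iso_of_coherence[where
      s = "\<lambda>(a, b, c). Par (Var 0 X a) (Par (Var 1 Y b) (Var 2 Z c))"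
      and t = "\<lambda>(a, b, c). Act (wassoc X Y Z) (Par (Par (Var 0 X a) (Var 1 Y b)) (Var 2 Z c))"
      and g = "\<lambda>(f, f', f'') n. if n = 0 then smap f else if n = 1 then smap f' else smap f''"])
  have "is_functor (spans (src (wassoc X Y Z))) (spans (tgt (wassoc X Y Z))) (fun_of Spn (wassoc X Y Z))"
    by (intro act_functor is_wiring_structure assms)
  note w = this[unfolded structure_sel]
  show "is_functor (spans X \<times>\<^sub>C spans Y \<times>\<^sub>C spans Z) (spans (box_sum X (box_sum Y Z)))
    (fun_of Spn (wassoc X Y Z) \<circ>\<^sub>F mult Spn (box_sum X Y) Z \<circ>\<^sub>F (mult Spn X Y \<times>\<^sub>F id_func)
      \<circ>\<^sub>F reassoc_func)"
    by (rule functor_intros category_spans par_functor w assms is_box_sum)+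
  show "is_functor (spans X \<times>\<^sub>C spans Y \<times>\<^sub>C spans Z) (spans (box_sum X (box_sum Y Z)))
    (mult Spn X (box_sum Y Z) \<circ>\<^sub>F (id_func \<times>\<^sub>F mult Spn Y Z))"
    by (rule functor_intros category_spans par_functor is_box_sum assms)+
qed (use assms equivalent_assoc[OF assms(1) _ assms(2) _ assms(3)] in
    \<open>auto simp: assoc_coh_def comp_func_def prod_func_def id_func_def reassoc_func_def
    is_wiring_structure prod_cat_hom intro!: over_rules\<close>)

lemma lunit_nat_iso:
  fixes X :: "('u, 'o) box"
  assumes "is_box C X"
  shows "is_nat_iso (spans X) (spans X) id_func
    (fun_of Spn (wlunit X) \<circ>\<^sub>F mult Spn empty_box X \<circ>\<^sub>F (unit_fun (Spn :: (('u, 'o) box, ('u, 'o) wiring, _, _) lax_data) \<times>\<^sub>F id_func) \<circ>\<^sub>F left_one_func)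
    (lunit_coh X)"
proof (rule nat_iso_of_coherence[where
      s = "\<lambda>a. Var 0 X a" and t = "\<lambda>a. Act (wlunit X) (Par Unit (Var 0 X a))" and g = "\<lambda>f _. smap f"])
  have "is_functor (spans (src (wlunit X))) (spans (tgt (wlunit X))) (fun_of Spn (wlunit X))"
    by (intro act_functor is_wiring_structure assms)
  note w = this[unfolded structure_sel]
  show "is_functor (spans X) (spans X)
    (fun_of Spn (wlunit X) \<circ>\<^sub>F mult Spn empty_box X \<circ>\<^sub>F (unit_fun (Spn :: (('u, 'o) box, ('u, 'o) wiring, _, _) lax_data) \<times>\<^sub>F id_func) \<circ>\<^sub>F left_one_func)"
    by (rule functor_intros category_spans par_functor w assms unit_functor is_box_empty)+
qed (use assms equivalent_lunit[OF assms] in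
    \<open>auto simp: lunit_coh_def comp_func_def prod_func_def id_func_def left_one_func_def Let_def
    is_wiring_structure category_spans intro!: over_rules functor_id[unfolded id_func_def]\<close>)

lemma runit_nat_iso:
  fixes X :: "('u, 'o) box"
  assumes "is_box C X"
  shows "is_nat_iso (spans X) (spans X) id_func
    (fun_of Spn (wrunit X) \<circ>\<^sub>F mult Spn X empty_box \<circ>\<^sub>F (id_func \<times>\<^sub>F unit_fun (Spn :: (('u, 'o) box, ('u, 'o) wiring, _, _) lax_data)) \<circ>\<^sub>F right_one_func)
    (runit_coh X)"
proof (rule nat_iso_of_coherence[where
      s = "\<lambda>a. Var 0 X a" and t = "\<lambda>a. Act (wrunit X) (Par (Var 0 X a) Unit)" and g = "\<lambda>f _. smap f"])
  have "is_functor (spans (src (wrunit X))) (spans (tgt (wrunit X))) (fun_of Spn (wrunit X))"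
    by (intro act_functor is_wiring_structure assms)
  note w = this[unfolded structure_sel]
  show "is_functor (spans X) (spans X)
    (fun_of Spn (wrunit X) \<circ>\<^sub>F mult Spn X empty_box \<circ>\<^sub>F (id_func \<times>\<^sub>F unit_fun (Spn :: (('u, 'o) box, ('u, 'o) wiring, _, _) lax_data)) \<circ>\<^sub>F right_one_func)"
    by (rule functor_intros category_spans par_functor w assms unit_functor is_box_empty)+
qed (use assms equivalent_runit[OF assms] in
    \<open>auto simp: runit_coh_def comp_func_def prod_func_def id_func_def right_one_func_def Let_def
    is_wiring_structure category_spans intro!: over_rules functor_id[unfolded id_func_def]\<close>)

lemma braid_nat_iso:
  assumes "is_box C X" "is_box C Y"
  shows "is_nat_iso (spans X \<times>\<^sub>C spans Y) (spans (box_sum Y X)) (mult Spn Y X \<circ>\<^sub>F swap_func)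
    (fun_of Spn (wbraid X Y) \<circ>\<^sub>F mult Spn X Y) (braid_cell Spn X Y)"
proof (rule nat_iso_of_coherence[where
      s = "\<lambda>(a, b). Par (Var 1 Y b) (Var 0 X a)"
      and t = "\<lambda>(a, b). Act (wbraid X Y) (Par (Var 0 X a) (Var 1 Y b))"
      and g = "\<lambda>(f, f') n. if n = 0 then smap f else smap f'"])
  have "is_functor (spans (src (wbraid X Y))) (spans (tgt (wbraid X Y))) (fun_of Spn (wbraid X Y))"
    by (intro act_functor is_wiring_structure assms)
  note w = this[unfolded structure_sel]
  show "is_functor (spans X \<times>\<^sub>C spans Y) (spans (box_sum Y X))
      (fun_of Spn (wbraid X Y) \<circ>\<^sub>F mult Spn X Y)"
    by (rule functor_intros category_spans par_functor w assms)+
  show "is_functor (spans X \<times>\<^sub>C spans Y) (spans (box_sum Y X)) (mult Spn Y X \<circ>\<^sub>F swap_func)"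
    by (rule functor_intros category_spans par_functor assms)+
qed (use assms equivalent_braid[OF assms(1) _ assms(2)] in
    \<open>auto simp: braid_coh_def comp_func_def swap_func_def
    is_wiring_structure prod_cat_hom intro!: over_rules\<close>)

text \<open>Both sides of a coherence axiom are composites of cells. They start at the same expression, and
  end in the same expression up to the wiring diagram that acts outermost; the two wiring diagrams
  agree by the corresponding axiom of the category of wiring diagrams.\<close>
lemma coherence_eqI:
  "\<lbrakk>coherent s (Act \<phi> t) f; coherent s (Act \<phi>' t) f'; \<phi> = \<phi>'\<rbrakk> \<Longrightarrow> f = f'"
  using coherent_unique by blast

lemma wiring_hom_boxes:
  "\<phi> \<in> hom (wiring_category C) X Y \<longleftrightarrow>
    is_wiring C \<phi> \<and> src \<phi> = X \<and> tgt \<phi> = Y \<and> is_box C X \<and> is_box C Y"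
  using is_wiring_boxes by (auto simp: wiring_hom)

lemmas wiring_simps = wiring_hom_boxes is_wiring_comp is_wiring_sum is_wiring_structure is_wiring_id
  is_box_sum is_box_empty is_wiring_boxes

lemma pseudofunctor_Spn:
  "pseudofunctor (wiring_category C)
    (Spn :: (('u, 'o) box, ('u, 'o) wiring, ('o, 'm) span, ('o, 'm) span_map) lax_data)"
proof (intro pseudofunctor.intro pseudofunctor_to_Cat.intro category_wiring
    pseudofunctor_axioms.intro, goal_cases)
  case (1 X)
  then show ?case by (simp add: category_spans)
next
  case (2 \<phi> X Y)
  then show ?case using act_functor[of \<phi>] by (simp add: wiring_hom)
next
  case (3 \<phi> X Y \<psi> Z)
  then show ?case using comp_nat_iso[of \<phi> \<psi>] by (simp add: wiring_hom)
next
  case (4 X)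
  then show ?case using id_nat_iso[of X] by simp
next
  case (5 \<phi> X Y \<psi> Z \<chi> T a)
  have "wiring_comp \<chi> (wiring_comp \<psi> \<phi>) = wiring_comp (wiring_comp \<chi> \<psi>) \<phi>"
    using category.Comp_assoc[OF category_wiring 5(1-3)] by simp
  then show ?case
    using 5 unfolding Spn_sel span_category_sel wiring_category_sel
    by (intro coherence_eqI[where s = "Act \<chi> (Act \<psi> (Act \<phi> (Var 0 X a)))" and t = "Var 0 X a"])
      (rule coherent_rules | simp add: wiring_simps; fail)+
next
  case (6 \<phi> X Y a)
  have "wiring_comp \<phi> (wiring_id X) = \<phi>"
    using category.Comp_Id_right[OF category_wiring 6(1)] by simp
  then show ?case
    using 6 unfolding Spn_sel span_category_sel wiring_category_sel
    by (intro coherence_eqI[where s = "Act \<phi> (Var 0 X a)" and t = "Var 0 X a"])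
      (rule coherent_rules | simp add: wiring_simps; fail)+
next
  case (7 \<phi> X Y a)
  have "wiring_comp (wiring_id Y) \<phi> = \<phi>"
    using category.Comp_Id_left[OF category_wiring 7(1)] by simp
  then show ?case
    using 7 unfolding Spn_sel span_category_sel wiring_category_sel
    by (intro coherence_eqI[where s = "Act \<phi> (Var 0 X a)" and t = "Var 0 X a"])
      (rule coherent_rules | simp add: wiring_simps; fail)+
qed

lemma pseudofunctor_with_mult_Spn:
  "pseudofunctor_with_mult (wiring_category C)
    (Spn :: (('u, 'o) box, ('u, 'o) wiring, ('o, 'm) span, ('o, 'm) span_map) lax_data)"
proof (intro pseudofunctor_with_mult.intro symmetric_monoidal_wiring pseudofunctor_Spn
    pseudofunctor_with_mult_axioms.intro, goal_cases)
  case (1 X Y)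
  then show ?case using par_functor[of X Y] by simp
next
  case 2
  show ?case using unit_functor[where 'u = 'u] by simp
next
  case (3 \<phi> X X' \<psi> Y Y')
  then show ?case using mult_nat_iso[of \<phi> \<psi>] by (auto simp: wiring_hom)
qed

text \<open>For each axiom one supplies the source expression \<open>s\<close>, the expression \<open>t\<close> on which the composite
  wiring diagram acts, and the equation between wiring diagrams over which the axiom lies;
  closure of coherent maps under the operations does the rest.\<close>
theorem symmetric_lax_monoidal_Spn:
  "wiring_algebra C
    (Spn :: (('u, 'o) box, ('u, 'o) wiring, ('o, 'm) span, ('o, 'm) span_map) lax_data)"
proof -
  interpret V: symmetric_monoidal "wiring_category C :: (('u, 'o) box, ('u, 'o) wiring) moncat"
    by (rule symmetric_monoidal_wiring)
  note whisker = pseudofunctor_with_mult.whisker_left_def[OF pseudofunctor_with_mult_Spn]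
    pseudofunctor_with_mult.whisker_right_def[OF pseudofunctor_with_mult_Spn]
  note sel = whisker Spn_sel span_category_sel wiring_category_sel
  show ?thesis
  proof (intro symmetric_lax_monoidal_pseudofunctor.intro pseudofunctor_with_mult_Spn
      symmetric_lax_monoidal_pseudofunctor_axioms.intro, goal_cases)
    case (1 \<phi> X X' \<phi>' X'' \<psi> Y Y' \<psi>' Y'' a b)
    have "wiring_sum (wiring_comp \<phi>' \<phi>) (wiring_comp \<psi>' \<psi>) =
        wiring_comp (wiring_sum \<phi>' \<psi>') (wiring_sum \<phi> \<psi>)"
      using 1 by (intro wiring_sum_comp[of C]) (auto simp: wiring_hom)
    then show ?case
      using 1 unfolding sel
      by (intro coherence_eqI[where t = "Par (Var 0 X a) (Var 1 Y b)"
            and s = "Par (Act \<phi>' (Act \<phi> (Var 0 X a))) (Act \<psi>' (Act \<psi> (Var 1 Y b)))"])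
        (rule coherent_rules | simp add: wiring_simps; fail)+
  next
    case (2 X Y a b)
    then have "wiring_sum (wiring_id X) (wiring_id Y) = wiring_id (box_sum X Y)"
      by (intro wiring_sum_id[of C]) auto
    then show ?case
      using 2 unfolding sel
      by (intro coherence_eqI[where t = "Par (Var 0 X a) (Var 1 Y b)"
            and s = "Par (Var 0 X a) (Var 1 Y b)"])
        (rule coherent_rules | simp add: wiring_simps; fail)+
  next
    case (3 X Y Z)
    then show ?case using assoc_nat_iso[of X Y Z] by simp
  next
    case (4 X)
    then show ?case using lunit_nat_iso[of X] by simp
  next
    case (5 X)
    then show ?case using runit_nat_iso[of X] by simp
  next
    case (6 X Y)
    then show ?case using braid_nat_iso[of X Y] by simp
  next
    case (7 \<phi> X X' \<psi> Y Y' \<chi> Z Z' a b c U m)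
    from V.assoc_natural[OF 7(1-3)] show ?case
      using 7 unfolding sel 7(7,8)
      by (intro coherence_eqI[where t = "Par (Par (Var 0 X a) (Var 1 Y b)) (Var 2 Z c)"
            and s = "Par (Act \<phi> (Var 0 X a)) (Par (Act \<psi> (Var 1 Y b)) (Act \<chi> (Var 2 Z c)))"])
        (rule coherent_rules | simp add: wiring_simps; fail)+
  next
    case (8 \<phi> X X' a m)
    from V.lunit_natural[OF 8(1)] show ?case
      using 8 unfolding sel 8(3)
      by (intro coherence_eqI[where t = "Par Unit (Var 0 X a)" and s = "Act \<phi> (Var 0 X a)"])
        (rule coherent_rules | simp add: wiring_simps; fail)+
  next
    case (9 \<phi> X X' a m)
    from V.runit_natural[OF 9(1)] show ?case
      using 9 unfolding sel 9(3)
      by (intro coherence_eqI[where t = "Par (Var 0 X a) Unit" and s = "Act \<phi> (Var 0 X a)"])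
        (rule coherent_rules | simp add: wiring_simps; fail)+
  next
    case (10 \<phi> X X' \<psi> Y Y' a b U m)
    from V.braid_natural[OF 10(1,2)] show ?case
      using 10 unfolding sel 10(5,6)
      by (intro coherence_eqI[where t = "Par (Var 0 X a) (Var 1 Y b)"
            and s = "Par (Act \<psi> (Var 1 Y b)) (Act \<phi> (Var 0 X a))"])
        (rule coherent_rules | simp add: wiring_simps; fail)+
  next
    case (11 X Y Z T a b c d U \<alpha> \<alpha>' \<beta> \<beta>' \<beta>'' abc m)
    from V.pentagon[OF 11(1-4)] show ?case
      using 11(1-8) unfolding 11(9-16) unfolding sel
      by (intro coherence_eqI[where t = "Par (Par (Par (Var 0 X a) (Var 1 Y b)) (Var 2 Z c)) (Var 3 T d)"
            and s = "Par (Var 0 X a) (Par (Var 1 Y b) (Par (Var 2 Z c) (Var 3 T d)))"])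
        (rule coherent_rules | simp add: wiring_simps; fail)+
  next
    case (12 X Y a b I U m)
    from V.triangle[OF 12(1,2)] show ?case
      using 12(1-4) unfolding 12(5-7) unfolding sel
      by (intro coherence_eqI[where t = "Par (Par (Var 0 X a) Unit) (Var 1 Y b)"
            and s = "Par (Var 0 X a) (Var 1 Y b)"])
        (rule coherent_rules | simp add: wiring_simps; fail)+
  next
    case (13 X Y Z a b c U \<alpha> \<alpha>' \<alpha>'' \<beta> \<beta>' \<beta>'' m)
    from V.hexagon[OF 13(1-3)] show ?case
      using 13(1-6) unfolding 13(7-14) unfolding sel
      by (intro coherence_eqI[where t = "Par (Par (Var 0 X a) (Var 1 Y b)) (Var 2 Z c)"
            and s = "Par (Var 1 Y b) (Par (Var 2 Z c) (Var 0 X a))"])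
        (rule coherent_rules | simp add: wiring_simps; fail)+
  next
    case (14 X Y a b U)
    from V.symmetry[OF 14(1,2)] show ?case
      using 14(1-4) unfolding 14(5) unfolding sel
      by (intro coherence_eqI[where t = "Par (Var 0 X a) (Var 1 Y b)"
            and s = "Par (Var 0 X a) (Var 1 Y b)"])
        (rule coherent_rules | simp add: wiring_simps; fail)+
  qed
qed

end

theorem proposition2p4p1:
  fixes C :: "('o, 'm) cat"
  assumes "category C" and "finitely_complete C"
  shows "\<exists>Spn :: (('u, 'o) box, ('u, 'o) wiring, ('o, 'm) span, ('o, 'm) span_map) lax_data.
    wiring_algebra C Spn \<and>
    (\<forall>X \<in> Ob (wiring_category C).
      cat_of Spn X = span_category C (hat C (inp X)) (hat C (outp X)))"
proof -
  interpret finitely_complete_category C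
    using assms by (intro finitely_complete_category.intro finitely_complete_category_axioms.intro)
  show ?thesis using symmetric_lax_monoidal_Spn Spn_sel(1) by blast
qed

end
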